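(* Let $k$ be an algebraically closed field of prime characteristic $p>0$, let $V$ be a $d$-dimensional $k$-vector space, and let $G\subset \mathrm{GL}(V)$ be a finite subgroup whose order is not divisible by $p$ and which contains no pseudo-reflections. Let $S=\mathrm{Sym}(V)$ and $R=S^G$. Let $V_0=k,V_1,\dots,V_n$ be a complete set of pairwise non-isomorphic irreducible representations of $G$ over $k$, and set $M_i=(S\otimes_k V_i)^G$ for $i=0,\dots,n$. For $e\in\mathbb{N}$ let $c_{0,e},\dots,c_{n,e}$ be the multiplicities in the decomposition of $R$-modules ${}^eR\cong M_0^{\oplus c_{0,e}}\oplus M_1^{\oplus c_{1,e}}\oplus\cdots\oplus M_n^{\oplus c_{n,e}}$, and let $s(R,M_i)=\lim_{e\to\infty} c_{i,e}/p^{de}$. Then for all $i=0,\dots,n$, $$s(R,M_i)=\frac{\dim_k V_i}{|G|}=\frac{\operatorname{rank}_R M_i}{|G|}.$$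
   Context: A pseudo-reflection is an element $g\in \mathrm{GL}(V)$, $g\neq 1$, of finite order that fixes a hyperplane of $V$ pointwise. The group $G$ acts on $S=\mathrm{Sym}(V)$ (a polynomial ring in $d$ variables over $k$) by $k$-algebra automorphisms extending its action on $V$; $V_0=k$ denotes the trivial representation. $G$ acts diagonally on $S\otimes_k V_i$, and $(S\otimes_k V_i)^G$ is an $R$-module via multiplication on the factor $S$; $M_0\cong R$. For an $R$-module $M$ and $e\in\mathbb{N}$, ${}^eM$ denotes the abelian group $M$ with the $R$-module structure $r\cdot m=r^{p^e}m$ (pull-back along the $e$-th iterated Frobenius map). It is known that for each $e$ the $R$-module ${}^eR$ is isomorphic to a finite direct sum of copies of $M_0,\dots,M_n$; the multiplicities $c_{i,e}$ are uniquely determined, and the limit $\lim_{e\to\infty}c_{i,e}/p^{de}$ exists. This limit $s(R,M_i)$ is called the generalized $F$-signature of $M_i$ with respect to $R$. *)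

theory Defs
  imports
    Complex_Main
    "HOL-Algebra.Algebra"
    "HOL-Computational_Algebra.Polynomial"
    "HOL-Library.Poly_Mapping"
begin

section \<open>Linear groups and pseudo-reflections\<close>

text \<open>
  Vector spaces over the field \<open>'k\<close> are given by a scalar multiplication satisfying the locale
  \<^locale>\<open>vector_space\<close>; the space \<open>V\<close> is the whole type \<open>'v\<close>, which may be the zero space.
\<close>

definition GL :: "('k::field \<Rightarrow> 'v::ab_group_add \<Rightarrow> 'v) \<Rightarrow> ('v \<Rightarrow> 'v) monoid" where
  "GL sV = \<lparr>carrier = {g. Vector_Spaces.linear sV sV g \<and> bij g}, monoid.mult = (\<circ>), one = id\<rparr>"

definition pseudo_reflection :: "('k::field \<Rightarrow> 'v::ab_group_add \<Rightarrow> 'v) \<Rightarrow> ('v \<Rightarrow> 'v) \<Rightarrow> bool" where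
  "pseudo_reflection sV g \<longleftrightarrow>
     g \<in> carrier (GL sV) \<and> g \<noteq> id \<and> (\<exists>m>0. (g ^^ m) = id) \<and>
     (\<exists>H. module.subspace sV H \<and> vector_space.dim sV H + 1 = vector_space.dim sV UNIV \<and>
          (\<forall>x\<in>H. g x = x))"


section \<open>Representations of a group of linear maps\<close>

text \<open>
  A representation is carried by a subspace \<open>U\<close> of an ambient vector space, so that a family of
  representations of different dimensions can live in a single type. The values of \<open>\<rho> g\<close> outside
  \<open>U\<close> are irrelevant.
\<close>

definition representation ::
  "('k::field \<Rightarrow> 'w::ab_group_add \<Rightarrow> 'w) \<Rightarrow> ('v \<Rightarrow> 'v) set \<Rightarrow> 'w set \<Rightarrow> (('v \<Rightarrow> 'v) \<Rightarrow> 'w \<Rightarrow> 'w) \<Rightarrow> bool"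
where
  "representation sW G U \<rho> \<longleftrightarrow>
     module.subspace sW U \<and>
     (\<forall>g\<in>G. \<forall>u\<in>U. \<rho> g u \<in> U) \<and>
     (\<forall>g\<in>G. \<forall>u\<in>U. \<forall>v\<in>U. \<rho> g (u + v) = \<rho> g u + \<rho> g v) \<and>
     (\<forall>g\<in>G. \<forall>c. \<forall>u\<in>U. \<rho> g (sW c u) = sW c (\<rho> g u)) \<and>
     (\<forall>u\<in>U. \<rho> id u = u) \<and>
     (\<forall>g\<in>G. \<forall>h\<in>G. \<forall>u\<in>U. \<rho> (g \<circ> h) u = \<rho> g (\<rho> h u))"

definition irreducible_representation ::
  "('k::field \<Rightarrow> 'w::ab_group_add \<Rightarrow> 'w) \<Rightarrow> ('v \<Rightarrow> 'v) set \<Rightarrow> 'w set \<Rightarrow> (('v \<Rightarrow> 'v) \<Rightarrow> 'w \<Rightarrow> 'w) \<Rightarrow> bool"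
where
  "irreducible_representation sW G U \<rho> \<longleftrightarrow>
     representation sW G U \<rho> \<and> U \<noteq> {0} \<and>
     (\<forall>U'. module.subspace sW U' \<and> U' \<subseteq> U \<and> (\<forall>g\<in>G. \<forall>u\<in>U'. \<rho> g u \<in> U') \<longrightarrow> U' = {0} \<or> U' = U)"

definition isomorphic_representations ::
  "('v \<Rightarrow> 'v) set \<Rightarrow>
   ('k::field \<Rightarrow> 'w::ab_group_add \<Rightarrow> 'w) \<Rightarrow> 'w set \<Rightarrow> (('v \<Rightarrow> 'v) \<Rightarrow> 'w \<Rightarrow> 'w) \<Rightarrow>
   ('k \<Rightarrow> 'u::ab_group_add \<Rightarrow> 'u) \<Rightarrow> 'u set \<Rightarrow> (('v \<Rightarrow> 'v) \<Rightarrow> 'u \<Rightarrow> 'u) \<Rightarrow> bool"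
where
  "isomorphic_representations G sW W \<rho> sU U \<sigma> \<longleftrightarrow>
     (\<exists>\<phi>. bij_betw \<phi> W U \<and>
          (\<forall>x\<in>W. \<forall>y\<in>W. \<phi> (x + y) = \<phi> x + \<phi> y) \<and>
          (\<forall>c. \<forall>x\<in>W. \<phi> (sW c x) = sU c (\<phi> x)) \<and>
          (\<forall>g\<in>G. \<forall>x\<in>W. \<phi> (\<rho> g x) = \<sigma> g (\<phi> x)))"

text \<open>
  Completeness has to range over all irreducible representations, but HOL cannot quantify over
  types inside a formula. As \<open>G\<close> is finite, every irreducible representation is finite-dimensional,
  hence isomorphic to one carried by a subspace of the space \<open>nat \<Rightarrow>\<^sub>0 'k\<close> of finitely supported
  sequences, and it suffices to quantify over these.
\<close>

definition complete_irreducibles ::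
  "('v \<Rightarrow> 'v) set \<Rightarrow> ('k::field \<Rightarrow> 'w::ab_group_add \<Rightarrow> 'w) \<Rightarrow> nat \<Rightarrow>
   (nat \<Rightarrow> 'w set) \<Rightarrow> (nat \<Rightarrow> ('v \<Rightarrow> 'v) \<Rightarrow> 'w \<Rightarrow> 'w) \<Rightarrow> bool"
where
  "complete_irreducibles G sW n W \<rho> \<longleftrightarrow>
     (\<forall>i\<le>n. irreducible_representation sW G (W i) (\<rho> i)) \<and>
     (\<forall>i\<le>n. \<forall>j\<le>n. i \<noteq> j \<longrightarrow> \<not> isomorphic_representations G sW (W i) (\<rho> i) sW (W j) (\<rho> j)) \<and>
     (\<forall>(U :: (nat \<Rightarrow>\<^sub>0 'k) set) \<sigma>.
        irreducible_representation (\<lambda>c. Poly_Mapping.map ((*) c)) G U \<sigma> \<longrightarrow>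
        (\<exists>i\<le>n. isomorphic_representations G sW (W i) (\<rho> i) (\<lambda>c. Poly_Mapping.map ((*) c)) U \<sigma>))"


section \<open>The symmetric algebra and its ring of invariants\<close>

text \<open>
  \<open>Sym(V)\<close> is the free commutative \<open>k\<close>-algebra on the set \<open>V\<close>, i.e. the polynomial ring with one
  variable \<open>sym_var v\<close> for every vector \<open>v\<close>, modulo the ideal making \<open>v \<mapsto> sym_var v\<close> linear.
\<close>

definition sym_var :: "'v \<Rightarrow> ('v \<Rightarrow>\<^sub>0 nat) \<Rightarrow>\<^sub>0 'k::field" where
  "sym_var v = Poly_Mapping.single (Poly_Mapping.single v 1) 1"

definition sym_const :: "'k::field \<Rightarrow> ('v \<Rightarrow>\<^sub>0 nat) \<Rightarrow>\<^sub>0 'k" where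
  "sym_const c = Poly_Mapping.single 0 c"

definition free_algebra :: "(('v \<Rightarrow>\<^sub>0 nat) \<Rightarrow>\<^sub>0 'k::field) ring" where
  "free_algebra = \<lparr>carrier = UNIV, monoid.mult = (*), one = 1, ring.zero = 0, add = (+)\<rparr>"

definition sym_ideal ::
  "('k::field \<Rightarrow> 'v::ab_group_add \<Rightarrow> 'v) \<Rightarrow> (('v \<Rightarrow>\<^sub>0 nat) \<Rightarrow>\<^sub>0 'k) set" where
  "sym_ideal sV = genideal free_algebra
     ({sym_var (v + w) - sym_var v - sym_var w | v w. True} \<union>
      {sym_var (sV c v) - sym_const c * sym_var v | c v. True})"

type_synonym ('k, 'v) sym = "(('v \<Rightarrow>\<^sub>0 nat) \<Rightarrow>\<^sub>0 'k) set"

definition Sym :: "('k::field \<Rightarrow> 'v::ab_group_add \<Rightarrow> 'v) \<Rightarrow> ('k, 'v) sym ring" where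
  "Sym sV = free_algebra Quot sym_ideal sV"

definition Sym_const :: "('k::field \<Rightarrow> 'v::ab_group_add \<Rightarrow> 'v) \<Rightarrow> 'k \<Rightarrow> ('k, 'v) sym" where
  "Sym_const sV c = sym_ideal sV +>\<^bsub>free_algebra\<^esub> sym_const c"

text \<open>The \<open>k\<close>-algebra endomorphism of the free algebra sending \<open>sym_var v\<close> to \<open>sym_var (g v)\<close>:\<close>

definition sym_rename :: "('v \<Rightarrow> 'v) \<Rightarrow> (('v \<Rightarrow>\<^sub>0 nat) \<Rightarrow>\<^sub>0 'k::field) \<Rightarrow> ('v \<Rightarrow>\<^sub>0 nat) \<Rightarrow>\<^sub>0 'k" where
  "sym_rename g p =
     (\<Sum>m\<in>Poly_Mapping.keys p.
        Poly_Mapping.single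
          (\<Sum>v\<in>Poly_Mapping.keys m. Poly_Mapping.single (g v) (Poly_Mapping.lookup m v))
          (Poly_Mapping.lookup p m))"

text \<open>
  The induced map on the quotient; for linear \<open>g\<close> all cosets in the union coincide.
\<close>

definition Sym_act ::
  "('k::field \<Rightarrow> 'v::ab_group_add \<Rightarrow> 'v) \<Rightarrow> ('v \<Rightarrow> 'v) \<Rightarrow> ('k, 'v) sym \<Rightarrow> ('k, 'v) sym" where
  "Sym_act sV g s = (\<Union>p\<in>s. sym_ideal sV +>\<^bsub>free_algebra\<^esub> sym_rename g p)"

definition invariant_ring ::
  "('k::field \<Rightarrow> 'v::ab_group_add \<Rightarrow> 'v) \<Rightarrow> ('v \<Rightarrow> 'v) set \<Rightarrow> ('k, 'v) sym ring" where
  "invariant_ring sV G =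
     (Sym sV)\<lparr>carrier := {s \<in> carrier (Sym sV). \<forall>g\<in>G. Sym_act sV g s = s}\<rparr>"


section \<open>The tensor product with \<open>Sym(V)\<close> and the modules of covariants\<close>

text \<open>
  \<open>Sym(V) \<otimes>\<^sub>k W\<close> is the free abelian group on \<open>Sym(V) \<times> W\<close> modulo the subgroup generated by the
  usual biadditivity and \<open>k\<close>-balancedness relations.
\<close>

definition tensor_free ::
  "('k::field \<Rightarrow> 'v::ab_group_add \<Rightarrow> 'v) \<Rightarrow> 'w set \<Rightarrow> (('k, 'v) sym \<times> 'w \<Rightarrow>\<^sub>0 int) monoid" where
  "tensor_free sV W = free_Abelian_group (carrier (Sym sV) \<times> W)"

definition tensor_relations ::
  "('k::field \<Rightarrow> 'v::ab_group_add \<Rightarrow> 'v) \<Rightarrow> ('k \<Rightarrow> 'w::ab_group_add \<Rightarrow> 'w) \<Rightarrow> 'w set \<Rightarrow>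
   (('k, 'v) sym \<times> 'w \<Rightarrow>\<^sub>0 int) set" where
  "tensor_relations sV sW W = generate (tensor_free sV W)
     ({frag_of (s \<oplus>\<^bsub>Sym sV\<^esub> t, w) - frag_of (s, w) - frag_of (t, w) | s t w.
         s \<in> carrier (Sym sV) \<and> t \<in> carrier (Sym sV) \<and> w \<in> W} \<union>
      {frag_of (s, w + x) - frag_of (s, w) - frag_of (s, x) | s w x.
         s \<in> carrier (Sym sV) \<and> w \<in> W \<and> x \<in> W} \<union>
      {frag_of (Sym_const sV c \<otimes>\<^bsub>Sym sV\<^esub> s, w) - frag_of (s, sW c w) | c s w.
         s \<in> carrier (Sym sV) \<and> w \<in> W})"

type_synonym ('k, 'v, 'w) tensor = "(('k, 'v) sym \<times> 'w \<Rightarrow>\<^sub>0 int) set"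

definition Sym_tensor ::
  "('k::field \<Rightarrow> 'v::ab_group_add \<Rightarrow> 'v) \<Rightarrow> ('k \<Rightarrow> 'w::ab_group_add \<Rightarrow> 'w) \<Rightarrow> 'w set \<Rightarrow>
   ('k, 'v, 'w) tensor monoid" where
  "Sym_tensor sV sW W = tensor_free sV W Mod tensor_relations sV sW W"

text \<open>
  The map \<open>f \<otimes> h\<close> induced by \<open>k\<close>-linear maps \<open>f\<close> of \<open>Sym(V)\<close> and \<open>h\<close> of \<open>W\<close>; again all cosets
  in the union coincide.
\<close>

definition tensor_map ::
  "('k::field \<Rightarrow> 'v::ab_group_add \<Rightarrow> 'v) \<Rightarrow> ('k \<Rightarrow> 'w::ab_group_add \<Rightarrow> 'w) \<Rightarrow> 'w set \<Rightarrow>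
   (('k, 'v) sym \<Rightarrow> ('k, 'v) sym) \<Rightarrow> ('w \<Rightarrow> 'w) \<Rightarrow> ('k, 'v, 'w) tensor \<Rightarrow> ('k, 'v, 'w) tensor" where
  "tensor_map sV sW W f h T =
     (\<Union>x\<in>T. tensor_relations sV sW W #>\<^bsub>tensor_free sV W\<^esub>
              frag_extend (\<lambda>(s, w). frag_of (f s, h w)) x)"

text \<open>
  \<open>(Sym(V) \<otimes>\<^sub>k W)\<^sup>G\<close> for the diagonal action. The record type for modules extends that for rings;
  its multiplicative fields play no role for a module.
\<close>

definition covariants ::
  "('k::field \<Rightarrow> 'v::ab_group_add \<Rightarrow> 'v) \<Rightarrow> ('v \<Rightarrow> 'v) set \<Rightarrow>
   ('k \<Rightarrow> 'w::ab_group_add \<Rightarrow> 'w) \<Rightarrow> 'w set \<Rightarrow> (('v \<Rightarrow> 'v) \<Rightarrow> 'w \<Rightarrow> 'w) \<Rightarrow>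
   (('k, 'v) sym, ('k, 'v, 'w) tensor) module" where
  "covariants sV G sW W \<rho> =
     \<lparr>carrier = {T \<in> carrier (Sym_tensor sV sW W).
                  \<forall>g\<in>G. tensor_map sV sW W (Sym_act sV g) (\<rho> g) T = T},
      monoid.mult = undefined,
      one = undefined,
      ring.zero = \<one>\<^bsub>Sym_tensor sV sW W\<^esub>,
      add = (\<otimes>\<^bsub>Sym_tensor sV sW W\<^esub>),
      module.smult = (\<lambda>r. tensor_map sV sW W ((\<otimes>\<^bsub>Sym sV\<^esub>) r) id)\<rparr>"


section \<open>Module-theoretic notions\<close>

definition regular_module :: "'r ring \<Rightarrow> ('r, 'r) module" where
  "regular_module R =
     \<lparr>carrier = carrier R, monoid.mult = monoid.mult R, monoid.one = monoid.one R,
      ring.zero = ring.zero R, ring.add = ring.add R, module.smult = (\<otimes>\<^bsub>R\<^esub>)\<rparr>"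

definition frobenius_twist :: "nat \<Rightarrow> nat \<Rightarrow> 'r ring \<Rightarrow> ('r, 'm) module \<Rightarrow> ('r, 'm) module" where
  "frobenius_twist p e R M = M\<lparr>module.smult := (\<lambda>r m. (r [^]\<^bsub>R\<^esub> (p ^ e)) \<odot>\<^bsub>M\<^esub> m)\<rparr>"

text \<open>The direct sum, for finite index sets \<open>I\<close> only (in general this is the product):\<close>

definition finite_direct_sum :: "'i set \<Rightarrow> ('i \<Rightarrow> ('r, 'm) module) \<Rightarrow> ('r, 'i \<Rightarrow> 'm) module" where
  "finite_direct_sum I M =
     \<lparr>carrier = (\<Pi>\<^sub>E i\<in>I. carrier (M i)),
      monoid.mult = undefined,
      one = undefined,
      ring.zero = (\<lambda>i\<in>I. \<zero>\<^bsub>M i\<^esub>),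
      add = (\<lambda>x y. \<lambda>i\<in>I. x i \<oplus>\<^bsub>M i\<^esub> y i),
      module.smult = (\<lambda>r x. \<lambda>i\<in>I. r \<odot>\<^bsub>M i\<^esub> x i)\<rparr>"

definition isomorphic_modules :: "'r ring \<Rightarrow> ('r, 'm) module \<Rightarrow> ('r, 'l) module \<Rightarrow> bool" where
  "isomorphic_modules R M N \<longleftrightarrow>
     (\<exists>\<phi>. bij_betw \<phi> (carrier M) (carrier N) \<and>
          (\<forall>x\<in>carrier M. \<forall>y\<in>carrier M. \<phi> (x \<oplus>\<^bsub>M\<^esub> y) = \<phi> x \<oplus>\<^bsub>N\<^esub> \<phi> y) \<and>
          (\<forall>r\<in>carrier R. \<forall>x\<in>carrier M. \<phi> (r \<odot>\<^bsub>M\<^esub> x) = r \<odot>\<^bsub>N\<^esub> \<phi> x))"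

text \<open>The rank of a module over a domain: the largest number of linearly independent elements.\<close>

definition linearly_independent :: "'r ring \<Rightarrow> ('r, 'm) module \<Rightarrow> 'm set \<Rightarrow> bool" where
  "linearly_independent R M A \<longleftrightarrow>
     finite A \<and> A \<subseteq> carrier M \<and>
     (\<forall>a \<in> A \<rightarrow> carrier R. (\<Oplus>\<^bsub>M\<^esub>x\<in>A. a x \<odot>\<^bsub>M\<^esub> x) = \<zero>\<^bsub>M\<^esub> \<longrightarrow> (\<forall>x\<in>A. a x = \<zero>\<^bsub>R\<^esub>))"

definition module_rank :: "'r ring \<Rightarrow> ('r, 'm) module \<Rightarrow> nat" where
  "module_rank R M = (GREATEST m. \<exists>A. linearly_independent R M A \<and> card A = m)"

text \<open>
  \<open>\<^sup>eR \<cong> M\<^sub>0\<^bsup>c 0\<^esup> \<oplus> \<dots> \<oplus> M\<^sub>n\<^bsup>c n\<^esup>\<close>; the pair \<open>(i, j)\<close> indexes the \<open>j\<close>-th copy of \<open>M i\<close>.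
\<close>

definition frobenius_multiplicities ::
  "nat \<Rightarrow> 'r ring \<Rightarrow> nat \<Rightarrow> (nat \<Rightarrow> ('r, 'm) module) \<Rightarrow> nat \<Rightarrow> (nat \<Rightarrow> nat) \<Rightarrow> bool" where
  "frobenius_multiplicities p R n M e c \<longleftrightarrow>
     isomorphic_modules R (frobenius_twist p e R (regular_module R))
       (finite_direct_sum (SIGMA i:{..n}. {..<c i}) (\<lambda>(i, j). M i))"

end

theory Submission imports Defs
begin

text \<open>Write \<open>q = p\<^sup>e\<close> and \<open>r\<^sub>i = dim V\<^sub>i\<close>. In a basis of \<open>V\<^sub>i\<close> the module \<open>M\<^sub>i\<close> consists of the vectors over \<open>S\<close> that
  are covariant for the matrices of \<open>V\<^sub>i\<close>, and since \<open>G\<close> contains no pseudo-reflections, every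
  \<open>R\<close>-linear map between such modules is multiplication by a matrix over \<open>S\<close>. Modulo the augmentation ideal
  this matrix is an intertwiner over \<open>k\<close>, to which Schur's lemma applies.

  Every covariant for the dual of the Frobenius twist of \<open>V\<^sub>i\<close> gives an \<open>R\<close>-linear map from \<open>M\<^sub>i\<close> to
  \<open>\<^sup>eR\<close>. Covariants that are independent over \<open>k\<close> modulo the \<open>q\<close>-th Frobenius power of the augmentation ideal can only
  be detected on the summands \<open>M\<^sub>i\<close> of \<open>\<^sup>eR\<close>, so their number is at most \<open>c\<^sub>i\<close>; Galois coordinates produce
  at least \<open>r\<^sub>i (q - O(1))\<^sup>d / |G|\<close> of them. On the other hand \<open>\<Sum>\<^sub>i c\<^sub>i r\<^sub>i \<le> q\<^sup>d\<close> by comparing ranks over \<open>R\<close>, and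
  \<open>\<Sum>\<^sub>i r\<^sub>i\<^sup>2 \<ge> |G|\<close> by Maschke's theorem for the regular representation. Together these bounds leave no room:
  \<open>c\<^sub>i / q\<^sup>d\<close> tends to \<open>r\<^sub>i / |G|\<close>.\<close>

section \<open>Finite groups acting on domains and covariants\<close>

text \<open>The argument closes because the lower bounds already exhaust the rank: weighted by
  \<open>r i\<close>, their leading terms \<open>r i * q^d / |G|\<close> sum to
  \<open>q^d * (\<Sum>i. r i * r i) / |G|\<close>, which is at least \<open>q^d\<close>. So no
  decomposition of \<open>^eR\<close> has to be built; an arbitrary isomorphism is split into its
  component maps and estimated. The obstacle is that the modules over \<open>R\<close> are rarely
  free. Statements over \<open>R\<close> are therefore reached from \<open>S\<close> by traces, at
  the cost of one denominator \<open>dl\<close>, the product of the differences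
  \<open>v - g v\<close> for a vector \<open>v\<close> that every \<open>g \<noteq> id\<close>
  moves. As \<open>dl\<close> is chosen before \<open>e\<close>, it costs a bounded shift of
  exponents; this is the O(1). Clearing \<open>dl\<close> from the matrix of an
  \<open>R\<close>-linear map is what reflections would obstruct. A summand \<open>M_j\<close> with
  \<open>j \<noteq> i\<close> detects nothing because a map from \<open>M_i\<close> through
  \<open>^eR\<close> back to \<open>M_i\<close> is a sum of matrix products over the summands, and
  Schur's lemma kills the factors at \<open>M_j\<close> after reduction. The trace of the surviving
  scalars returns a coordinate of the covariant times \<open>|G|\<close>, which is invertible in
  \<open>k\<close>.\<close>

text \<open>Fraction-free elimination: a homogeneous system with more unknowns than equations is
  solved by cross-multiplication, so the coefficients never leave the subring
  \<open>S\<close>.\<close>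

lemma linear_relation:
  fixes f :: "'t \<Rightarrow> 'x \<Rightarrow> 'a::idom"
  assumes S1: "1 \<in> S" and Sa: "\<And>x y. x \<in> S \<Longrightarrow> y \<in> S \<Longrightarrow> x + y \<in> S"
    and Sm: "\<And>x y. x \<in> S \<Longrightarrow> y \<in> S \<Longrightarrow> x * y \<in> S" and Su: "\<And>x. x \<in> S \<Longrightarrow> - x \<in> S"
  assumes "finite Y" "finite T" "card Y < card T" "\<And>t x. t \<in> T \<Longrightarrow> x \<in> Y \<Longrightarrow> f t x \<in> S"
  shows "\<exists>s. (\<forall>t\<in>T. s t \<in> S) \<and> (\<exists>t\<in>T. s t \<noteq> 0) \<and> (\<forall>x\<in>Y. (\<Sum>t\<in>T. s t * f t x) = 0)"
proof -
  have S0: "0 \<in> S" using Sa[OF S1 Su[OF S1]] by simp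
  have Ssum: "sum h A \<in> S" if "\<And>a. a \<in> A \<Longrightarrow> h a \<in> S" for h :: "'t \<Rightarrow> 'a" and A
    using that by (induction A rule: infinite_finite_induct) (auto simp: S0 Sa)
  from \<open>finite Y\<close> assms(6-8) show ?thesis
  proof (induction Y arbitrary: T f rule: finite_induct)
    case empty
    then obtain t where "t \<in> T" by fastforce
    then show ?case using S1 by (intro exI[of _ "\<lambda>_. 1"]) auto
  next
    case (insert x Y)
    show ?case
    proof (cases "\<forall>t\<in>T. f t x = 0")
      case True
      have "\<exists>s. (\<forall>t\<in>T. s t \<in> S) \<and> (\<exists>t\<in>T. s t \<noteq> 0) \<and> (\<forall>x\<in>Y. (\<Sum>t\<in>T. s t * f t x) = 0)"
        using insert by (intro insert.IH) auto
      then obtain s where s: "\<forall>t\<in>T. s t \<in> S" "\<exists>t\<in>T. s t \<noteq> 0" "\<forall>x\<in>Y. (\<Sum>t\<in>T. s t * f t x) = 0" by blast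
      show ?thesis by (rule exI[of _ s]) (use s True in simp)
    next
      case False
      then obtain u where u: "u \<in> T" "f u x \<noteq> 0" by blast
      have fT: "f t y \<in> S" if "t \<in> T" "y = x \<or> y \<in> Y" for t y
        using insert.prems(3) that by blast
      \<comment> \<open>The pivot \<open>u\<close> eliminates equation \<open>x\<close> from the
        remaining unknowns by cross-multiplication.\<close>
      let ?f = "\<lambda>t y. f u x * f t y - f t x * f u y"
      have "\<exists>s. (\<forall>t\<in>T-{u}. s t \<in> S) \<and> (\<exists>t\<in>T-{u}. s t \<noteq> 0) \<and> (\<forall>y\<in>Y. (\<Sum>t\<in>T-{u}. s t * ?f t y) = 0)"
      proof (intro insert.IH)
        show "card Y < card (T - {u})" using insert u by simp
        fix t y assume "t \<in> T - {u}" "y \<in> Y"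
        then show "?f t y \<in> S"
          using Sa[OF Sm Su[OF Sm]] fT u by (metis DiffD1 add_uminus_conv_diff)
      qed (use insert in simp)
      then obtain s where s: "\<forall>t\<in>T-{u}. s t \<in> S" "\<exists>t\<in>T-{u}. s t \<noteq> 0"
        "\<forall>y\<in>Y. (\<Sum>t\<in>T-{u}. s t * ?f t y) = 0" by blast
      \<comment> \<open>The value at \<open>u\<close> is dictated by equation \<open>x\<close>; the
        other values are rescaled by the pivot \<open>f u x\<close>, so that no division
        occurs.\<close>
      define s' where "s' t = (if t = u then - (\<Sum>t\<in>T-{u}. s t * f t x) else s t * f u x)" for t
      have sum_s': "(\<Sum>t\<in>T. s' t * f t y) = (\<Sum>t\<in>T-{u}. s t * ?f t y)" for y
      proof -
        have "(\<Sum>t\<in>T. s' t * f t y) = s' u * f u y + (\<Sum>t\<in>T-{u}. s' t * f t y)"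
          by (rule sum.remove[OF \<open>finite T\<close> u(1)])
        also have "(\<Sum>t\<in>T-{u}. s' t * f t y) = (\<Sum>t\<in>T-{u}. s t * f u x * f t y)"
          by (rule sum.cong) (auto simp: s'_def)
        also have "s' u * f u y = - (\<Sum>t\<in>T-{u}. s t * f t x * f u y)"
          by (simp add: s'_def sum_distrib_right)
        finally show ?thesis
          by (simp add: sum_subtractf algebra_simps)
      qed
      have "s' t \<in> S" if "t \<in> T" for t
        using that s(1) u fT Ssum[of "T-{u}" "\<lambda>t. s t * f t x"]
        by (auto simp: s'_def intro!: Su Sm)
      moreover have "\<exists>t\<in>T. s' t \<noteq> 0" using s(2) u by (auto simp: s'_def)
      moreover have "(\<Sum>t\<in>T. s' t * f t y) = 0" if "y \<in> insert x Y" for y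
      proof (cases "y = x")
        case True
        have "(\<Sum>t\<in>T-{u}. s t * ?f t x) = 0" by (rule sum.neutral) (simp add: mult.commute)
        then show ?thesis using True sum_s' by metis
      qed (use that s(3) sum_s' in auto)
      ultimately show ?thesis by blast
    qed
  qed
qed

lemma linear_relation_UNIV:
  fixes f :: "'t \<Rightarrow> 'x \<Rightarrow> 'a::idom"
  assumes "finite Y" "finite T" "card Y < card T"
  shows "\<exists>s. (\<exists>t\<in>T. s t \<noteq> 0) \<and> (\<forall>x\<in>Y. (\<Sum>t\<in>T. s t * f t x) = 0)"
  using linear_relation[of UNIV Y T f] assms by auto

section \<open>Finite groups of bijections and their matrix representations\<close>

locale finite_map_group =
  fixes G :: "('v \<Rightarrow> 'v) set"
  assumes fin_G: "finite G" and id_G: "id \<in> G" and comp_G: "g \<in> G \<Longrightarrow> h \<in> G \<Longrightarrow> g \<circ> h \<in> G"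
    and bij_G: "g \<in> G \<Longrightarrow> bij g" and inv_G: "g \<in> G \<Longrightarrow> inv_into UNIV g \<in> G"
begin

abbreviation iv where "iv \<equiv> inv_into UNIV"

lemma inv_comp: assumes "g \<in> G" shows "iv g \<circ> g = id" "g \<circ> iv g = id"
  using inv_o_cancel[OF bij_is_inj[OF bij_G[OF assms]]] bij_is_surj[OF bij_G[OF assms]] surj_iff[of g]
  by simp_all

lemma cancel_G: assumes "g \<in> G"
  shows "iv g \<circ> (g \<circ> h) = h" "g \<circ> (iv g \<circ> h) = h" "(h \<circ> g) \<circ> iv g = h" "(h \<circ> iv g) \<circ> g = h"
  unfolding comp_assoc[symmetric] inv_comp[OF assms] id_comp
  unfolding comp_assoc inv_comp[OF assms] comp_id by (rule refl)+

lemma sum_G_left: assumes "g \<in> G" shows "(\<Sum>h\<in>G. f (g \<circ> h)) = (\<Sum>h\<in>G. f h)"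
proof -
  have "bij_betw (\<lambda>h. g \<circ> h) G G"
    by (rule bij_betw_byWitness[of _ "\<lambda>h. iv g \<circ> h"])
       (use assms comp_G inv_G cancel_G[OF assms] in \<open>blast+\<close>)
  then show ?thesis by (rule sum.reindex_bij_betw)
qed

lemma card_G: "card G > 0" using fin_G id_G by (metis card_gt_0_iff empty_iff)

lemma iv_comp: assumes "g \<in> G" "h \<in> G" shows "iv (g \<circ> h) = iv h \<circ> iv g"
  using assms bij_G o_inv_distrib by blast

text \<open>A representation by \<open>r\<close> by \<open>r\<close> matrices, stored as total
  functions of two indices: the dimension is a value and cannot be a type.\<close>

definition mrep :: "nat \<Rightarrow> (('v \<Rightarrow> 'v) \<Rightarrow> nat \<Rightarrow> nat \<Rightarrow> 'k::comm_semiring_1) \<Rightarrow> bool" where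
  "mrep r D \<longleftrightarrow> (\<forall>j<r. \<forall>k<r. D id j k = (if j = k then 1 else 0)) \<and>
     (\<forall>g\<in>G. \<forall>h\<in>G. \<forall>j<r. \<forall>k<r. D (g \<circ> h) j k = (\<Sum>l<r. D g j l * D h l k))"

lemma mrep_id: "mrep r D \<Longrightarrow> j < r \<Longrightarrow> k < r \<Longrightarrow> D id j k = (if j = k then 1 else 0)"
  by (auto simp: mrep_def)

lemma mrep_comp: "mrep r D \<Longrightarrow> g \<in> G \<Longrightarrow> h \<in> G \<Longrightarrow> j < r \<Longrightarrow> k < r \<Longrightarrow>
    D (g \<circ> h) j k = (\<Sum>l<r. D g j l * D h l k)"
  by (auto simp: mrep_def)

definition intertwiner :: "nat \<Rightarrow> (('v \<Rightarrow> 'v) \<Rightarrow> nat \<Rightarrow> nat \<Rightarrow> 'k::comm_semiring_1) \<Rightarrow>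
    nat \<Rightarrow> (('v \<Rightarrow> 'v) \<Rightarrow> nat \<Rightarrow> nat \<Rightarrow> 'k) \<Rightarrow> (nat \<Rightarrow> nat \<Rightarrow> 'k) \<Rightarrow> bool" where
  "intertwiner r D r' D' Q \<longleftrightarrow> (\<forall>g\<in>G. \<forall>j<r'. \<forall>k<r. (\<Sum>l<r'. D' g j l * Q l k) = (\<Sum>l<r. Q j l * D g l k))"

end

text \<open>An axiomatic stand-in for \<open>Sym(V)\<close>: \<open>S\<close> is a subring of a
  larger domain on which the action, the constants \<open>kc\<close> and the augmentation
  \<open>ep\<close> live, and \<open>io\<close> sends vectors to linear forms.
  \<open>no_reflections\<close> says that two of the linear forms \<open>g x - x\<close> are
  coprime, stated as a cancellation law for divisibility in the ambient domain.\<close>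

locale invariant_setup = finite_map_group G
  for S :: "'a::idom set" and kc :: "'k::field \<Rightarrow> 'a" and ep :: "'a \<Rightarrow> 'k"
    and G :: "('v::ab_group_add \<Rightarrow> 'v) set" and act :: "('v \<Rightarrow> 'v) \<Rightarrow> 'a \<Rightarrow> 'a" and io :: "'v \<Rightarrow> 'a" +
  assumes S_1: "1 \<in> S" and S_add: "x \<in> S \<Longrightarrow> y \<in> S \<Longrightarrow> x + y \<in> S"
    and S_mult: "x \<in> S \<Longrightarrow> y \<in> S \<Longrightarrow> x * y \<in> S" and S_uminus: "x \<in> S \<Longrightarrow> - x \<in> S"
    and S_kc: "kc c \<in> S" and S_act: "g \<in> G \<Longrightarrow> x \<in> S \<Longrightarrow> act g x \<in> S"
    and kc_add: "kc (a + b) = kc a + kc b" and kc_mult: "kc (a * b) = kc a * kc b" and kc_1: "kc 1 = 1"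
    and ep_add: "ep (x + y) = ep x + ep y" and ep_mult: "ep (x * y) = ep x * ep y" and ep_kc: "ep (kc c) = c"
    and ep_act: "g \<in> G \<Longrightarrow> ep (act g x) = ep x"
    and act_add: "g \<in> G \<Longrightarrow> act g (x + y) = act g x + act g y"
    and act_mult: "g \<in> G \<Longrightarrow> act g (x * y) = act g x * act g y"
    and act_kc: "g \<in> G \<Longrightarrow> act g (kc c) = kc c"
    and act_id: "act id x = x"
    and act_comp: "g \<in> G \<Longrightarrow> h \<in> G \<Longrightarrow> act (g \<circ> h) x = act g (act h x)"
    and S_io: "io v \<in> S" and act_io: "g \<in> G \<Longrightarrow> act g (io v) = io (g v)"
    and no_reflections: "g \<in> G \<Longrightarrow> g \<noteq> id \<Longrightarrow> \<exists>x y. io (g x) - io x \<noteq> 0 \<and>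
          (\<forall>c. io (g x) - io x dvd c * (io (g y) - io y) \<longrightarrow> io (g x) - io x dvd c)"
    and generic_vector: "\<exists>v. \<forall>g\<in>G. g \<noteq> id \<longrightarrow> io (g v) \<noteq> io v"
begin

lemma S_0: "0 \<in> S" using S_add[OF S_1 S_uminus[OF S_1]] by simp
lemma S_diff: "x \<in> S \<Longrightarrow> y \<in> S \<Longrightarrow> x - y \<in> S" using S_add[OF _ S_uminus] by fastforce
lemma S_sum: "(\<And>a. a \<in> A \<Longrightarrow> f a \<in> S) \<Longrightarrow> sum f A \<in> S"
  by (induction A rule: infinite_finite_induct) (auto simp: S_0 S_add)
lemma S_prod: "(\<And>a. a \<in> A \<Longrightarrow> f a \<in> S) \<Longrightarrow> prod f A \<in> S"
  by (induction A rule: infinite_finite_induct) (auto simp: S_1 S_mult)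
lemma S_power: "x \<in> S \<Longrightarrow> x ^ n \<in> S"
  by (induction n) (auto simp: S_1 S_mult)
lemmas S_closed = S_0 S_1 S_add S_mult S_uminus S_diff S_sum S_prod S_power S_kc S_act S_io

lemma act_0: "g \<in> G \<Longrightarrow> act g 0 = 0" using act_add[of g 0 0] by (metis add.right_neutral add_cancel_left_left)
lemma act_1: "g \<in> G \<Longrightarrow> act g 1 = 1" using act_kc[of g 1] by (simp add: kc_1)
lemma act_uminus: "g \<in> G \<Longrightarrow> act g (- x) = - act g x" using act_add[of g x "-x"] by (simp add: act_0 minus_unique)
lemma act_diff: "g \<in> G \<Longrightarrow> act g (x - y) = act g x - act g y" using act_add[of g x "-y"] by (simp add: act_uminus)
lemma act_sum: "g \<in> G \<Longrightarrow> act g (sum f A) = (\<Sum>a\<in>A. act g (f a))"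
  by (induction A rule: infinite_finite_induct) (auto simp: act_0 act_add)
lemma act_power: "g \<in> G \<Longrightarrow> act g (x ^ n) = act g x ^ n"
  by (induction n) (auto simp: act_1 act_mult)
lemma kc_0: "kc 0 = 0" using kc_add[of 0 0] by (metis add.right_neutral add_cancel_left_left)
lemma kc_sum: "kc (sum f A) = (\<Sum>a\<in>A. kc (f a))"
  by (induction A rule: infinite_finite_induct) (auto simp: kc_0 kc_add)
lemma ep_0: "ep 0 = 0" using ep_add[of 0 0] by (metis add.right_neutral add_cancel_left_left)
lemma ep_sum: "ep (sum f A) = (\<Sum>a\<in>A. ep (f a))"
  by (induction A rule: infinite_finite_induct) (auto simp: ep_0 ep_add)
text \<open>Multiplying by differences \<open>io (g x) - io x\<close> removes one group element after the other from
  the sum; by the absence of reflections such a factor can be cancelled again from a divisibility.\<close>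

lemma dvd_coefficient:
  assumes "\<And>s. s \<in> S \<Longrightarrow> d dvd (\<Sum>g\<in>G. act g s * b g)"
  shows "d dvd b id"
proof -
  define e :: "'v \<Rightarrow> 'v" where "e = id"
  have e: "e \<in> G" by (simp add: e_def id_G)
  have "\<forall>b. (\<forall>s\<in>S. d dvd (\<Sum>g\<in>insert e F. act g s * b g)) \<longrightarrow> d dvd b e"
    if "F \<subseteq> G - {e}" "finite F" for F
    using that(2,1)
  proof (induction F rule: finite_induct)
    case empty
    show ?case
    proof (intro allI impI)
      fix b assume "\<forall>s\<in>S. d dvd (\<Sum>g\<in>insert e {}. act g s * b g)"
      then have "d dvd (\<Sum>g\<in>insert e {}. act g 1 * b g)" using S_1 by blast
      moreover have "act e 1 = 1" unfolding e_def by (rule act_id)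
      ultimately show "d dvd b e" by simp
    qed
  next
    case (insert h F)
    have h: "h \<in> G" "h \<noteq> e" and F: "F \<subseteq> G - {e}" using insert.prems insert.hyps by blast+
    show ?case
    proof (intro allI impI)
      fix b assume b: "\<forall>s\<in>S. d dvd (\<Sum>g\<in>insert e (insert h F). act g s * b g)"
      have key: "d dvd (io (h x) - io x) * b e" for x
      proof -
        \<comment> \<open>Replacing \<open>s\<close> by \<open>s * io x\<close> multiplies the
          coefficient at \<open>g\<close> by \<open>io (g x)\<close>; subtracting the result from
          \<open>io (h x)\<close> times the old sum annihilates the coefficient at
          \<open>h\<close>.\<close>
        let ?b = "\<lambda>g. (io (h x) - io (g x)) * b g"
        have "d dvd (\<Sum>g\<in>insert e F. act g s * ?b g)" if s: "s \<in> S" for s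
        proof -
          have ins: "insert e (insert h F) = insert h (insert e F)" by auto
          have 1: "d dvd (\<Sum>g\<in>insert h (insert e F). act g (s * io x) * b g)"
            using b S_mult[OF s S_io] unfolding ins by blast
          have 2: "d dvd (\<Sum>g\<in>insert h (insert e F). act g s * b g)"
            using b s unfolding ins by blast
          have nin: "h \<notin> insert e F" using h insert.hyps by blast
          have "(\<Sum>g\<in>insert e F. act g s * ?b g) = (\<Sum>g\<in>insert h (insert e F). act g s * ?b g)"
            using nin insert.hyps by simp
          also have "\<dots> = io (h x) * (\<Sum>g\<in>insert h (insert e F). act g s * b g)
             - (\<Sum>g\<in>insert h (insert e F). act g (s * io x) * b g)"
            unfolding sum_distrib_left sum_subtractf[symmetric]
          proof (rule sum.cong)
            fix g assume "g \<in> insert h (insert e F)"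
            then have "g \<in> G" using h F e by auto
            then show "act g s * ?b g = io (h x) * (act g s * b g) - act g (s * io x) * b g"
              by (simp add: act_mult act_io algebra_simps)
          qed simp
          finally show ?thesis using 1 2 by simp
        qed
        then have "d dvd (io (h x) - io (e x)) * b e"
          by (rule insert.IH[OF F, rule_format, of ?b])
        then show ?thesis by (simp add: e_def)
      qed
      obtain x y where xy: "io (h x) - io x \<noteq> 0"
        "\<And>c. io (h x) - io x dvd c * (io (h y) - io y) \<Longrightarrow> io (h x) - io x dvd c"
        using no_reflections[OF h(1) h(2)[unfolded e_def]] that by metis
      obtain c where c: "(io (h x) - io x) * b e = d * c" using key[of x] by (auto elim: dvdE)
      obtain c' where c': "(io (h y) - io y) * b e = d * c'" using key[of y] by (auto elim: dvdE)
      show "d dvd b e"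
      proof (cases "d = 0")
        case True
        then show ?thesis using c xy(1) by auto
      next
        case False
        \<comment> \<open>\<open>c\<close> and \<open>c'\<close> are the quotients by
          \<open>d\<close> of the multiples of \<open>b e\<close> by the two coprime forms.
          Eliminating \<open>b e\<close> shows that the first form divides the product of
          \<open>c\<close> with the second, hence divides \<open>c\<close> itself.\<close>
        have "d * (c * (io (h y) - io y)) = d * (c' * (io (h x) - io x))"
          using c c' by (metis (no_types, lifting) mult.assoc mult.commute)
        then have "c * (io (h y) - io y) = c' * (io (h x) - io x)" using False by simp
        then have "io (h x) - io x dvd c" using xy(2) by (metis dvd_triv_right)
        then obtain z where "c = (io (h x) - io x) * z" by (auto elim: dvdE)
          then have "(io (h x) - io x) * b e = (io (h x) - io x) * (d * z)" using c by (simp only: mult.left_commute)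
          then show ?thesis using xy(1) by simp
      qed
    qed
  qed
  from this[of "G - {e}"] show ?thesis using assms fin_G e by (simp add: insert_absorb e_def)
qed

section \<open>Traces and Galois coordinates\<close>

definition tr where "tr s = (\<Sum>g\<in>G. act g s)"
definition R where "R = {s \<in> S. \<forall>g\<in>G. act g s = s}"

lemma R_S: "x \<in> R \<Longrightarrow> x \<in> S" by (simp add: R_def)
lemma R_act: "x \<in> R \<Longrightarrow> g \<in> G \<Longrightarrow> act g x = x" by (simp add: R_def)

lemma tr_R: "s \<in> S \<Longrightarrow> tr s \<in> R"
  unfolding R_def tr_def
proof (safe intro!: S_sum S_act)
  fix g assume "s \<in> S" "g \<in> G"
  then show "act g (\<Sum>g\<in>G. act g s) = (\<Sum>g\<in>G. act g s)"
    using sum_G_left[of g "\<lambda>h. act h s"] by (simp add: act_sum flip: act_comp)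
qed

text \<open>The case \<open>d = 0\<close> of \<open>dvd_coefficient\<close>: divisibility by zero
  turns it into Dedekind's independence of automorphisms.\<close>

lemma trace_nondegenerate:
  assumes "\<And>t. t \<in> S \<Longrightarrow> tr (t * s) = 0" shows "s = 0"
proof -
  have "0 dvd act id s"
    by (rule dvd_coefficient) (use assms in \<open>simp add: tr_def act_mult\<close>)
  then show ?thesis by (simp add: act_id)
qed

text \<open>The polynomial \<open>P\<close> with roots \<open>g v\<close> for
  \<open>g \<noteq> id\<close> vanishes at \<open>x v\<close> unless \<open>x = id\<close>, where it
  takes the value \<open>D\<close>. Its coefficients therefore form, up to the factor
  \<open>D\<close>, a system dual to the powers of \<open>v\<close>. In terms of the orbit
  polynomial of \<open>v\<close>, the value \<open>D\<close> is its derivative at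
  \<open>v\<close>.\<close>

lemma galois_coordinates:
  obtains D b v where "D \<noteq> 0" "D \<in> S" "\<And>l. b l \<in> S" "v \<in> S"
    "\<And>x. x \<in> G \<Longrightarrow> (\<Sum>l<card G. act x (v ^ l) * b l) = (if x = id then D else 0)"
proof -
  obtain v where v: "\<And>g. g \<in> G \<Longrightarrow> g \<noteq> id \<Longrightarrow> io (g v) \<noteq> io v" using generic_vector by blast
  define P where "P = (\<Prod>g\<in>G-{id}. [:- io (g v), 1:])"
  have degP: "degree P < card G"
  proof -
    have "degree P \<le> (\<Sum>g\<in>G-{id}. degree [:- io (g v), 1:])" unfolding P_def
      using degree_prod_sum_le[of "G-{id}" "\<lambda>g. [:- io (g v), 1:]"] fin_G by (simp add: o_def)
    also have "\<dots> = card G - 1" using fin_G id_G by simp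
    finally show ?thesis using card_G by linarith
  qed
  have ev: "(\<Sum>l<card G. z ^ l * coeff P l) = (\<Prod>g\<in>G-{id}. z - io (g v))" for z
  proof -
    have "poly P z = (\<Sum>l<card G. z ^ l * coeff P l)"
      unfolding poly_altdef
      by (rule sum.mono_neutral_cong_left) (use degP in \<open>auto intro: mult.commute coeff_eq_0\<close>)
    moreover have "poly P z = (\<Prod>g\<in>G-{id}. z - io (g v))"
      by (simp add: P_def poly_prod algebra_simps)
    ultimately show ?thesis by simp
  qed
  show thesis
  proof (rule that[of "\<Prod>g\<in>G-{id}. io v - io (g v)" "coeff P" "io v"])
    show "(\<Prod>g\<in>G-{id}. io v - io (g v)) \<noteq> 0" using v fin_G by (auto dest: sym)
    show "(\<Prod>g\<in>G-{id}. io v - io (g v)) \<in> S" by (intro S_closed)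
    have "\<forall>l. coeff (\<Prod>g\<in>A. [:- io (g v), 1:]) l \<in> S" for A
    proof (induction A rule: infinite_finite_induct)
      case (insert g A)
      show ?case
        unfolding prod.insert[OF insert(1,2)]
        by (auto simp: coeff_pCons insert.IH[rule_format] intro!: S_closed split: nat.splits)
    qed (simp_all add: S_0 S_1)
    then show "coeff P l \<in> S" for l by (simp add: P_def)
    fix x assume x: "x \<in> G"
    have "(\<Sum>l<card G. act x (io v ^ l) * coeff P l) = (\<Prod>g\<in>G-{id}. io (x v) - io (g v))"
      using ev[of "io (x v)"] x by (simp add: act_power act_io)
    also have "\<dots> = (if x = id then (\<Prod>g\<in>G-{id}. io v - io (g v)) else 0)"
    proof (cases "x = id")
      case False
      then have "(\<Prod>g\<in>G-{id}. io (x v) - io (g v)) = 0"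
        using x fin_G by (intro prod_zero) auto
      then show ?thesis unfolding if_not_P[OF False] .
    next
      case True
      then show ?thesis by (simp only: if_True refl id_apply)
    qed
    finally show "(\<Sum>l<card G. act x (io v ^ l) * coeff P l) = (if x = id then (\<Prod>g\<in>G-{id}. io v - io (g v)) else 0)" .
  qed (rule S_io)
qed

section \<open>Covariants and the twisted trace\<close>

text \<open>The coordinate vectors of the elements of \<open>(S \<otimes> V_i)^G\<close>. Entries
  from \<open>r\<close> on are zero, so that two covariants are equal exactly when they are equal as
  functions.\<close>

definition Cov :: "nat \<Rightarrow> (('v \<Rightarrow> 'v) \<Rightarrow> nat \<Rightarrow> nat \<Rightarrow> 'k) \<Rightarrow> (nat \<Rightarrow> 'a) set" where
  "Cov r D = {m. (\<forall>j<r. m j \<in> S) \<and> (\<forall>j\<ge>r. m j = 0) \<and>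
     (\<forall>g\<in>G. \<forall>j<r. (\<Sum>k<r. kc (D g j k) * act g (m k)) = m j)}"

text \<open>The sum over \<open>G\<close> of the twisted action on \<open>S^r\<close>. It is to
  covariants what \<open>tr\<close> is to invariants.\<close>

definition T :: "nat \<Rightarrow> (('v \<Rightarrow> 'v) \<Rightarrow> nat \<Rightarrow> nat \<Rightarrow> 'k) \<Rightarrow> (nat \<Rightarrow> 'a) \<Rightarrow> nat \<Rightarrow> 'a" where
  "T r D x = (\<lambda>j. if j < r then \<Sum>g\<in>G. \<Sum>k<r. kc (D g j k) * act g (x k) else 0)"

definition un :: "nat \<Rightarrow> 'a \<Rightarrow> nat \<Rightarrow> 'a" where
  "un k s = (\<lambda>j. if j = k then s else 0)"

lemma Cov_S: "m \<in> Cov r D \<Longrightarrow> m j \<in> S"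
  using S_0 by (cases "j < r") (auto simp: Cov_def)

lemma Cov_out: "m \<in> Cov r D \<Longrightarrow> \<not> j < r \<Longrightarrow> m j = 0" by (auto simp: Cov_def)

lemma Cov_eq: "m \<in> Cov r D \<Longrightarrow> g \<in> G \<Longrightarrow> j < r \<Longrightarrow> (\<Sum>k<r. kc (D g j k) * act g (m k)) = m j"
  by (auto simp: Cov_def)

lemma Cov_eqI: "m \<in> Cov r D \<Longrightarrow> m' \<in> Cov r D \<Longrightarrow> (\<And>j. j < r \<Longrightarrow> m j = m' j) \<Longrightarrow> m = m'"
  using Cov_out by (metis ext)

lemma Cov_0: "(\<lambda>_. 0) \<in> Cov r D" by (auto simp: Cov_def S_0 act_0)

lemma Cov_add: "m \<in> Cov r D \<Longrightarrow> m' \<in> Cov r D \<Longrightarrow> (\<lambda>j. m j + m' j) \<in> Cov r D"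
  by (auto simp: Cov_def S_add act_add distrib_left sum.distrib)

lemma Cov_smult: assumes "\<rho> \<in> R" "m \<in> Cov r D" shows "(\<lambda>j. \<rho> * m j) \<in> Cov r D"
proof -
  have "(\<Sum>k<r. kc (D g j k) * act g (\<rho> * m k)) = \<rho> * m j" if "g \<in> G" "j < r" for g j
  proof -
    have "(\<Sum>k<r. kc (D g j k) * act g (\<rho> * m k)) = \<rho> * (\<Sum>k<r. kc (D g j k) * act g (m k))"
      unfolding sum_distrib_left by (rule sum.cong) (simp_all add: act_mult that R_act[OF assms(1)])
    then show ?thesis using Cov_eq[OF assms(2) that] by simp
  qed
  then show ?thesis using assms(2) R_S[OF assms(1)] by (auto simp: Cov_def S_mult)
qed

lemma Cov_sum: "(\<And>t. t \<in> I \<Longrightarrow> m t \<in> Cov r D) \<Longrightarrow> (\<lambda>j. \<Sum>t\<in>I. m t j) \<in> Cov r D"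
  by (induction I rule: infinite_finite_induct) (auto simp: Cov_0 Cov_add)

lemma kc_delta: "mrep r D \<Longrightarrow> j < r \<Longrightarrow> (\<Sum>k<r. kc (D id j k) * x k) = x j"
  by (subst sum.cong[OF refl, of _ _ "\<lambda>k. if k = j then x j else 0"])
     (auto simp: mrep_id kc_0 kc_1)

lemma kc_delta': "mrep r D \<Longrightarrow> j < r \<Longrightarrow> (\<Sum>k<r. x k * kc (D id k j)) = x j"
  by (subst sum.cong[OF refl, of _ _ "\<lambda>k. if k = j then x j else 0"])
     (auto simp: mrep_id kc_0 kc_1)

lemma T_Cov:
  assumes D: "mrep r D" and x: "\<And>j. j < r \<Longrightarrow> x j \<in> S"
  shows "T r D x \<in> Cov r D"
proof -
  have "(\<Sum>k<r. kc (D g j k) * act g (T r D x k)) = T r D x j" if g: "g \<in> G" and j: "j < r" for g j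
  proof -
    have "(\<Sum>k<r. kc (D g j k) * act g (T r D x k))
        = (\<Sum>k<r. \<Sum>h\<in>G. \<Sum>l<r. kc (D g j k) * kc (D h k l) * act (g \<circ> h) (x l))"
      using g by (simp add: T_def act_sum sum_distrib_left act_mult act_kc act_comp algebra_simps)
    also have "\<dots> = (\<Sum>h\<in>G. \<Sum>l<r. \<Sum>k<r. kc (D g j k) * kc (D h k l) * act (g \<circ> h) (x l))"
      by (subst sum.swap, rule sum.cong, rule refl, rule sum.swap)
    also have "\<dots> = (\<Sum>h\<in>G. \<Sum>l<r. kc (D (g \<circ> h) j l) * act (g \<circ> h) (x l))"
      using g j by (intro sum.cong refl) (simp add: mrep_comp[OF D] kc_sum kc_mult sum_distrib_right)
    also have "\<dots> = (\<Sum>h\<in>G. \<Sum>l<r. kc (D h j l) * act h (x l))"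
      using sum_G_left[OF g, of "\<lambda>h. \<Sum>l<r. kc (D h j l) * act h (x l)"] .
    finally show ?thesis using j by (simp add: T_def)
  qed
  moreover have "T r D x j \<in> S" for j
    by (auto simp: T_def intro!: S_0 S_sum S_mult S_kc S_act x)
  moreover have "T r D x j = 0" if "j \<ge> r" for j using that by (simp add: T_def)
  ultimately show ?thesis unfolding Cov_def by blast
qed

text \<open>The twisted action of \<open>g\<close> sends \<open>s * m\<close> to
  \<open>act g s * m\<close>, because it fixes \<open>m\<close>.\<close>

lemma T_smult_Cov: assumes "m \<in> Cov r D" "j < r" shows "T r D (\<lambda>k. s * m k) j = tr s * m j"
proof -
  have "T r D (\<lambda>k. s * m k) j = (\<Sum>g\<in>G. act g s * (\<Sum>k<r. kc (D g j k) * act g (m k)))"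
    using assms(2) unfolding T_def by (auto simp: sum_distrib_left act_mult intro!: sum.cong)
  also have "\<dots> = tr s * m j" unfolding tr_def sum_distrib_right
    using Cov_eq[OF assms(1) _ assms(2)] by (intro sum.cong refl) simp
  finally show ?thesis .
qed

text \<open>Expanding \<open>T\<close> gives a sum of terms \<open>act g s\<close> with coefficients
  that do not depend on \<open>s\<close>, and the coefficient at \<open>id\<close> is
  \<open>z j\<close>.\<close>

lemma T_dvd:
  assumes D: "mrep r D" and j: "j < r" and "\<And>s. s \<in> S \<Longrightarrow> d dvd T r D (\<lambda>k. s * z k) j"
  shows "d dvd z j"
proof -
  have "d dvd (\<Sum>k<r. kc (D id j k) * act id (z k))"
  proof (rule dvd_coefficient[where b = "\<lambda>g. \<Sum>k<r. kc (D g j k) * act g (z k)"])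
    fix s assume "s \<in> S"
    then have "d dvd T r D (\<lambda>k. s * z k) j" using assms(3) by blast
    also have "T r D (\<lambda>k. s * z k) j = (\<Sum>g\<in>G. act g s * (\<Sum>k<r. kc (D g j k) * act g (z k)))"
      using j unfolding T_def by (auto simp: sum_distrib_left act_mult intro!: sum.cong)
    finally show "d dvd (\<Sum>g\<in>G. act g s * (\<Sum>k<r. kc (D g j k) * act g (z k)))" .
  qed
  then show ?thesis using kc_delta[OF D j] by (simp only: act_id)
qed

lemma T_sum:
  "T r D (\<lambda>k. \<Sum>t\<in>I. x t k) j = (\<Sum>t\<in>I. T r D (x t) j)"
proof (induction I rule: infinite_finite_induct)
  case (insert t I)
  have "T r D (\<lambda>k. x t k + y k) j = T r D (x t) j + T r D y j" for y
    by (simp add: T_def act_add distrib_left sum.distrib)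
  then show ?case using insert by simp
qed (simp_all add: T_def act_0)

lemma T_un: "j < r \<Longrightarrow> k < r \<Longrightarrow> T r D (un k s) j = (\<Sum>g\<in>G. kc (D g j k) * act g s)"
proof -
  assume "j < r" "k < r"
  moreover have "(\<Sum>l<r. kc (D g j l) * act g (un k s l)) = kc (D g j k) * act g s" if "g \<in> G" for g
    by (subst sum.cong[OF refl, of _ _ "\<lambda>l. if l = k then kc (D g j k) * act g s else 0"])
       (auto simp: un_def act_0 that \<open>k < r\<close>)
  ultimately show ?thesis by (simp add: T_def)
qed

lemma un_S: "s \<in> S \<Longrightarrow> un k s j \<in> S" by (simp add: un_def S_0)

lemma T_un_R: assumes "\<rho> \<in> R" "k < r" shows "T r D (un k (\<rho> * s)) = (\<lambda>j. \<rho> * T r D (un k s) j)"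
proof
  fix j
  show "T r D (un k (\<rho> * s)) j = \<rho> * T r D (un k s) j"
  proof (cases "j < r")
    case True
    show ?thesis unfolding T_un[OF True assms(2)] sum_distrib_left
      by (rule sum.cong) (simp_all add: act_mult R_act[OF assms(1)] mult.left_commute)
  qed (simp add: T_def)
qed

lemma T_un_add: assumes "k < r" shows "T r D (un k (s + t)) = (\<lambda>j. T r D (un k s) j + T r D (un k t) j)"
proof
  fix j
  show "T r D (un k (s + t)) j = T r D (un k s) j + T r D (un k t) j"
  proof (cases "j < r")
    case True
    show ?thesis unfolding T_un[OF True assms] by (simp add: act_add distrib_left sum.distrib)
  qed (simp add: T_def)
qed

lemma T_un_Cov: "mrep r D \<Longrightarrow> s \<in> S \<Longrightarrow> T r D (un k s) \<in> Cov r D"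
  by (intro T_Cov un_S)

definition lin where
  "lin r D r' D' \<phi> \<longleftrightarrow> (\<forall>m\<in>Cov r D. \<phi> m \<in> Cov r' D') \<and>
     (\<forall>m\<in>Cov r D. \<forall>m'\<in>Cov r D. \<phi> (\<lambda>j. m j + m' j) = (\<lambda>j. \<phi> m j + \<phi> m' j)) \<and>
     (\<forall>\<rho>\<in>R. \<forall>m\<in>Cov r D. \<phi> (\<lambda>j. \<rho> * m j) = (\<lambda>j. \<rho> * \<phi> m j))"

lemma R_0: "0 \<in> R" by (auto simp: R_def S_0 act_0)
lemma R_1: "1 \<in> R" by (auto simp: R_def S_1 act_1)
lemma R_add: "x \<in> R \<Longrightarrow> y \<in> R \<Longrightarrow> x + y \<in> R" by (auto simp: R_def S_add act_add)
lemma R_mult: "x \<in> R \<Longrightarrow> y \<in> R \<Longrightarrow> x * y \<in> R" by (auto simp: R_def S_mult act_mult)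
lemma R_uminus: "x \<in> R \<Longrightarrow> - x \<in> R" by (auto simp: R_def S_uminus act_uminus)
lemma R_power: "x \<in> R \<Longrightarrow> x ^ n \<in> R" by (induction n) (auto simp: R_1 R_mult)
lemma R_prod: "(\<And>t. t \<in> I \<Longrightarrow> x t \<in> R) \<Longrightarrow> prod x I \<in> R"
  by (induction I rule: infinite_finite_induct) (auto simp: R_1 R_mult)

lemma lin_Cov: "lin r D r' D' \<phi> \<Longrightarrow> m \<in> Cov r D \<Longrightarrow> \<phi> m \<in> Cov r' D'"
  by (simp add: lin_def)
lemma lin_add: "lin r D r' D' \<phi> \<Longrightarrow> m \<in> Cov r D \<Longrightarrow> m' \<in> Cov r D \<Longrightarrow>
    \<phi> (\<lambda>j. m j + m' j) = (\<lambda>j. \<phi> m j + \<phi> m' j)"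
  by (simp add: lin_def)
lemma lin_smult: "lin r D r' D' \<phi> \<Longrightarrow> \<rho> \<in> R \<Longrightarrow> m \<in> Cov r D \<Longrightarrow>
    \<phi> (\<lambda>j. \<rho> * m j) = (\<lambda>j. \<rho> * \<phi> m j)"
  by (simp add: lin_def)

lemma lin_0: assumes "lin r D r' D' \<phi>" shows "\<phi> (\<lambda>_. 0) = (\<lambda>_. 0)"
  using lin_smult[OF assms R_0 Cov_0] by simp

lemma lin_sum:
  assumes "lin r D r' D' \<phi>" "\<And>t. t \<in> I \<Longrightarrow> m t \<in> Cov r D" "\<And>t. t \<in> I \<Longrightarrow> \<rho> t \<in> R"
  shows "\<phi> (\<lambda>j. \<Sum>t\<in>I. \<rho> t * m t j) = (\<lambda>j. \<Sum>t\<in>I. \<rho> t * \<phi> (m t) j)"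
  using assms(2,3)
proof (induction I rule: infinite_finite_induct)
  case (insert t I)
  have m: "(\<lambda>j. \<rho> t * m t j) \<in> Cov r D" "(\<lambda>j. \<Sum>t\<in>I. \<rho> t * m t j) \<in> Cov r D"
    using insert.prems by (auto intro!: Cov_sum Cov_smult)
  have "\<phi> (\<lambda>j. \<rho> t * m t j + (\<Sum>t\<in>I. \<rho> t * m t j))
     = (\<lambda>j. \<phi> (\<lambda>j. \<rho> t * m t j) j + \<phi> (\<lambda>j. \<Sum>t\<in>I. \<rho> t * m t j) j)"
    by (rule lin_add[OF assms(1) m])
  also have "\<phi> (\<lambda>j. \<rho> t * m t j) = (\<lambda>j. \<rho> t * \<phi> (m t) j)"
    using insert.prems by (intro lin_smult[OF assms(1)]) auto
  finally show ?case using insert by simp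
qed (simp_all add: lin_0[OF assms(1)])

text \<open>An \<open>R\<close>-linear map of covariants respects \<open>S\<close>-linear relations, because the trace turns such a
  relation into \<open>R\<close>-linear ones.\<close>

lemma lin_relation:
  assumes D: "mrep r D" "mrep r' D'" and \<phi>: "lin r D r' D' \<phi>"
    and m: "m0 \<in> Cov r D" "\<And>t. t \<in> I \<Longrightarrow> m t \<in> Cov r D" and s: "s0 \<in> S" "\<And>t. t \<in> I \<Longrightarrow> s t \<in> S"
    and rel: "\<And>j. j < r \<Longrightarrow> s0 * m0 j = (\<Sum>t\<in>I. s t * m t j)" and j: "j < r'"
  shows "s0 * \<phi> m0 j = (\<Sum>t\<in>I. s t * \<phi> (m t) j)"
proof -
  have \<phi>C: "\<phi> x \<in> Cov r' D'" if "x \<in> Cov r D" for x using \<phi> that by (auto simp: lin_def)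
  \<comment> \<open>The defect of the transported relation; by nondegeneracy of \<open>T\<close> it
    vanishes once \<open>T\<close> vanishes on all its multiples by \<open>w\<close>.\<close>
  define z where "z j = s0 * \<phi> m0 j - (\<Sum>t\<in>I. s t * \<phi> (m t) j)" for j
  have "0 dvd T r' D' (\<lambda>k. w * z k) j" if w: "w \<in> S" for w
  proof -
    have rel': "(\<lambda>j. tr (w * s0) * m0 j) = (\<lambda>j. \<Sum>t\<in>I. tr (w * s t) * m t j)"
    proof
      fix j
      show "tr (w * s0) * m0 j = (\<Sum>t\<in>I. tr (w * s t) * m t j)"
      proof (cases "j < r")
        case True
        have "tr (w * s0) * m0 j = T r D (\<lambda>k. (w * s0) * m0 k) j"
          using T_smult_Cov[OF m(1) True] by simp
        also have "\<dots> = T r D (\<lambda>k. \<Sum>t\<in>I. (w * s t) * m t k) j"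
          unfolding T_def using rel by (simp add: mult.assoc sum_distrib_left)
        also have "\<dots> = (\<Sum>t\<in>I. tr (w * s t) * m t j)"
          unfolding T_sum by (intro sum.cong refl T_smult_Cov m(2) True)
        finally show ?thesis .
      next
        case False
        then show ?thesis using Cov_out[OF m(1) False] Cov_out[OF m(2) False] by simp
      qed
    qed
    have "tr (w * s0) * \<phi> m0 j = \<phi> (\<lambda>j. tr (w * s0) * m0 j) j"
      by (simp add: lin_smult[OF \<phi> tr_R[OF S_mult[OF w s(1)]] m(1)])
    also have "\<dots> = (\<Sum>t\<in>I. tr (w * s t) * \<phi> (m t) j)"
      unfolding rel' using lin_sum[OF \<phi>, of I m "\<lambda>t. tr (w * s t)"] m(2) tr_R[OF S_mult[OF w s(2)]] by simp
    finally have eq: "tr (w * s0) * \<phi> m0 j = (\<Sum>t\<in>I. tr (w * s t) * \<phi> (m t) j)" .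
    have "T r' D' (\<lambda>k. w * z k) j = T r' D' (\<lambda>k. (w * s0) * \<phi> m0 k - (\<Sum>t\<in>I. (w * s t) * \<phi> (m t) k)) j"
      by (simp add: z_def right_diff_distrib sum_distrib_left mult.assoc)
    also have "\<dots> = T r' D' (\<lambda>k. (w * s0) * \<phi> m0 k) j - T r' D' (\<lambda>k. \<Sum>t\<in>I. (w * s t) * \<phi> (m t) k) j"
      by (simp add: T_def act_diff right_diff_distrib sum_subtractf)
    also have "\<dots> = tr (w * s0) * \<phi> m0 j - (\<Sum>t\<in>I. tr (w * s t) * \<phi> (m t) j)"
      unfolding T_sum using T_smult_Cov[OF \<phi>C[OF m(1)] j] T_smult_Cov[OF \<phi>C[OF m(2)] j] by simp
    finally show ?thesis using eq by simp
  qed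
  then have "0 dvd z j" by (rule T_dvd[OF D(2) j])
  then show ?thesis by (simp add: z_def)
qed

end

section \<open>Matrices of linear maps between modules of covariants\<close>

text \<open>Fixes one choice of Galois coordinates, so that a single denominator \<open>dl\<close>
  serves all matrix representations.\<close>

locale invariant_galois = invariant_setup S kc ep G act io
  for S :: "'a::idom set" and kc :: "'k::field \<Rightarrow> 'a" and ep :: "'a \<Rightarrow> 'k"
    and G :: "('v::ab_group_add \<Rightarrow> 'v) set" and act :: "('v \<Rightarrow> 'v) \<Rightarrow> 'a \<Rightarrow> 'a" and io :: "'v \<Rightarrow> 'a" +
  fixes dl :: 'a and bl :: "nat \<Rightarrow> 'a" and vl :: 'a
  assumes dl_0: "dl \<noteq> 0" and dl_S: "dl \<in> S" and bl_S: "bl l \<in> S" and vl_S: "vl \<in> S"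
    and galois: "x \<in> G \<Longrightarrow> (\<Sum>l<card G. act x (vl ^ l) * bl l) = (if x = id then dl else 0)"
begin

abbreviation tu where "tu r D k l \<equiv> T r D (un k (vl ^ l))"

lemma tu_Cov: "mrep r D \<Longrightarrow> tu r D k l \<in> Cov r D"
  by (intro T_un_Cov S_power vl_S)

lemma sum_G_id: "(\<Sum>g\<in>G. f g * (if g = id then c else 0)) = f id * (c::'a)"
proof -
  have "f g * (if g = id then c else 0) = (if g = id then f id * c else 0)" for g
    by (cases "g = id") (simp_all only: if_True if_False refl mult_zero_right)
  then have "(\<Sum>g\<in>G. f g * (if g = id then c else 0)) = (\<Sum>g\<in>G. if g = id then f id * c else 0)" by (simp only:)
  also have "\<dots> = (if id \<in> G then f id * c else 0)" by (rule sum.delta'[OF fin_G, of id "\<lambda>_. f id * c", unfolded eq_commute[of id]])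
  finally show ?thesis using id_G by (simp only: if_True)
qed

text \<open>The Galois coordinates collapse the sum over \<open>G\<close> to the identity, where
  \<open>D\<close> is the unit matrix. Hence \<open>dl\<close> times every unit vector lies in the
  \<open>S\<close>-span of the covariants.\<close>

lemma galois_T:
  assumes D: "mrep r D" and jk: "j < r" "k < r"
  shows "(\<Sum>l<card G. bl l * tu r D k l j) = (if j = k then dl else 0)"
proof -
  have "(\<Sum>l<card G. bl l * tu r D k l j) = (\<Sum>l<card G. \<Sum>g\<in>G. kc (D g j k) * (act g (vl ^ l) * bl l))"
    unfolding T_un[OF jk] by (simp add: sum_distrib_left mult_ac)
  also have "\<dots> = (\<Sum>g\<in>G. kc (D g j k) * (\<Sum>l<card G. act g (vl ^ l) * bl l))"
    by (subst sum.swap) (simp add: sum_distrib_left)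
  also have "\<dots> = (\<Sum>g\<in>G. kc (D g j k) * (if g = id then dl else 0))"
    by (intro sum.cong refl) (simp only: galois)
  also have "\<dots> = kc (D id j k) * dl" by (rule sum_G_id)
  finally show ?thesis using mrep_id[OF D jk] by (simp add: kc_0 kc_1)
qed

text \<open>A row that annihilates the covariants annihilates their \<open>S\<close>-span, which
  contains \<open>dl\<close> times the \<open>k\<close>-th unit vector.\<close>

lemma Cov_annihilator:
  assumes D: "mrep r D" and "\<And>m. m \<in> Cov r D \<Longrightarrow> (\<Sum>k<r. A k * m k) = 0" and k: "k < r"
  shows "A k = 0"
proof -
  have "(\<Sum>l<card G. bl l * (\<Sum>j<r. A j * tu r D k l j)) = (\<Sum>j<r. A j * (\<Sum>l<card G. bl l * tu r D k l j))"
    unfolding sum_distrib_left by (subst sum.swap) (simp add: mult_ac)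
  also have "\<dots> = (\<Sum>j<r. A j * (if j = k then dl else 0))"
    by (intro sum.cong refl) (simp add: galois_T[OF D _ k])
  also have "\<dots> = A k * dl"
    by (subst sum.cong[OF refl, of _ _ "\<lambda>j. if j = k then A k * dl else 0"]) (use k in auto)
  finally have "A k * dl = (\<Sum>l<card G. bl l * (\<Sum>j<r. A j * tu r D k l j))" by simp
  also have "\<dots> = 0" using assms(2)[OF tu_Cov[OF D]] by simp
  finally show ?thesis using dl_0 by simp
qed

text \<open>\<open>dl * m\<close> is an \<open>S\<close>-combination of the covariants
  \<open>tu\<close> with coefficients linear in \<open>m\<close>. As \<phi> respects
  \<open>S\<close>-linear relations, \<open>dl * \<phi>\<close> is given by a matrix
  \<open>A0\<close>, whose entries are then divided by \<open>dl\<close>; the coprime linear forms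
  enter through this division. The quotients lie in the ambient domain, on which \<open>act\<close>
  and \<open>ep\<close> are defined.\<close>

lemma lin_matrix:
  assumes D: "mrep r D" "mrep r' D'" and \<phi>: "lin r D r' D' \<phi>"
  obtains A where "\<And>m j. m \<in> Cov r D \<Longrightarrow> j < r' \<Longrightarrow> \<phi> m j = (\<Sum>k<r. A j k * m k)"
proof -
  define A0 where "A0 j k = (\<Sum>l<card G. bl l * \<phi> (tu r D k l) j)" for j k
  have A0: "dl * \<phi> m j = (\<Sum>k<r. A0 j k * m k)" if m: "m \<in> Cov r D" and j: "j < r'" for m j
  proof -
    have "dl * \<phi> m j = (\<Sum>t\<in>{..<r}\<times>{..<card G}. (m (fst t) * bl (snd t)) * \<phi> (tu r D (fst t) (snd t)) j)"
    proof (rule lin_relation[OF D \<phi> m])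
      fix i assume i: "i < r"
      have "(\<Sum>t\<in>{..<r}\<times>{..<card G}. m (fst t) * bl (snd t) * tu r D (fst t) (snd t) i)
          = (\<Sum>k<r. m k * (\<Sum>l<card G. bl l * tu r D k l i))"
        unfolding sum_distrib_left by (simp add: sum.cartesian_product case_prod_beta mult.assoc)
      also have "\<dots> = (\<Sum>k<r. if k = i then dl * m i else 0)"
        by (intro sum.cong refl) (use i in \<open>auto simp: galois_T[OF D(1) i]\<close>)
      finally show "dl * m i = (\<Sum>t\<in>{..<r}\<times>{..<card G}. m (fst t) * bl (snd t) * tu r D (fst t) (snd t) i)"
        using i by simp
    qed (use j m in \<open>auto intro!: S_closed tu_Cov D dl_S bl_S intro: Cov_S\<close>)
    also have "\<dots> = (\<Sum>k<r. A0 j k * m k)"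
      unfolding A0_def sum_distrib_right by (simp add: sum.cartesian_product case_prod_beta mult_ac)
    finally show ?thesis .
  qed
  have "dl dvd A0 j k" if j: "j < r'" and k: "k < r" for j k
  proof -
    \<comment> \<open>Applying \<open>A0\<close> to the twisted trace of \<open>s\<close> times the
      \<open>k\<close>-th unit vector gives a value of \<open>dl * \<phi>\<close>, so a multiple of
      \<open>dl\<close> for every \<open>s\<close>.\<close>
    have "dl dvd (\<Sum>i<r. A0 j i * kc (D id i k))"
    proof (rule dvd_coefficient[where b = "\<lambda>g. \<Sum>i<r. A0 j i * kc (D g i k)"])
      fix s assume s: "s \<in> S"
      have "(\<Sum>g\<in>G. act g s * (\<Sum>i<r. A0 j i * kc (D g i k))) = (\<Sum>i<r. A0 j i * T r D (un k s) i)"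
        using k by (simp add: T_un sum_distrib_left mult_ac sum.swap[of _ G])
      also have "\<dots> = dl * \<phi> (T r D (un k s)) j"
        using A0[OF T_un_Cov[OF D(1) s] j] by simp
      finally show "dl dvd (\<Sum>g\<in>G. act g s * (\<Sum>i<r. A0 j i * kc (D g i k)))" by simp
    qed
    then show ?thesis using kc_delta'[OF D(1) k] by simp
  qed
  note dv = this
  have "\<exists>a. A0 j k = dl * a" if "j < r'" "k < r" for j k
    using dv[OF that] by (auto elim: dvdE)
  then obtain A where A: "\<And>j k. j < r' \<Longrightarrow> k < r \<Longrightarrow> A0 j k = dl * A j k" by metis
  show thesis
  proof (rule that)
    fix m j assume mj: "m \<in> Cov r D" "j < r'"
    have "dl * \<phi> m j = dl * (\<Sum>k<r. A j k * m k)"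
      using A0[OF mj] A mj(2) by (simp add: sum_distrib_left mult.assoc)
    then show "\<phi> m j = (\<Sum>k<r. A j k * m k)" using dl_0 by simp
  qed
qed

lemma act_inv: "g \<in> G \<Longrightarrow> act g (act (iv g) x) = x" "g \<in> G \<Longrightarrow> act (iv g) (act g x) = x"
  using act_comp[of g "iv g" x] act_comp[of "iv g" g x] inv_G inv_comp act_id by metis+

text \<open>Since \<open>A\<close> maps covariants to covariants, \<open>D' g * act g A\<close> and
  \<open>A * D g\<close> agree on every \<open>act g m\<close>; translated back by
  \<open>iv g\<close>, their difference annihilates all covariants. The augmentation is invariant
  under \<open>G\<close> and turns the resulting identity over the ring into one over
  \<open>k\<close>.\<close>

lemma intertwining:
  assumes D: "mrep r D" "mrep r' D'" and A: "\<And>m. m \<in> Cov r D \<Longrightarrow> (\<lambda>j. if j < r' then \<Sum>k<r. A j k * m k else 0) \<in> Cov r' D'"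
    and g: "g \<in> G" and j: "j < r'" and k: "k < r"
  shows "(\<Sum>l<r'. D' g j l * ep (A l k)) = (\<Sum>l<r. ep (A j l) * D g l k)"
proof -
  \<comment> \<open>Row \<open>j\<close> of \<open>D' g * act g A - A * D g\<close>.\<close>
  define C where "C k = (\<Sum>l<r'. kc (D' g j l) * act g (A l k)) - (\<Sum>l<r. A j l * kc (D g l k))" for k
  have "(\<Sum>k<r. act (iv g) (C k) * m k) = 0" if m: "m \<in> Cov r D" for m
  proof -
    have "(\<Sum>k<r. A j k * m k) = (\<Sum>l<r'. kc (D' g j l) * act g (\<Sum>k<r. A l k * m k))"
      using Cov_eq[OF A[OF m] g j] j by simp
    also have "\<dots> = (\<Sum>k<r. (\<Sum>l<r'. kc (D' g j l) * act g (A l k)) * act g (m k))"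
      using g by (simp add: act_sum act_mult sum_distrib_left sum_distrib_right mult.assoc sum.swap[of _ "{..<r'}"])
    finally have 1: "(\<Sum>k<r. A j k * m k) = (\<Sum>k<r. (\<Sum>l<r'. kc (D' g j l) * act g (A l k)) * act g (m k))" .
    have "(\<Sum>l<r. A j l * m l) = (\<Sum>l<r. A j l * (\<Sum>k<r. kc (D g l k) * act g (m k)))"
      using Cov_eq[OF m g] by simp
    also have "\<dots> = (\<Sum>k<r. \<Sum>l<r. A j l * (kc (D g l k) * act g (m k)))"
      unfolding sum_distrib_left by (rule sum.swap)
    also have "\<dots> = (\<Sum>k<r. (\<Sum>l<r. A j l * kc (D g l k)) * act g (m k))"
      by (simp add: sum_distrib_right mult.assoc)
    finally have "(\<Sum>k<r. C k * act g (m k)) = 0"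
      unfolding C_def left_diff_distrib sum_subtractf 1[symmetric] by simp
    then have "act (iv g) (\<Sum>k<r. C k * act g (m k)) = 0" using inv_G[OF g] by (simp add: act_0)
    then show ?thesis using inv_G[OF g] by (simp add: act_sum act_mult act_inv[OF g])
  qed
  then have "act (iv g) (C k) = 0" by (rule Cov_annihilator[OF D(1) _ k])
  then have "C k = 0" using act_inv(1)[OF g, of "C k"] by (simp add: act_0[OF g])
  then have "(\<Sum>l<r'. kc (D' g j l) * act g (A l k)) = (\<Sum>l<r. A j l * kc (D g l k))" by (simp add: C_def)
  then have "ep (\<Sum>l<r'. kc (D' g j l) * act g (A l k)) = ep (\<Sum>l<r. A j l * kc (D g l k))" by simp
  then show ?thesis by (simp add: ep_sum ep_mult ep_kc ep_act[OF g])
qed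

section \<open>The rank of the covariants over the invariants\<close>

definition R_independent where
  "R_independent r B \<longleftrightarrow> (\<forall>s. (\<forall>x\<in>B. s x \<in> R) \<and> (\<forall>j<r. (\<Sum>x\<in>B. s x * x j) = 0) \<longrightarrow> (\<forall>x\<in>B. s x = 0))"

lemma tr_nonzero: "s \<noteq> 0 \<Longrightarrow> \<exists>w\<in>S. tr (w * s) \<noteq> 0" using trace_nondegenerate by blast

text \<open>More than \<open>r\<close> vectors of length \<open>r\<close> are dependent over
  \<open>S\<close>. Multiplying by \<open>w\<close> and applying \<open>T\<close> replaces the
  coefficients \<open>s t\<close> by the invariants \<open>tr (w * s t)\<close>, and
  \<open>w\<close> is chosen so that one of them stays nonzero.\<close>

lemma Cov_dependent:
  assumes B: "finite B" "B \<subseteq> Cov r D" "card B > r"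
  shows "\<not> R_independent r B"
proof -
  have "\<exists>s. (\<forall>t\<in>B. s t \<in> S) \<and> (\<exists>t\<in>B. s t \<noteq> 0) \<and> (\<forall>j\<in>{..<r}. (\<Sum>t\<in>B. s t * t j) = 0)"
    using B by (intro linear_relation) (auto intro: S_closed Cov_S)
  then obtain s u where s: "\<And>t. t \<in> B \<Longrightarrow> s t \<in> S" and u: "u \<in> B" "s u \<noteq> 0"
    and rel: "\<And>j. j < r \<Longrightarrow> (\<Sum>t\<in>B. s t * t j) = 0" by blast
  obtain w where w: "w \<in> S" "tr (w * s u) \<noteq> 0" using tr_nonzero[OF u(2)] by blast
  have "(\<Sum>t\<in>B. tr (w * s t) * t j) = 0" if j: "j < r" for j
  proof -
    have "(\<Sum>t\<in>B. tr (w * s t) * t j) = T r D (\<lambda>k. \<Sum>t\<in>B. (w * s t) * t k) j"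
      unfolding T_sum by (intro sum.cong refl T_smult_Cov[symmetric] j) (use B in auto)
    also have "\<dots> = T r D (\<lambda>k. w * (\<Sum>t\<in>B. s t * t k)) j" by (simp add: sum_distrib_left mult.assoc)
    also have "\<dots> = 0" unfolding T_def using rel by (simp add: act_0)
    finally show ?thesis .
  qed
  moreover have "tr (w * s t) \<in> R" if "t \<in> B" for t using tr_R[OF S_mult[OF w(1) s[OF that]]] .
  ultimately show ?thesis unfolding R_independent_def using u(1) w(2)
    by (auto intro!: exI[of _ "\<lambda>t. tr (w * s t)"])
qed

text \<open>A maximal independent set \<open>B\<close> spans every covariant up to a denominator in
  \<open>R\<close>. With fewer than \<open>r\<close> elements, \<open>B\<close> would span the
  \<open>r\<close> vectors obtained from the unit vectors by the nonzero factor
  \<open>P * dl\<close>, which is impossible over a domain.\<close>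

lemma Cov_basis:
  assumes D: "mrep r D"
  obtains B where "finite B" "B \<subseteq> Cov r D" "card B = r" "R_independent r B"
proof -
  let ?P = "\<lambda>n. \<exists>B. finite B \<and> B \<subseteq> Cov r D \<and> card B = n \<and> R_independent r B"
  have P0: "?P 0" by (intro exI[of _ "{}"]) (auto simp: R_independent_def)
  have Pb: "?P n \<Longrightarrow> n \<le> r" for n using Cov_dependent by (metis not_le)
  obtain n where n: "?P n" "\<And>m. ?P m \<Longrightarrow> m \<le> n"
    using Greatest_le_nat[of ?P _ r] GreatestI_nat[of ?P 0 r] P0 Pb by blast
  then obtain B where B: "finite B" "B \<subseteq> Cov r D" "card B = n" "R_independent r B" by blast
  \<comment> \<open>By maximality \<open>m\<close> is dependent on \<open>B\<close>. Its own
    coefficient in the relation cannot vanish and serves as the denominator.\<close>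
  have span: "\<exists>\<rho> s. \<rho> \<in> R \<and> \<rho> \<noteq> 0 \<and> (\<forall>x\<in>B. s x \<in> R) \<and> (\<forall>j<r. \<rho> * m j = (\<Sum>x\<in>B. s x * x j))"
    if m: "m \<in> Cov r D" for m
  proof (cases "m \<in> B")
    case True
    have "(\<Sum>x\<in>B. (if x = m then 1 else 0) * x j) = m j" for j
      by (subst sum.cong[OF refl, of _ _ "\<lambda>x. if x = m then m j else 0"]) (use B True in auto)
    then show ?thesis using R_0 R_1
      by (intro exI[of _ 1] exI[of _ "\<lambda>x. if x = m then 1 else 0"]) auto
  next
    case False
    have "\<not> R_independent r (insert m B)"
      using n(2)[of "Suc n"] B m False by (metis Suc_n_not_le_n card_insert_disjoint finite_insert insert_subset)
    then obtain s u where s: "\<And>x. x \<in> insert m B \<Longrightarrow> s x \<in> R" and u: "u \<in> insert m B" "s u \<noteq> 0"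
      and rel: "\<And>j. j < r \<Longrightarrow> (\<Sum>x\<in>insert m B. s x * x j) = 0"
      unfolding R_independent_def by blast
    have rel': "s m * m j + (\<Sum>x\<in>B. s x * x j) = 0" if "j < r" for j
      using rel[OF that] B(1) False by simp
    have "s m \<noteq> 0"
    proof
      assume "s m = 0"
      then have "\<forall>x\<in>B. s x = 0" using B(4) s rel' unfolding R_independent_def by auto
      then show False using u \<open>s m = 0\<close> by auto
    qed
    moreover have "s m * m j = (\<Sum>x\<in>B. - s x * x j)" if "j < r" for j
      using rel'[OF that] by (simp add: sum_negf eq_neg_iff_add_eq_0)
    ultimately show ?thesis using s R_uminus
      by (intro exI[of _ "s m"] exI[of _ "\<lambda>x. - s x"]) auto
  qed
  have "n \<ge> r"
  proof (rule ccontr)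
    assume "\<not> n \<ge> r"
    \<comment> \<open>Denominator and coefficients are packed into one pair, so that a single choice
      yields both as functions of \<open>(k, l)\<close>.\<close>
    let ?Q = "\<lambda>kl f. fst f \<in> R \<and> fst f \<noteq> 0 \<and> (\<forall>x\<in>B. snd f x \<in> R) \<and>
      (\<forall>j<r. fst f * tu r D (fst kl) (snd kl) j = (\<Sum>x\<in>B. snd f x * x j))"
    have "\<exists>f. ?Q kl f" for kl
    proof -
      have "\<exists>\<rho> s. \<rho> \<in> R \<and> \<rho> \<noteq> 0 \<and> (\<forall>x\<in>B. s x \<in> R) \<and>
        (\<forall>j<r. \<rho> * tu r D (fst kl) (snd kl) j = (\<Sum>x\<in>B. s x * x j))"
        by (rule span[OF tu_Cov[OF D]])
      then obtain \<rho> s where "\<rho> \<in> R \<and> \<rho> \<noteq> 0 \<and> (\<forall>x\<in>B. s x \<in> R) \<and>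
        (\<forall>j<r. \<rho> * tu r D (fst kl) (snd kl) j = (\<Sum>x\<in>B. s x * x j))"
        by (elim exE) (rule that)
      then have "?Q kl (\<rho>, s)" unfolding fst_conv snd_conv .
      then show ?thesis by (rule exI)
    qed
    then have "\<forall>kl. \<exists>f. ?Q kl f" by (rule allI)
    from choice[OF this] obtain f where f: "\<And>kl. ?Q kl (f kl)" by (elim exE) (rule that, erule spec)
    define \<rho> where "\<rho> k l = fst (f (k, l))" for k l
    define s where "s k l = snd (f (k, l))" for k l
    have \<rho>: "\<And>k l. \<rho> k l \<in> R" "\<And>k l. \<rho> k l \<noteq> 0" and s: "\<And>k l x. x \<in> B \<Longrightarrow> s k l x \<in> R"
      and rel: "\<And>k l j. j < r \<Longrightarrow> \<rho> k l * tu r D k l j = (\<Sum>x\<in>B. s k l x * x j)"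
      unfolding \<rho>_def s_def using f[of "(k, l)" for k l] by auto
    let ?I = "{..<r} \<times> {..<card G}"
    \<comment> \<open>A common denominator for the finitely many covariants
      \<open>tu r D k l\<close>; \<open>P'\<close> is the cofactor of one of them.\<close>
    define P where "P = (\<Prod>(k,l)\<in>?I. \<rho> k l)"
    have P: "P \<in> R" "P \<noteq> 0" using \<rho> by (auto simp: P_def intro!: R_prod)
    define P' where "P' k l = (\<Prod>(i,j)\<in>?I-{(k,l)}. \<rho> i j)" for k l
    have P': "P' k l \<in> R" for k l using \<rho> by (auto simp: P'_def intro!: R_prod)
    have PP: "P = \<rho> k l * P' k l" if "k < r" "l < card G" for k l
      unfolding P_def P'_def by (subst prod.remove[of _ "(k,l)"]) (use that in auto)
    \<comment> \<open>The coefficients, with respect to \<open>B\<close>, of \<open>P * dl\<close>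
      times the \<open>k\<close>-th unit vector.\<close>
    define c where "c k x = (\<Sum>l<card G. bl l * (P' k l * s k l x))" for k x
    have c: "(\<Sum>x\<in>B. c k x * x j) = (if j = k then P * dl else 0)" if "k < r" "j < r" for k j
    proof -
      have "(\<Sum>x\<in>B. c k x * x j) = (\<Sum>l<card G. bl l * (P' k l * (\<Sum>x\<in>B. s k l x * x j)))"
        unfolding c_def sum_distrib_left sum_distrib_right by (subst sum.swap) (simp add: mult.assoc)
      also have "\<dots> = (\<Sum>l<card G. P * (bl l * tu r D k l j))"
      proof (rule sum.cong[OF refl])
        fix l assume "l \<in> {..<card G}"
        then have "P = \<rho> k l * P' k l" using PP[OF that(1)] by simp
        then show "bl l * (P' k l * (\<Sum>x\<in>B. s k l x * x j)) = P * (bl l * tu r D k l j)"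
          unfolding rel[OF that(2), symmetric] by (simp only: mult_ac)
      qed
      also have "\<dots> = P * (if j = k then dl else 0)"
        unfolding sum_distrib_left[symmetric] galois_T[OF D that(2,1)] ..
      finally show ?thesis by simp
    qed
    have "\<exists>w. (\<exists>k\<in>{..<r}. w k \<noteq> 0) \<and> (\<forall>x\<in>B. (\<Sum>k\<in>{..<r}. w k * c k x) = 0)"
      by (rule linear_relation_UNIV) (use B \<open>\<not> n \<ge> r\<close> in auto)
    then obtain w i where w: "i < r" "w i \<noteq> 0" "\<And>x. x \<in> B \<Longrightarrow> (\<Sum>k<r. w k * c k x) = 0" by blast
    have "w i * (P * dl) = (\<Sum>k<r. if k = i then w i * (P * dl) else 0)" using w(1) by simp
    also have "\<dots> = (\<Sum>k<r. w k * (\<Sum>x\<in>B. c k x * x i))"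
      by (intro sum.cong refl) (use w(1) in \<open>auto simp: c\<close>)
    also have "\<dots> = (\<Sum>x\<in>B. (\<Sum>k<r. w k * c k x) * x i)"
      unfolding sum_distrib_left sum_distrib_right by (subst sum.swap) (simp add: mult.assoc)
    also have "\<dots> = 0" using w(3) by simp
    finally show False using w(2) P(2) dl_0 by simp
  qed
  then have "n = r" using Pb[OF n(1)] by simp
  then show thesis using B that by blast
qed

end

section \<open>The Frobenius pull-back of the invariant ring\<close>

text \<open>\<open>mo\<close> and \<open>pi\<close> present \<open>S\<close> over its subring of
  \<open>q\<close>-th powers. In the application \<open>mo\<close> runs through the monomials with
  all exponents below \<open>q\<close>, and \<open>pi a\<close> is the \<open>q\<close>-th root of
  the coefficient of \<open>mo a\<close>; thus a factor \<open>s ^ q\<close> leaves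
  \<open>pi a\<close> as \<open>s\<close>.\<close>

locale invariant_frobenius = invariant_galois S kc ep G act io dl bl vl
  for S :: "'a::idom set" and kc :: "'k::field \<Rightarrow> 'a" and ep :: "'a \<Rightarrow> 'k"
    and G :: "('v::ab_group_add \<Rightarrow> 'v) set" and act :: "('v \<Rightarrow> 'v) \<Rightarrow> 'a \<Rightarrow> 'a" and io :: "'v \<Rightarrow> 'a"
    and dl :: 'a and bl :: "nat \<Rightarrow> 'a" and vl :: 'a +
  fixes q :: nat and Bx :: "'b set" and mo :: "'b \<Rightarrow> 'a" and pi :: "'b \<Rightarrow> 'a \<Rightarrow> 'a"
  assumes fin_Bx: "finite Bx" and q_pos: "q > 0" and q_add: "(x + y) ^ q = x ^ q + (y::'a) ^ q"
    and pi_S: "s \<in> S \<Longrightarrow> pi a s \<in> S" and pi_add: "pi a (s + t) = pi a s + pi a t"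
    and pi_smult: "pi a (s ^ q * t) = s * pi a t"
    and mo_S: "a \<in> Bx \<Longrightarrow> mo a \<in> S"
    and pi_expansion: "s \<in> S \<Longrightarrow> (\<Sum>a\<in>Bx. pi a s ^ q * mo a) = s"
begin

lemma q_sum: "(sum f A :: 'a) ^ q = (\<Sum>a\<in>A. f a ^ q)"
  by (induction A rule: infinite_finite_induct) (use q_pos in \<open>auto simp: q_add zero_power\<close>)

lemma pi_0: "pi a 0 = 0" using pi_add[of a 0 0] by (metis add.right_neutral add_cancel_left_left)
lemma pi_sum: "pi a (sum f A) = (\<Sum>x\<in>A. pi a (f x))"
  by (induction A rule: infinite_finite_induct) (auto simp: pi_0 pi_add)

text \<open>Up to \<open>q\<close>-th roots, the coordinates of \<open>s\<close> modulo the
  \<open>q\<close>-th Frobenius power of the augmentation ideal.\<close>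

definition kap :: "'b \<Rightarrow> 'a \<Rightarrow> 'k" where "kap a s = ep (pi a s)"

lemma kap_sum: "kap a (sum f A) = (\<Sum>x\<in>A. kap a (f x))" by (simp add: kap_def pi_sum ep_sum)
lemma kap_0: "kap a 0 = 0" by (simp add: kap_def pi_0 ep_0)

text \<open>Multiplication by \<open>z\<close> descends to the quotient by the Frobenius power,
  where its matrix has the entries \<open>kap b (z * mo a)\<close>.\<close>

lemma kap_mult: assumes "s \<in> S" shows "kap b (z * s) = (\<Sum>a\<in>Bx. kap a s * kap b (z * mo a))"
proof -
  have "z * s = (\<Sum>a\<in>Bx. pi a s ^ q * (z * mo a))"
    using arg_cong[OF pi_expansion[OF assms], of "\<lambda>x. z * x"] by (simp add: sum_distrib_left mult_ac)
  then show ?thesis by (simp add: kap_def pi_sum pi_smult ep_sum ep_mult)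
qed

text \<open>The coordinates \<open>pi a\<close> turn the problem into \<open>card Bx\<close> linear
  equations over \<open>S\<close>. The solution is made invariant by multiplying by \<open>w\<close>
  and taking traces; this is compatible with \<open>q\<close>-th powers because they are additive
  and the \<open>y t\<close> are invariant.\<close>

lemma frobenius_dependent:
  assumes I: "finite I" "card Bx < card I" and y: "\<And>t. t \<in> I \<Longrightarrow> y t \<in> R"
  obtains s u where "\<And>t. t \<in> I \<Longrightarrow> s t \<in> R" "u \<in> I" "s u \<noteq> 0" "(\<Sum>t\<in>I. s t ^ q * y t) = 0"
proof -
  have "\<exists>s. (\<forall>t\<in>I. s t \<in> S) \<and> (\<exists>t\<in>I. s t \<noteq> 0) \<and> (\<forall>a\<in>Bx. (\<Sum>t\<in>I. s t * pi a (y t)) = 0)"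
    using I y by (intro linear_relation) (auto intro: S_closed fin_Bx pi_S R_S)
  then obtain s u where s: "\<And>t. t \<in> I \<Longrightarrow> s t \<in> S" and u: "u \<in> I" "s u \<noteq> 0"
    and rel: "\<And>a. a \<in> Bx \<Longrightarrow> (\<Sum>t\<in>I. s t * pi a (y t)) = 0" by blast
  have "(\<Sum>t\<in>I. s t ^ q * y t) = (\<Sum>a\<in>Bx. pi a (\<Sum>t\<in>I. s t ^ q * y t) ^ q * mo a)"
    by (rule pi_expansion[symmetric]) (intro S_sum S_mult S_power s R_S[OF y])
  also have "\<dots> = 0" using q_pos rel by (simp add: pi_sum pi_smult zero_power)
  finally have 0: "(\<Sum>t\<in>I. s t ^ q * y t) = 0" .
  obtain w where w: "w \<in> S" "tr (w * s u) \<noteq> 0" using tr_nonzero[OF u(2)] by blast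
  have "(\<Sum>t\<in>I. tr (w * s t) ^ q * y t) = (\<Sum>t\<in>I. \<Sum>g\<in>G. act g ((w * s t) ^ q * y t))"
    unfolding tr_def q_sum sum_distrib_right
    by (intro sum.cong refl) (simp add: act_mult act_power R_act y)
  also have "\<dots> = (\<Sum>g\<in>G. act g (w ^ q * (\<Sum>t\<in>I. s t ^ q * y t)))"
    by (subst sum.swap) (simp add: act_sum sum_distrib_left power_mult_distrib mult.assoc)
  also have "\<dots> = 0" using 0 by (simp add: act_0)
  finally show thesis using that[of "\<lambda>t. tr (w * s t)" u] u w s tr_R S_mult by blast
qed

text \<open>The covariants for the dual of the Frobenius twist of \<open>D\<close>; pairing them with the \<open>q\<close>-th powers
  of the entries of a covariant for \<open>D\<close> gives an invariant.\<close>

definition Xq :: "nat \<Rightarrow> (('v \<Rightarrow> 'v) \<Rightarrow> nat \<Rightarrow> nat \<Rightarrow> 'k) \<Rightarrow> (nat \<Rightarrow> 'a) set" where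
  "Xq r D = {x. (\<forall>j<r. x j \<in> S) \<and> (\<forall>g\<in>G. \<forall>j<r. act g (x j) = (\<Sum>k<r. x k * kc (D g k j) ^ q))}"

text \<open>The averaging operator onto \<open>Xq\<close>; rows transform contragrediently, whence
  \<open>iv g\<close>.\<close>

definition Tq :: "nat \<Rightarrow> (('v \<Rightarrow> 'v) \<Rightarrow> nat \<Rightarrow> nat \<Rightarrow> 'k) \<Rightarrow> (nat \<Rightarrow> 'a) \<Rightarrow> nat \<Rightarrow> 'a" where
  "Tq r D x k = (\<Sum>g\<in>G. \<Sum>j<r. kc (D (iv g) j k) ^ q * act g (x j))"

lemma Tq_Xq:
  assumes D: "mrep r D" and x: "\<And>j. j < r \<Longrightarrow> x j \<in> S"
  shows "Tq r D x \<in> Xq r D"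
proof -
  have "act h (Tq r D x k) = (\<Sum>l<r. Tq r D x l * kc (D h l k) ^ q)" if h: "h \<in> G" and k: "k < r" for h k
  proof -
    have "act h (Tq r D x k) = (\<Sum>g\<in>G. \<Sum>j<r. kc (D (iv g) j k) ^ q * act (h \<circ> g) (x j))"
      using h by (simp add: Tq_def act_sum act_mult act_power act_kc act_comp)
    also have "\<dots> = (\<Sum>g\<in>G. \<Sum>j<r. kc (D (iv (h \<circ> g) \<circ> h) j k) ^ q * act (h \<circ> g) (x j))"
    proof (intro sum.cong refl)
      fix g j assume g: "g \<in> G"
      have "iv (h \<circ> g) \<circ> h = iv g"
        unfolding iv_comp[OF h g] using cancel_G(4)[OF h] by blast
      then show "kc (D (iv g) j k) ^ q * act (h \<circ> g) (x j) = kc (D (iv (h \<circ> g) \<circ> h) j k) ^ q * act (h \<circ> g) (x j)"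
        by (simp only:)
    qed
    also have "\<dots> = (\<Sum>g\<in>G. \<Sum>j<r. kc (D (iv g \<circ> h) j k) ^ q * act g (x j))"
      by (rule sum_G_left[OF h, of "\<lambda>g. \<Sum>j<r. kc (D (iv g \<circ> h) j k) ^ q * act g (x j)"])
    also have "\<dots> = (\<Sum>g\<in>G. \<Sum>j<r. \<Sum>l<r. kc (D (iv g) j l) ^ q * kc (D h l k) ^ q * act g (x j))"
      by (intro sum.cong refl)
         (simp add: mrep_comp[OF D inv_G h _ k] kc_sum kc_mult q_sum sum_distrib_right power_mult_distrib)
    also have "\<dots> = (\<Sum>g\<in>G. \<Sum>l<r. \<Sum>j<r. kc (D (iv g) j l) ^ q * kc (D h l k) ^ q * act g (x j))"
      by (intro sum.cong refl sum.swap)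
    also have "\<dots> = (\<Sum>l<r. \<Sum>g\<in>G. \<Sum>j<r. kc (D (iv g) j l) ^ q * kc (D h l k) ^ q * act g (x j))"
      by (rule sum.swap)
    also have "\<dots> = (\<Sum>l<r. Tq r D x l * kc (D h l k) ^ q)"
      unfolding Tq_def sum_distrib_right by (simp only: mult_ac)
    finally show ?thesis .
  qed
  moreover have "Tq r D x k \<in> S" for k unfolding Tq_def
    by (auto intro!: S_sum S_mult S_power S_kc S_act x)
  ultimately show ?thesis unfolding Xq_def by blast
qed

text \<open>Only \<open>id\<close> survives the Galois sum, so \<open>dl\<close> times an arbitrary
  row is recovered from \<open>card G\<close> averages.\<close>

lemma galois_Tq:
  assumes D: "mrep r D" and j: "j < r"
  shows "(\<Sum>l<card G. bl l * Tq r D (\<lambda>i. vl ^ l * x i) j) = dl * x j"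
proof -
  have "(\<Sum>l<card G. bl l * Tq r D (\<lambda>i. vl ^ l * x i) j)
      = (\<Sum>l<card G. \<Sum>g\<in>G. (\<Sum>i<r. kc (D (iv g) i j) ^ q * act g (x i)) * (act g (vl ^ l) * bl l))"
    unfolding Tq_def sum_distrib_left sum_distrib_right
    by (intro sum.cong refl) (simp add: act_mult mult_ac)
  also have "\<dots> = (\<Sum>g\<in>G. (\<Sum>i<r. kc (D (iv g) i j) ^ q * act g (x i)) * (\<Sum>l<card G. act g (vl ^ l) * bl l))"
    by (subst sum.swap) (simp add: sum_distrib_left)
  also have "\<dots> = (\<Sum>g\<in>G. (\<Sum>i<r. kc (D (iv g) i j) ^ q * act g (x i)) * (if g = id then dl else 0))"
    by (intro sum.cong refl) (simp only: galois)
  also have "\<dots> = (\<Sum>i<r. kc (D (iv id) i j) ^ q * act id (x i)) * dl" by (rule sum_G_id)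
  also have "(\<Sum>i<r. kc (D (iv id) i j) ^ q * act id (x i)) = (\<Sum>i<r. if i = j then x j else 0)"
    unfolding inv_id act_id
    by (intro sum.cong refl) (use j q_pos in \<open>simp add: mrep_id[OF D _ j] kc_0 kc_1 zero_power\<close>)
  finally show ?thesis using j by (simp add: mult.commute)
qed

section \<open>Counting twisted covariants modulo the Frobenius power\<close>

text \<open>Linear independence over \<open>k\<close> of the classes modulo the Frobenius power,
  expressed by the coordinates \<open>kap\<close>.\<close>

definition k_independent where
  "k_independent r Z \<longleftrightarrow> (\<forall>u. (\<forall>a\<in>Bx. \<forall>j<r. (\<Sum>x\<in>Z. u x * kap a (x j)) = 0) \<longrightarrow> (\<forall>x\<in>Z. u x = 0))"

lemma k_dependent: assumes "finite Z" "card Z > card Bx * r" shows "\<not> k_independent r Z"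
proof -
  have "\<exists>s. (\<exists>t\<in>Z. s t \<noteq> 0) \<and> (\<forall>y\<in>Bx \<times> {..<r}. (\<Sum>t\<in>Z. s t * kap (fst y) (t (snd y))) = 0)"
    by (rule linear_relation_UNIV) (use assms fin_Bx in auto)
  then show ?thesis unfolding k_independent_def by force
qed

text \<open>By \<open>galois_Tq\<close> each of the \<open>r * card Y\<close> vectors
  \<open>dl * y t\<close>, placed in some position \<open>k\<close>, is combined from
  \<open>card G\<close> elements of \<open>Xq\<close> with the multipliers \<open>bl l\<close>.
  Modulo the Frobenius power these elements lie in the span of a maximal independent
  \<open>Z\<close>, so all the vectors lie in a space of dimension at most
  \<open>card G * card Z\<close>; by \<open>ind\<close> they are independent.\<close>

lemma Xq_basis:
  assumes D: "mrep r D" and Y: "finite Y" and y: "\<And>t. t \<in> Y \<Longrightarrow> y t \<in> S"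
    and ind: "\<And>u. (\<And>a. a \<in> Bx \<Longrightarrow> (\<Sum>t\<in>Y. u t * kap a (dl * y t)) = 0) \<Longrightarrow> (\<And>t. t \<in> Y \<Longrightarrow> u t = 0)"
  obtains Z where "finite Z" "Z \<subseteq> Xq r D" "k_independent r Z" "r * card Y \<le> card G * card Z"
proof -
  let ?P = "\<lambda>n. \<exists>Z. finite Z \<and> Z \<subseteq> Xq r D \<and> card Z = n \<and> k_independent r Z"
  have P0: "?P 0" by (intro exI[of _ "{}"]) (auto simp: k_independent_def)
  have Pb: "?P n \<Longrightarrow> n \<le> card Bx * r" for n using k_dependent by (metis not_le)
  obtain n where n: "?P n" "\<And>m. ?P m \<Longrightarrow> m \<le> n"
    using Greatest_le_nat[of ?P _ "card Bx * r"] GreatestI_nat[of ?P 0 "card Bx * r"] P0 Pb by blast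
  then obtain Z where Z: "finite Z" "Z \<subseteq> Xq r D" "card Z = n" "k_independent r Z" by blast
  have span: "\<exists>u. \<forall>a\<in>Bx. \<forall>j<r. kap a (x j) = (\<Sum>z\<in>Z. u z * kap a (z j))" if x: "x \<in> Xq r D" for x
  proof (cases "x \<in> Z")
    case True
    have "(\<Sum>z\<in>Z. (if z = x then 1 else 0) * kap a (z j)) = kap a (x j)" for a j
      by (subst sum.cong[OF refl, of _ _ "\<lambda>z. if z = x then kap a (x j) else 0"]) (use Z True in auto)
    then show ?thesis by (intro exI[of _ "\<lambda>z. if z = x then 1 else 0"]) auto
  next
    case False
    have "\<not> k_independent r (insert x Z)"
      using n(2)[of "Suc n"] Z x False by (metis Suc_n_not_le_n card_insert_disjoint finite_insert insert_subset)
    then obtain u v where v: "v \<in> insert x Z" "u v \<noteq> 0"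
      and rel: "\<And>a j. a \<in> Bx \<Longrightarrow> j < r \<Longrightarrow> (\<Sum>z\<in>insert x Z. u z * kap a (z j)) = 0"
      unfolding k_independent_def by blast
    have rel': "u x * kap a (x j) + (\<Sum>z\<in>Z. u z * kap a (z j)) = 0" if "a \<in> Bx" "j < r" for a j
      using rel[OF that] Z(1) False by simp
    have ux: "u x \<noteq> 0"
    proof
      assume "u x = 0"
      then have "\<forall>z\<in>Z. u z = 0" using Z(4) rel' unfolding k_independent_def by auto
      then show False using v \<open>u x = 0\<close> by auto
    qed
    have "kap a (x j) = (\<Sum>z\<in>Z. (- u z / u x) * kap a (z j))" if "a \<in> Bx" "j < r" for a j
    proof -
      have "kap a (x j) = - (\<Sum>z\<in>Z. u z * kap a (z j)) / u x"
      proof -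
        have "u x * kap a (x j) = - (\<Sum>z\<in>Z. u z * kap a (z j))"
          using rel'[OF that] by (simp only: eq_neg_iff_add_eq_0)
        then show ?thesis using ux by (metis nonzero_mult_div_cancel_left)
      qed
      also have "\<dots> = (\<Sum>z\<in>Z. (- u z / u x) * kap a (z j))"
        unfolding sum_negf[symmetric] sum_divide_distrib by (intro sum.cong refl) simp
      finally show ?thesis .
    qed
    then show ?thesis by (intro exI[of _ "\<lambda>z. - u z / u x"]) auto
  qed
  have "r * card Y \<le> card G * card Z"
  proof (rule ccontr)
    assume less: "\<not> r * card Y \<le> card G * card Z"
    let ?x = "\<lambda>t k l. Tq r D (\<lambda>i. vl ^ l * un k (y t) i)"
    have x: "?x t k l \<in> Xq r D" if "t \<in> Y" for t k l
      using that by (intro Tq_Xq D S_mult S_power vl_S un_S y)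
    define c where "c t k l = (SOME u. \<forall>a\<in>Bx. \<forall>j<r. kap a (?x t k l j) = (\<Sum>z\<in>Z. u z * kap a (z j)))" for t k l
    have "\<forall>a\<in>Bx. \<forall>j<r. kap a (?x t k l j) = (\<Sum>z\<in>Z. c t k l z * kap a (z j))" if "t \<in> Y" for t k l
      unfolding c_def by (rule someI_ex[OF span[OF x[OF that]]])
    note c = this[rule_format]
    \<comment> \<open>The unknowns are the pairs \<open>(t, k)\<close> and the equations the pairs
      \<open>(l, z)\<close>; the negated bound makes the former more numerous.\<close>
    have "\<exists>w. (\<exists>t\<in>Y\<times>{..<r}. w t \<noteq> 0) \<and>
       (\<forall>i\<in>{..<card G}\<times>Z. (\<Sum>t\<in>Y\<times>{..<r}. w t * c (fst t) (snd t) (fst i) (snd i)) = 0)"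
      by (rule linear_relation_UNIV) (use Z Y less in \<open>auto simp: mult.commute\<close>)
    then obtain w t0 k0 where w: "t0 \<in> Y" "k0 < r" "w (t0, k0) \<noteq> 0"
      and rel: "\<And>l z. l < card G \<Longrightarrow> z \<in> Z \<Longrightarrow> (\<Sum>t\<in>Y\<times>{..<r}. w t * c (fst t) (snd t) l z) = 0"
      by force
    have "(\<Sum>t\<in>Y. w (t, k0) * kap b (dl * y t)) = 0" if b: "b \<in> Bx" for b
    proof -
      have kd: "kap b (dl * un k (y t) k0)
          = (\<Sum>l<card G. \<Sum>a\<in>Bx. \<Sum>z\<in>Z. c t k l z * kap a (z k0) * kap b (bl l * mo a))"
        if t: "t \<in> Y" "k < r" for t k
      proof -
        have "kap b (dl * un k (y t) k0) = (\<Sum>l<card G. kap b (bl l * ?x t k l k0))"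
          unfolding galois_Tq[OF D w(2), symmetric] kap_sum ..
        also have "\<dots> = (\<Sum>l<card G. \<Sum>a\<in>Bx. kap a (?x t k l k0) * kap b (bl l * mo a))"
          using x[OF t(1)] w(2) by (intro sum.cong refl kap_mult) (simp add: Xq_def)
        also have "\<dots> = (\<Sum>l<card G. \<Sum>a\<in>Bx. \<Sum>z\<in>Z. c t k l z * kap a (z k0) * kap b (bl l * mo a))"
          using c[OF t(1) _ w(2)] by (simp add: sum_distrib_right)
        finally show ?thesis .
      qed
      have "(\<Sum>t\<in>Y. w (t, k0) * kap b (dl * y t)) = (\<Sum>t\<in>Y. \<Sum>k<r. w (t, k) * kap b (dl * un k (y t) k0))"
      proof (rule sum.cong[OF refl])
        fix t
        have "(\<Sum>k<r. w (t, k) * kap b (dl * un k (y t) k0)) = (\<Sum>k<r. if k = k0 then w (t, k0) * kap b (dl * y t) else 0)"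
          by (intro sum.cong refl) (auto simp: un_def kap_0)
        then show "w (t, k0) * kap b (dl * y t) = (\<Sum>k<r. w (t, k) * kap b (dl * un k (y t) k0))" using w(2) by simp
      qed
      also have "\<dots> = (\<Sum>t\<in>Y\<times>{..<r}. w t * kap b (dl * un (snd t) (y (fst t)) k0))"
        by (simp add: sum.cartesian_product case_prod_beta)
      also have "\<dots> = (\<Sum>t\<in>Y\<times>{..<r}. \<Sum>l<card G. \<Sum>a\<in>Bx. \<Sum>z\<in>Z.
          (kap a (z k0) * kap b (bl l * mo a)) * (w t * c (fst t) (snd t) l z))"
        by (intro sum.cong refl) (auto simp: kd sum_distrib_left mult_ac)
      also have "\<dots> = (\<Sum>l<card G. \<Sum>a\<in>Bx. \<Sum>z\<in>Z. \<Sum>t\<in>Y\<times>{..<r}.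
          (kap a (z k0) * kap b (bl l * mo a)) * (w t * c (fst t) (snd t) l z))"
        by (subst sum.swap, intro sum.cong refl, subst sum.swap, intro sum.cong refl, rule sum.swap)
      also have "\<dots> = 0"
        unfolding sum_distrib_left[symmetric] by (intro sum.neutral ballI) (simp add: rel)
      finally show ?thesis .
    qed
    then have "w (t0, k0) = 0" using ind[of "\<lambda>t. w (t, k0)"] w(1) by blast
    then show False using w(3) by simp
  qed
  then show thesis using that Z by blast
qed

section \<open>Linear maps between the covariants and the Frobenius pull-back\<close>

definition alpha :: "nat \<Rightarrow> (nat \<Rightarrow> 'a) \<Rightarrow> (nat \<Rightarrow> 'a) \<Rightarrow> 'a" where
  "alpha r x m = (\<Sum>k<r. x k * m k ^ q)"

lemma alpha_R:
  assumes x: "x \<in> Xq r D" and m: "m \<in> Cov r D"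
  shows "alpha r x m \<in> R"
proof -
  have "alpha r x m \<in> S" unfolding alpha_def
    using x by (intro S_sum S_mult S_power Cov_S[OF m]) (simp add: Xq_def)
  moreover have "act g (alpha r x m) = alpha r x m" if g: "g \<in> G" for g
  proof -
    have "alpha r x m = (\<Sum>k<r. x k * (\<Sum>j<r. kc (D g k j) * act g (m j)) ^ q)"
      unfolding alpha_def using Cov_eq[OF m g] by simp
    also have "\<dots> = (\<Sum>k<r. \<Sum>j<r. x k * kc (D g k j) ^ q * act g (m j) ^ q)"
      by (simp add: q_sum sum_distrib_left power_mult_distrib mult.assoc)
    also have "\<dots> = (\<Sum>j<r. (\<Sum>k<r. x k * kc (D g k j) ^ q) * act g (m j) ^ q)"
      by (subst sum.swap) (simp add: sum_distrib_right)
    also have "\<dots> = (\<Sum>j<r. act g (x j) * act g (m j) ^ q)"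
      using x g by (intro sum.cong refl) (simp add: Xq_def)
    also have "\<dots> = act g (alpha r x m)"
      unfolding alpha_def using g by (simp add: act_sum act_mult act_power)
    finally show ?thesis by simp
  qed
  ultimately show ?thesis by (simp add: R_def)
qed

lemma alpha_add: "alpha r x (\<lambda>j. m j + m' j) = alpha r x m + alpha r x m'"
  by (simp add: alpha_def q_add distrib_left sum.distrib)

lemma alpha_smult: "alpha r x (\<lambda>j. \<rho> * m j) = \<rho> ^ q * alpha r x m"
  unfolding alpha_def sum_distrib_left by (intro sum.cong refl) (simp add: power_mult_distrib mult.left_commute)

text \<open>The direction opposite to \<open>alpha\<close>: the coordinate \<open>pi a\<close> of
  \<open>y\<close> is put in position \<open>k\<close> and averaged. Since \<open>pi a\<close> takes
  \<open>q\<close>-th powers out as their roots, this is \<open>R\<close>-linear on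
  \<open>^eR\<close>.\<close>

definition beta :: "nat \<Rightarrow> (('v \<Rightarrow> 'v) \<Rightarrow> nat \<Rightarrow> nat \<Rightarrow> 'k) \<Rightarrow> 'b \<Rightarrow> nat \<Rightarrow> 'a \<Rightarrow> nat \<Rightarrow> 'a" where
  "beta r D a k y = T r D (un k (pi a y))"

lemma beta_Cov: "mrep r D \<Longrightarrow> y \<in> R \<Longrightarrow> beta r D a k y \<in> Cov r D"
  unfolding beta_def by (intro T_un_Cov pi_S R_S)

lemma beta_add: "k < r \<Longrightarrow> beta r D a k (y + z) = (\<lambda>j. beta r D a k y j + beta r D a k z j)"
  unfolding beta_def pi_add by (rule T_un_add)

lemma beta_smult: "\<rho> \<in> R \<Longrightarrow> k < r \<Longrightarrow> beta r D a k (\<rho> ^ q * y) = (\<lambda>j. \<rho> * beta r D a k y j)"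
  unfolding beta_def pi_smult by (rule T_un_R)

lemma beta_sum: assumes "k < r" shows "beta r D a k (sum f A) j = (\<Sum>t\<in>A. beta r D a k (f t) j)"
proof (induction A rule: infinite_finite_induct)
  have 0: "beta r D a k 0 j = 0" for j
    unfolding beta_def pi_0 by (cases "j < r") (simp_all add: T_def un_def act_0)
  { case (infinite A) then show ?case using 0 by simp }
  { case empty then show ?case using 0 by simp }
  { case (insert x A) then show ?case using beta_add[OF assms] by simp }
qed

text \<open>The matrix of the composite \<open>beta \<circ> alpha\<close>; modulo the augmentation ideal its trace is
  \<open>|G|\<close> times the coordinate of \<open>x\<close> that \<open>beta\<close> reads off.\<close>

definition ab :: "nat \<Rightarrow> (('v \<Rightarrow> 'v) \<Rightarrow> nat \<Rightarrow> nat \<Rightarrow> 'k) \<Rightarrow> 'b \<Rightarrow> nat \<Rightarrow> (nat \<Rightarrow> 'a) \<Rightarrow> nat \<Rightarrow> nat \<Rightarrow> 'a" where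
  "ab r D a k x j n = (\<Sum>g\<in>G. \<Sum>i<r. kc (D g j k) * act g (pi a (x i)) * kc (D (iv g) i n))"

text \<open>The covariance equation at \<open>iv g\<close>, translated by \<open>g\<close>.\<close>

lemma Cov_act:
  assumes m: "m \<in> Cov r D" and g: "g \<in> G" and i: "i < r"
  shows "act g (m i) = (\<Sum>n<r. kc (D (iv g) i n) * m n)"
proof -
  have "act g (m i) = act g (\<Sum>n<r. kc (D (iv g) i n) * act (iv g) (m n))"
    using Cov_eq[OF m inv_G[OF g] i] by simp
  then show ?thesis using g by (simp add: act_sum act_mult act_kc act_inv)
qed

lemma beta_alpha:
  assumes m: "m \<in> Cov r D" and k: "k < r" and j: "j < r"
  shows "beta r D a k (alpha r x m) j = (\<Sum>n<r. ab r D a k x j n * m n)"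
proof -
  have "pi a (alpha r x m) = (\<Sum>i<r. m i * pi a (x i))"
    unfolding alpha_def pi_sum by (intro sum.cong refl) (simp add: pi_smult mult.commute[of "x _"])
  then have "beta r D a k (alpha r x m) j = (\<Sum>g\<in>G. kc (D g j k) * act g (\<Sum>i<r. m i * pi a (x i)))"
    unfolding beta_def T_un[OF j k] by simp
  also have "\<dots> = (\<Sum>g\<in>G. \<Sum>i<r. kc (D g j k) * act g (pi a (x i)) * act g (m i))"
    by (intro sum.cong refl) (simp add: act_sum act_mult sum_distrib_left mult_ac)
  also have "\<dots> = (\<Sum>g\<in>G. \<Sum>i<r. kc (D g j k) * act g (pi a (x i)) * (\<Sum>n<r. kc (D (iv g) i n) * m n))"
    by (intro sum.cong refl) (simp add: Cov_act[OF m])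
  also have "\<dots> = (\<Sum>g\<in>G. \<Sum>i<r. \<Sum>n<r. kc (D g j k) * act g (pi a (x i)) * kc (D (iv g) i n) * m n)"
    by (simp add: sum_distrib_left mult.assoc)
  also have "\<dots> = (\<Sum>n<r. \<Sum>g\<in>G. \<Sum>i<r. kc (D g j k) * act g (pi a (x i)) * kc (D (iv g) i n) * m n)"
  proof -
    have "(\<Sum>g\<in>G. \<Sum>i<r. \<Sum>n<r. F g i n) = (\<Sum>g\<in>G. \<Sum>n<r. \<Sum>i<r. F g i n)" for F :: "('v \<Rightarrow> 'v) \<Rightarrow> nat \<Rightarrow> nat \<Rightarrow> 'a"
      by (intro sum.cong refl sum.swap)
    then show ?thesis by (simp only: sum.swap[of _ "{..<r}" G])
  qed
  also have "\<dots> = (\<Sum>n<r. ab r D a k x j n * m n)"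
    unfolding ab_def sum_distrib_right ..
  finally show ?thesis .
qed

text \<open>On the diagonal \<open>D (iv g)\<close> and \<open>D g\<close> meet and cancel, and the
  augmentation removes the action, so all elements of \<open>G\<close> contribute the same
  term.\<close>

lemma ab_trace:
  assumes D: "mrep r D" and k: "k < r"
  shows "(\<Sum>j<r. ep (ab r D a k x j j)) = of_nat (card G) * kap a (x k)"
proof -
  have "(\<Sum>j<r. ep (ab r D a k x j j)) = (\<Sum>j<r. \<Sum>g\<in>G. \<Sum>i<r. kap a (x i) * (D (iv g) i j * D g j k))"
    by (simp add: ab_def ep_sum ep_mult ep_kc ep_act kap_def mult_ac)
  also have "\<dots> = (\<Sum>g\<in>G. \<Sum>i<r. \<Sum>j<r. kap a (x i) * (D (iv g) i j * D g j k))"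
    by (subst sum.swap) (intro sum.cong refl sum.swap)
  also have "\<dots> = (\<Sum>g\<in>G. \<Sum>i<r. if i = k then kap a (x k) else 0)"
  proof (intro sum.cong refl)
    fix g i assume g: "g \<in> G" and i: "i \<in> {..<r}"
    have "(\<Sum>j<r. kap a (x i) * (D (iv g) i j * D g j k)) = kap a (x i) * D (iv g \<circ> g) i k"
      using mrep_comp[OF D inv_G[OF g] g _ k, of i] i by (simp add: sum_distrib_left)
    also have "\<dots> = (if i = k then kap a (x k) else 0)"
      unfolding inv_comp[OF g] using mrep_id[OF D _ k, of i] i by auto
    finally show "(\<Sum>j<r. kap a (x i) * (D (iv g) i j * D g j k)) = (if i = k then kap a (x k) else 0)" .
  qed
  also have "\<dots> = of_nat (card G) * kap a (x k)" using k by simp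
  finally show ?thesis .
qed

text \<open>\<open>R\<close>-linearity of a map out of \<open>^eR\<close>, written on the ring
  itself, where the scalar \<rho> acts as \<open>\<rho> ^ q\<close>; \<open>qlin_from\<close> is the
  counterpart for maps into \<open>^eR\<close>.\<close>

definition qlin_to where
  "qlin_to r D \<Phi> \<longleftrightarrow> (\<forall>y\<in>R. \<Phi> y \<in> Cov r D) \<and>
     (\<forall>y\<in>R. \<forall>z\<in>R. \<Phi> (y + z) = (\<lambda>j. \<Phi> y j + \<Phi> z j)) \<and>
     (\<forall>\<rho>\<in>R. \<forall>y\<in>R. \<Phi> (\<rho> ^ q * y) = (\<lambda>j. \<rho> * \<Phi> y j))"

definition qlin_from where
  "qlin_from r D \<Psi> \<longleftrightarrow> (\<forall>m\<in>Cov r D. \<Psi> m \<in> R) \<and>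
     (\<forall>m\<in>Cov r D. \<forall>m'\<in>Cov r D. \<Psi> (\<lambda>j. m j + m' j) = \<Psi> m + \<Psi> m') \<and>
     (\<forall>\<rho>\<in>R. \<forall>m\<in>Cov r D. \<Psi> (\<lambda>j. \<rho> * m j) = \<rho> ^ q * \<Psi> m)"

lemma qlin_to_alpha:
  assumes "x \<in> Xq r D" "qlin_to r' D' \<Phi>"
  shows "lin r D r' D' (\<lambda>m. \<Phi> (alpha r x m))"
  using assms alpha_R[OF assms(1)] unfolding lin_def qlin_to_def by (simp add: alpha_add alpha_smult)

lemma beta_qlin_from:
  assumes "mrep r D" "k < r" "qlin_from r' D' \<Psi>"
  shows "lin r' D' r D (\<lambda>m. beta r D a k (\<Psi> m))"
  using assms beta_Cov[OF assms(1)] unfolding lin_def qlin_from_def by (simp add: beta_add beta_smult)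

lemma lin_matrix_intertwiner:
  assumes D: "mrep r D" "mrep r' D'" and \<phi>: "lin r D r' D' \<phi>"
  shows "\<exists>A. (\<forall>m\<in>Cov r D. \<forall>j<r'. \<phi> m j = (\<Sum>k<r. A j k * m k)) \<and>
    intertwiner r D r' D' (\<lambda>j k. ep (A j k))"
proof -
  obtain A where A: "\<And>m j. m \<in> Cov r D \<Longrightarrow> j < r' \<Longrightarrow> \<phi> m j = (\<Sum>k<r. A j k * m k)"
    using lin_matrix[OF D \<phi>] by blast
  have "(\<lambda>j. if j < r' then \<Sum>k<r. A j k * m k else 0) \<in> Cov r' D'" if "m \<in> Cov r D" for m
  proof -
    have "(\<lambda>j. if j < r' then \<Sum>k<r. A j k * m k else 0) = \<phi> m"
      using A[OF that] Cov_out[OF lin_Cov[OF \<phi> that]] by auto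
    then show ?thesis using lin_Cov[OF \<phi> that] by simp
  qed
  from intertwining[OF D this] have "intertwiner r D r' D' (\<lambda>j k. ep (A j k))"
    unfolding intertwiner_def by blast
  then show ?thesis using A by blast
qed

lemma matrix_unique:
  assumes D: "mrep r D" and "\<And>m. m \<in> Cov r D \<Longrightarrow> (\<Sum>k<r. A k * m k) = (\<Sum>k<r. B k * m k)" and "k < r"
  shows "A k = B k"
  using Cov_annihilator[OF D _ assms(3), of "\<lambda>k. A k - B k"] assms(2)
  by (simp add: left_diff_distrib sum_subtractf)

text \<open>The matrix of \<open>beta\<close> after \<open>alpha\<close> is the sum over the
  summands \<open>t\<close> of products of a matrix into and a matrix out of \<open>t\<close>. After
  augmentation Schur's lemma removes all \<open>t\<close> outside \<open>J0\<close> and leaves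
  scalars on \<open>J0\<close>, so the trace identity expresses every coordinate
  \<open>kap a (x k)\<close> through the \<open>card J0\<close> values \<open>c t x\<close>. More
  than \<open>card J0\<close> elements would admit a relation among these values, hence among their
  coordinates, because \<open>card G\<close> is invertible.\<close>

lemma multiplicity_bound:
  assumes J: "finite J" and D0: "mrep r0 D0" and D: "\<And>t. t \<in> J \<Longrightarrow> mrep (r t) (D t)"
    and \<Phi>: "\<And>t. t \<in> J \<Longrightarrow> qlin_to (r t) (D t) (\<Phi> t)" and \<Psi>: "\<And>t. t \<in> J \<Longrightarrow> qlin_from (r t) (D t) (\<Psi> t)"
    and dec: "\<And>y. y \<in> R \<Longrightarrow> (\<Sum>t\<in>J. \<Psi> t (\<Phi> t y)) = y"
    and J0: "J0 \<subseteq> J"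
    and schur0: "\<And>t Q j k. t \<in> J - J0 \<Longrightarrow> intertwiner r0 D0 (r t) (D t) Q \<Longrightarrow> j < r t \<Longrightarrow> k < r0 \<Longrightarrow> Q j k = 0"
    and J0D: "\<And>t. t \<in> J0 \<Longrightarrow> r t = r0 \<and> D t = D0"
    and schur1: "\<And>Q. intertwiner r0 D0 r0 D0 Q \<Longrightarrow> \<exists>c. \<forall>j<r0. \<forall>k<r0. Q j k = (if j = k then c else 0)"
    and cG: "of_nat (card G) \<noteq> (0::'k)"
    and Z: "finite Z" "Z \<subseteq> Xq r0 D0" "k_independent r0 Z"
  shows "card Z \<le> card J0"
proof (rule ccontr)
  assume less: "\<not> card Z \<le> card J0"
  define Cp where "Cp t x A \<longleftrightarrow> (\<forall>m\<in>Cov r0 D0. \<forall>j<r t. \<Phi> t (alpha r0 x m) j = (\<Sum>k<r0. A j k * m k))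
     \<and> intertwiner r0 D0 (r t) (D t) (\<lambda>j k. ep (A j k))" for t x A
  define C where "C t x = (SOME A. Cp t x A)" for t x
  have C: "Cp t x (C t x)" if t: "t \<in> J" and x: "x \<in> Z" for t x
  proof -
    have "x \<in> Xq r0 D0" using x Z by auto
    have "\<exists>A. Cp t x A" unfolding Cp_def
      by (rule lin_matrix_intertwiner[OF D0 D[OF t] qlin_to_alpha[OF \<open>x \<in> Xq r0 D0\<close> \<Phi>[OF t]]])
    then show ?thesis unfolding C_def by (rule someI_ex)
  qed
  define Bp where "Bp t a k A \<longleftrightarrow> (\<forall>m\<in>Cov (r t) (D t). \<forall>j<r0. beta r0 D0 a k (\<Psi> t m) j = (\<Sum>l<r t. A j l * m l))
     \<and> intertwiner (r t) (D t) r0 D0 (\<lambda>j k. ep (A j k))" for t a k A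
  define B where "B t a k = (SOME A. Bp t a k A)" for t a k
  have B: "Bp t a k (B t a k)" if t: "t \<in> J" and k: "k < r0" for t a k
  proof -
    have "\<exists>A. Bp t a k A" unfolding Bp_def
      by (rule lin_matrix_intertwiner[OF D[OF t] D0 beta_qlin_from[OF D0 k \<Psi>[OF t]]])
    then show ?thesis unfolding B_def by (rule someI_ex)
  qed
  define c where "c t x = (SOME c. \<forall>j<r0. \<forall>k<r0. ep (C t x j k) = (if j = k then c else 0))" for t x
  have c: "ep (C t x j k) = (if j = k then c t x else 0)" if "t \<in> J0" "x \<in> Z" "j < r0" "k < r0" for t x j k
  proof -
    have "intertwiner r0 D0 r0 D0 (\<lambda>j k. ep (C t x j k))"
      using C[of t x] that J0 J0D[OF that(1)] unfolding Cp_def by auto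
    from someI_ex[OF schur1[OF this]] show ?thesis using that unfolding c_def by blast
  qed
  define b where "b t a k = (SOME c. \<forall>j<r0. \<forall>l<r0. ep (B t a k j l) = (if j = l then c else 0))" for t a k
  have b: "ep (B t a k j l) = (if j = l then b t a k else 0)" if "t \<in> J0" "k < r0" "j < r0" "l < r0" for t a k j l
  proof -
    have "intertwiner r0 D0 r0 D0 (\<lambda>j l. ep (B t a k j l))"
      using B[of t k a] that J0 J0D[OF that(1)] unfolding Bp_def by auto
    from someI_ex[OF schur1[OF this]] show ?thesis using that unfolding b_def by blast
  qed
  \<comment> \<open>Both matrices describe the same map on covariants, and covariants determine a
    matrix.\<close>
  have ab: "ab r0 D0 a k x j n = (\<Sum>t\<in>J. \<Sum>l<r t. B t a k j l * C t x l n)"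
    if x: "x \<in> Z" and k: "k < r0" and j: "j < r0" and n: "n < r0" for a k x j n
  proof (rule matrix_unique[OF D0 _ n])
    fix m assume m: "m \<in> Cov r0 D0"
    have xX: "x \<in> Xq r0 D0" using x Z by auto
    have aR: "alpha r0 x m \<in> R" by (rule alpha_R[OF xX m])
    have "(\<Sum>n<r0. ab r0 D0 a k x j n * m n) = beta r0 D0 a k (\<Sum>t\<in>J. \<Psi> t (\<Phi> t (alpha r0 x m))) j"
      unfolding dec[OF aR] by (rule beta_alpha[OF m k j, symmetric])
    also have "\<dots> = (\<Sum>t\<in>J. beta r0 D0 a k (\<Psi> t (\<Phi> t (alpha r0 x m))) j)" by (rule beta_sum[OF k])
    also have "\<dots> = (\<Sum>t\<in>J. \<Sum>l<r t. B t a k j l * (\<Sum>n<r0. C t x l n * m n))"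
    proof (rule sum.cong[OF refl])
      fix t assume t: "t \<in> J"
      have "\<Phi> t (alpha r0 x m) \<in> Cov (r t) (D t)" using \<Phi>[OF t] aR by (simp add: qlin_to_def)
      then have "beta r0 D0 a k (\<Psi> t (\<Phi> t (alpha r0 x m))) j = (\<Sum>l<r t. B t a k j l * \<Phi> t (alpha r0 x m) l)"
        using B[OF t k] j unfolding Bp_def by blast
      also have "\<dots> = (\<Sum>l<r t. B t a k j l * (\<Sum>n<r0. C t x l n * m n))"
        using C[OF t x] m unfolding Cp_def by (intro sum.cong refl) simp
      finally show "beta r0 D0 a k (\<Psi> t (\<Phi> t (alpha r0 x m))) j = (\<Sum>l<r t. B t a k j l * (\<Sum>n<r0. C t x l n * m n))" .
    qed
    also have "\<dots> = (\<Sum>t\<in>J. \<Sum>n<r0. \<Sum>l<r t. B t a k j l * C t x l n * m n)"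
      unfolding sum_distrib_left mult.assoc by (intro sum.cong refl sum.swap)
    also have "\<dots> = (\<Sum>n<r0. (\<Sum>t\<in>J. \<Sum>l<r t. B t a k j l * C t x l n) * m n)"
      unfolding sum_distrib_right by (rule sum.swap)
    finally show "(\<Sum>n<r0. ab r0 D0 a k x j n * m n) = (\<Sum>n<r0. (\<Sum>t\<in>J. \<Sum>l<r t. B t a k j l * C t x l n) * m n)" .
  qed
  \<comment> \<open>Only the scalars at \<open>J0\<close> are left; the factor \<open>r0\<close> is
    the trace of the unit matrix.\<close>
  have key: "of_nat (card G) * kap a (x k) = (\<Sum>t\<in>J0. of_nat r0 * b t a k * c t x)"
    if x: "x \<in> Z" and k: "k < r0" for a k x
  proof -
    have "of_nat (card G) * kap a (x k) = (\<Sum>j<r0. \<Sum>t\<in>J. \<Sum>l<r t. ep (B t a k j l) * ep (C t x l j))"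
      unfolding ab_trace[OF D0 k, symmetric] by (simp add: ab[OF x k] ep_sum ep_mult)
    also have "\<dots> = (\<Sum>t\<in>J. \<Sum>j<r0. \<Sum>l<r t. ep (B t a k j l) * ep (C t x l j))" by (rule sum.swap)
    also have "\<dots> = (\<Sum>t\<in>J0. \<Sum>j<r0. \<Sum>l<r t. ep (B t a k j l) * ep (C t x l j))"
    proof (rule sum.mono_neutral_right[OF J J0], rule ballI)
      fix t assume t: "t \<in> J - J0"
      have "intertwiner r0 D0 (r t) (D t) (\<lambda>j k. ep (C t x j k))" using C[of t x] t x unfolding Cp_def by blast
      then have "ep (C t x l j) = 0" if "l < r t" "j < r0" for l j
        using schur0[OF t _ that, of "\<lambda>j k. ep (C t x j k)"] by simp
      then show "(\<Sum>j<r0. \<Sum>l<r t. ep (B t a k j l) * ep (C t x l j)) = 0" by simp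
    qed
    also have "\<dots> = (\<Sum>t\<in>J0. of_nat r0 * b t a k * c t x)"
    proof (rule sum.cong[OF refl])
      fix t assume t: "t \<in> J0"
      have "(\<Sum>l<r0. ep (B t a k j l) * ep (C t x l j)) = b t a k * c t x" if j: "j < r0" for j
      proof -
        have "(\<Sum>l<r0. ep (B t a k j l) * ep (C t x l j)) = (\<Sum>l<r0. if l = j then b t a k * c t x else 0)"
          by (intro sum.cong refl) (auto simp: b[OF t k j] c[OF t x _ j])
        then show ?thesis using j by simp
      qed
      then show "(\<Sum>j<r0. \<Sum>l<r t. ep (B t a k j l) * ep (C t x l j)) = of_nat r0 * b t a k * c t x"
        using J0D[OF t] by (simp add: mult.assoc)
    qed
    finally show ?thesis .
  qed
  have "\<exists>u. (\<exists>x\<in>Z. u x \<noteq> 0) \<and> (\<forall>t\<in>J0. (\<Sum>x\<in>Z. u x * c t x) = 0)"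
    by (rule linear_relation_UNIV) (use Z less J0 J finite_subset in auto)
  then obtain u x0 where x0: "x0 \<in> Z" "u x0 \<noteq> 0" and u: "\<And>t. t \<in> J0 \<Longrightarrow> (\<Sum>x\<in>Z. u x * c t x) = 0" by blast
  have "(\<Sum>x\<in>Z. u x * kap a (x k)) = 0" if k: "k < r0" for a k
  proof -
    have "of_nat (card G) * (\<Sum>x\<in>Z. u x * kap a (x k)) = (\<Sum>x\<in>Z. u x * (of_nat (card G) * kap a (x k)))"
      by (simp add: sum_distrib_left mult_ac)
    also have "\<dots> = (\<Sum>x\<in>Z. \<Sum>t\<in>J0. of_nat r0 * b t a k * (u x * c t x))"
      by (intro sum.cong refl) (simp add: key[OF _ k] sum_distrib_left mult_ac)
    also have "\<dots> = (\<Sum>t\<in>J0. of_nat r0 * b t a k * (\<Sum>x\<in>Z. u x * c t x))"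
      by (subst sum.swap) (simp add: sum_distrib_left)
    also have "\<dots> = 0" using u by simp
    finally show ?thesis using cG by simp
  qed
  then have "u x0 = 0" using Z(3) x0(1) unfolding k_independent_def by blast
  then show False using x0(2) by simp
qed

text \<open>Maximal independent sets of covariants, with \<open>r t\<close> elements for each
  \<open>t\<close>, are pushed into \<open>R\<close> by the \<Psi>. More than \<open>card Bx\<close>
  images would satisfy a relation with coefficients \<open>s ^ q\<close>; these pass inside the
  \<Psi> as \<open>s\<close>, and injectivity of the total map gives an \<open>R\<close>-relation
  inside one of the independent sets.\<close>

lemma total_bound:
  assumes J: "finite J" and D: "\<And>t. t \<in> J \<Longrightarrow> mrep (r t) (D t)"
    and \<Psi>: "\<And>t. t \<in> J \<Longrightarrow> qlin_from (r t) (D t) (\<Psi> t)"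
    and inj: "\<And>w. (\<And>t. t \<in> J \<Longrightarrow> w t \<in> Cov (r t) (D t)) \<Longrightarrow> (\<Sum>t\<in>J. \<Psi> t (w t)) = 0 \<Longrightarrow>
        (\<And>t j. t \<in> J \<Longrightarrow> w t j = 0)"
  shows "(\<Sum>t\<in>J. r t) \<le> card Bx"
proof (rule ccontr)
  assume less: "\<not> (\<Sum>t\<in>J. r t) \<le> card Bx"
  define E where "E t = (SOME B. finite B \<and> B \<subseteq> Cov (r t) (D t) \<and> card B = r t \<and> R_independent (r t) B)" for t
  have E: "finite (E t) \<and> E t \<subseteq> Cov (r t) (D t) \<and> card (E t) = r t \<and> R_independent (r t) (E t)" if t: "t \<in> J" for t
  proof -
    obtain B where "finite B" "B \<subseteq> Cov (r t) (D t)" "card B = r t" "R_independent (r t) B"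
      by (rule Cov_basis[OF D[OF t]])
    then have "finite B \<and> B \<subseteq> Cov (r t) (D t) \<and> card B = r t \<and> R_independent (r t) B" by blast
    then show ?thesis unfolding E_def by (rule someI)
  qed
  \<comment> \<open>Indexing by pairs keeps the elements apart even when their images in
    \<open>R\<close> coincide.\<close>
  let ?I = "SIGMA t:J. E t"
  have fin: "finite ?I" using J E by auto
  have "card ?I = (\<Sum>t\<in>J. r t)" using J E by simp
  then have less': "card Bx < card ?I" using less by simp
  have yR: "\<Psi> (fst i) (snd i) \<in> R" if "i \<in> ?I" for i
    using that E \<Psi> unfolding qlin_from_def by fastforce
  obtain s u where s: "\<And>i. i \<in> ?I \<Longrightarrow> s i \<in> R" and u: "u \<in> ?I" "s u \<noteq> 0"
    and rel: "(\<Sum>i\<in>?I. s i ^ q * \<Psi> (fst i) (snd i)) = 0"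
    by (rule frobenius_dependent[OF fin less', of "\<lambda>i. \<Psi> (fst i) (snd i)"]) (use yR in blast)+
  \<comment> \<open>The relation, regrouped into one covariant for each summand.\<close>
  define w where "w t = (\<lambda>j. \<Sum>x\<in>E t. s (t, x) * x j)" for t
  have \<Psi>sum: "\<Psi> t (\<lambda>j. \<Sum>x\<in>A. s (t, x) * x j) = (\<Sum>x\<in>A. s (t, x) ^ q * \<Psi> t x)"
    if t: "t \<in> J" and A: "finite A" "A \<subseteq> E t" for t A
    using A
  proof (induction A rule: finite_induct)
    case empty
    have "\<Psi> t (\<lambda>j. 0 * 0) = 0 ^ q * \<Psi> t (\<lambda>_. 0)"
      using \<Psi>[OF t] R_0 Cov_0[of "r t" "D t"] unfolding qlin_from_def by meson
    then show ?case using q_pos by (simp add: zero_power)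
  next
    case (insert x A)
    have x: "x \<in> Cov (r t) (D t)" and sx: "s (t, x) \<in> R" using E[OF t] insert.prems s t by auto
    have A: "(\<lambda>j. \<Sum>x\<in>A. s (t, x) * x j) \<in> Cov (r t) (D t)"
      using E[OF t] insert.prems s t by (intro Cov_sum Cov_smult) auto
    have "\<Psi> t (\<lambda>j. \<Sum>x\<in>insert x A. s (t, x) * x j) = \<Psi> t (\<lambda>j. s (t, x) * x j + (\<Sum>x\<in>A. s (t, x) * x j))"
      using insert.hyps by simp
    also have "\<dots> = \<Psi> t (\<lambda>j. s (t, x) * x j) + \<Psi> t (\<lambda>j. \<Sum>x\<in>A. s (t, x) * x j)"
      using \<Psi>[OF t] Cov_smult[OF sx x] A by (simp add: qlin_from_def)
    also have "\<Psi> t (\<lambda>j. s (t, x) * x j) = s (t, x) ^ q * \<Psi> t x"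
      using \<Psi>[OF t] sx x by (simp add: qlin_from_def)
    finally show ?case using insert by simp
  qed
  have wC: "w t \<in> Cov (r t) (D t)" if "t \<in> J" for t
    unfolding w_def using E[OF that] s that by (intro Cov_sum Cov_smult) auto
  have "(\<Sum>t\<in>J. \<Psi> t (w t)) = (\<Sum>t\<in>J. \<Sum>x\<in>E t. s (t, x) ^ q * \<Psi> t x)"
    unfolding w_def by (intro sum.cong refl \<Psi>sum) (use E in blast)+
  also have "\<dots> = 0" using rel J E by (simp add: sum.Sigma case_prod_beta)
  finally have sum0: "(\<Sum>t\<in>J. \<Psi> t (w t)) = 0" .
  have w0: "w t j = 0" if "t \<in> J" for t j by (rule inj[of w]) (use wC sum0 that in simp_all)
  have "\<forall>x\<in>E t. s (t, x) = 0" if "t \<in> J" for t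
  proof -
    have "\<forall>x\<in>E t. s (t, x) \<in> R" using s that by blast
    moreover have "\<forall>j<r t. (\<Sum>x\<in>E t. s (t, x) * x j) = 0"
      using w0[OF that] by (simp add: w_def)
    ultimately show ?thesis using E[OF that] unfolding R_independent_def by (elim conjE allE[of _ "\<lambda>x. s (t, x)"]) simp
  qed
  then show False using u by auto
qed

end

section \<open>Additive maps on finitely supported functions\<close>

lemma poly_mapping_expansion: "(\<Sum>m\<in>Poly_Mapping.keys p. Poly_Mapping.single m (Poly_Mapping.lookup p m)) = p"
proof (rule poly_mapping_eqI)
  fix k
  have "Poly_Mapping.lookup (\<Sum>m\<in>Poly_Mapping.keys p. Poly_Mapping.single m (Poly_Mapping.lookup p m)) k
      = (\<Sum>m\<in>Poly_Mapping.keys p. if m = k then Poly_Mapping.lookup p k else 0)"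
    unfolding lookup_sum by (intro sum.cong refl) (simp add: lookup_single when_def)
  then show "Poly_Mapping.lookup (\<Sum>m\<in>Poly_Mapping.keys p. Poly_Mapping.single m (Poly_Mapping.lookup p m)) k
      = Poly_Mapping.lookup p k"
    by (simp add: in_keys_iff)
qed

lemma poly_mapping_single_induct:
  fixes p :: "'m \<Rightarrow>\<^sub>0 'b::comm_monoid_add"
  assumes "P 0" "\<And>m c. P (Poly_Mapping.single m c)" "\<And>p q. P p \<Longrightarrow> P q \<Longrightarrow> P (p + q)"
  shows "P p"
proof -
  have "P (\<Sum>m\<in>A. Poly_Mapping.single m (Poly_Mapping.lookup p m))" for A
    by (induction A rule: infinite_finite_induct) (use assms in auto)
  from this[of "Poly_Mapping.keys p"] show ?thesis by (simp only: poly_mapping_expansion)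
qed

text \<open>One construction for the evaluation of polynomials, the Frobenius coordinates
  \<open>rc\<close> and the tensor coordinates \<open>tau\<close>: an additive map prescribed on
  one-term functions.\<close>

definition additive_extension ::
  "('m \<Rightarrow> 'k \<Rightarrow> 'b::comm_monoid_add) \<Rightarrow> ('m \<Rightarrow>\<^sub>0 'k::comm_monoid_add) \<Rightarrow> 'b" where
  "additive_extension F p = (\<Sum>m\<in>Poly_Mapping.keys p. F m (Poly_Mapping.lookup p m))"

context
  fixes F :: "'m \<Rightarrow> 'k::comm_monoid_add \<Rightarrow> 'b::comm_monoid_add"
  assumes F_0: "\<And>m. F m 0 = 0" and F_add: "\<And>m c d. F m (c + d) = F m c + F m d"
begin

lemma additive_extension_superset:
  assumes "finite A" "Poly_Mapping.keys p \<subseteq> A"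
  shows "additive_extension F p = (\<Sum>m\<in>A. F m (Poly_Mapping.lookup p m))"
  unfolding additive_extension_def
  by (rule sum.mono_neutral_left) (use assms F_0 in \<open>auto simp: in_keys_iff\<close>)

lemma additive_extension_add: "additive_extension F (p + q) = additive_extension F p + additive_extension F q"
proof -
  let ?A = "Poly_Mapping.keys p \<union> Poly_Mapping.keys q"
  have "additive_extension F r = (\<Sum>m\<in>?A. F m (Poly_Mapping.lookup r m))" if "Poly_Mapping.keys r \<subseteq> ?A" for r
    using additive_extension_superset[OF _ that] by simp
  from this[of p] this[of q] this[of "p + q"] show ?thesis
    using Poly_Mapping.keys_add[of p q] by (simp add: lookup_add F_add sum.distrib)
qed

lemma additive_extension_0: "additive_extension F 0 = 0"
  by (simp add: additive_extension_def)

lemma additive_extension_single: "additive_extension F (Poly_Mapping.single m c) = F m c"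
  by (simp add: additive_extension_def F_0)

end

section \<open>Polynomials\<close>

definition monomial_value :: "('x \<Rightarrow> 'a::comm_monoid_mult) \<Rightarrow> ('x \<Rightarrow>\<^sub>0 nat) \<Rightarrow> 'a" where
  "monomial_value f m = (\<Prod>v\<in>Poly_Mapping.keys m. f v ^ Poly_Mapping.lookup m v)"

lemma monomial_value_superset:
  "finite A \<Longrightarrow> Poly_Mapping.keys m \<subseteq> A \<Longrightarrow> monomial_value f m = (\<Prod>v\<in>A. f v ^ Poly_Mapping.lookup m v)"
  unfolding monomial_value_def by (rule prod.mono_neutral_left) (auto simp: in_keys_iff)

lemma monomial_value_0: "monomial_value f 0 = 1" by (simp add: monomial_value_def)
lemma monomial_value_single: "monomial_value f (Poly_Mapping.single v 1) = f v" by (simp add: monomial_value_def)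

lemma monomial_value_add: "monomial_value f (m + n) = monomial_value f m * monomial_value f n"
proof -
  let ?A = "Poly_Mapping.keys m \<union> Poly_Mapping.keys n"
  have "monomial_value f r = (\<Prod>v\<in>?A. f v ^ Poly_Mapping.lookup r v)" if "Poly_Mapping.keys r \<subseteq> ?A" for r
    using monomial_value_superset[OF _ that] by simp
  from this[of m] this[of n] this[of "m + n"] show ?thesis
    using Poly_Mapping.keys_add[of m n] by (simp add: lookup_add power_add prod.distrib)
qed

definition poly_eval :: "('k::comm_ring_1 \<Rightarrow> 'a::comm_ring_1) \<Rightarrow> ('x \<Rightarrow> 'a) \<Rightarrow> (('x \<Rightarrow>\<^sub>0 nat) \<Rightarrow>\<^sub>0 'k) \<Rightarrow> 'a" where
  "poly_eval \<kappa> f = additive_extension (\<lambda>m c. \<kappa> c * monomial_value f m)"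

definition coefficient_hom :: "('k::comm_ring_1 \<Rightarrow> 'a::comm_ring_1) \<Rightarrow> bool" where
  "coefficient_hom \<kappa> \<longleftrightarrow> \<kappa> 1 = 1 \<and> (\<forall>a b. \<kappa> (a + b) = \<kappa> a + \<kappa> b) \<and> (\<forall>a b. \<kappa> (a * b) = \<kappa> a * \<kappa> b)"

context
  fixes \<kappa> :: "'k::comm_ring_1 \<Rightarrow> 'a::comm_ring_1" and f :: "'x \<Rightarrow> 'a"
  assumes \<kappa>: "coefficient_hom \<kappa>"
begin

lemma coefficient_hom_0: "\<kappa> 0 = 0"
proof -
  have "\<kappa> (0 + 0) = \<kappa> 0 + \<kappa> 0" using \<kappa> unfolding coefficient_hom_def by blast
  then show ?thesis by (metis add.right_neutral add_cancel_left_left)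
qed

lemma poly_eval_F: "\<kappa> 0 * monomial_value f m = 0" "\<kappa> (c + d) * monomial_value f m = \<kappa> c * monomial_value f m + \<kappa> d * monomial_value f m"
  using \<kappa> coefficient_hom_0 by (simp_all add: coefficient_hom_def distrib_right)

lemma poly_eval_add: "poly_eval \<kappa> f (p + q) = poly_eval \<kappa> f p + poly_eval \<kappa> f q"
  unfolding poly_eval_def by (rule additive_extension_add) (rule poly_eval_F)+
lemma poly_eval_0: "poly_eval \<kappa> f 0 = 0"
  unfolding poly_eval_def by (rule additive_extension_0) (rule poly_eval_F)+
lemma poly_eval_single: "poly_eval \<kappa> f (Poly_Mapping.single m c) = \<kappa> c * monomial_value f m"
  unfolding poly_eval_def by (rule additive_extension_single) (rule poly_eval_F)+

lemma poly_eval_mult: "poly_eval \<kappa> f (p * q) = poly_eval \<kappa> f p * poly_eval \<kappa> f q"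
proof (induction p rule: poly_mapping_single_induct)
  case (2 m c)
  show ?case
  proof (induction q rule: poly_mapping_single_induct)
    case (2 n d)
    show ?case using \<kappa>
      by (simp add: mult_single poly_eval_single monomial_value_add coefficient_hom_def mult_ac)
  qed (simp_all add: poly_eval_0 poly_eval_add distrib_left)
qed (simp_all add: poly_eval_0 poly_eval_add distrib_right)

end

lemma poly_eval_const: "coefficient_hom \<kappa> \<Longrightarrow> poly_eval \<kappa> f (sym_const c) = \<kappa> c"
  by (simp add: sym_const_def poly_eval_single monomial_value_0)
lemma poly_eval_var: "coefficient_hom \<kappa> \<Longrightarrow> poly_eval \<kappa> f (sym_var v) = f v"
  by (simp add: sym_var_def poly_eval_single monomial_value_single coefficient_hom_def del: One_nat_def)
lemma poly_eval_1: "coefficient_hom \<kappa> \<Longrightarrow> poly_eval \<kappa> f 1 = 1"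
  using poly_eval_single[of \<kappa> f 0 1] by (simp add: monomial_value_0 coefficient_hom_def)

lemma single_power: "Poly_Mapping.single m (c::'k::comm_semiring_1) ^ n = Poly_Mapping.single (\<Sum>_<n. m) (c ^ n)"
  for m :: "'m::comm_monoid_add"
  by (induction n) (simp_all add: mult_single add.commute)

lemma sum_single_nat: "(\<Sum>_<n. Poly_Mapping.single v 1) = Poly_Mapping.single v (n::nat)"
  by (induction n) (simp_all flip: single_add)

lemma monomial_value_var: "monomial_value (\<lambda>v. sym_var (g v)) m
    = (Poly_Mapping.single (\<Sum>v\<in>Poly_Mapping.keys m. Poly_Mapping.single (g v) (Poly_Mapping.lookup m v)) 1
       :: ('y \<Rightarrow>\<^sub>0 nat) \<Rightarrow>\<^sub>0 'k::field)"
proof -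
  have "(\<Prod>v\<in>A. Poly_Mapping.single (e v) 1) = (Poly_Mapping.single (\<Sum>v\<in>A. e v) 1 :: ('y \<Rightarrow>\<^sub>0 nat) \<Rightarrow>\<^sub>0 'k)"
    for A :: "'x set" and e
    by (induction A rule: infinite_finite_induct) (simp_all add: mult_single)
  then show ?thesis
    unfolding monomial_value_def sym_var_def by (simp add: single_power sum_single_nat del: One_nat_def)
qed

lemma coefficient_hom_const: "coefficient_hom (sym_const :: 'k::field \<Rightarrow> ('x \<Rightarrow>\<^sub>0 nat) \<Rightarrow>\<^sub>0 'k)"
  by (simp add: coefficient_hom_def sym_const_def single_add mult_single)

text \<open>Recognising the explicit sum as a substitution makes \<open>sym_rename g\<close> an
  algebra homomorphism, determined by its values on constants and variables.\<close>

lemma sym_rename_eval: "sym_rename g p = poly_eval sym_const (\<lambda>v. sym_var (g v)) p"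
  unfolding sym_rename_def poly_eval_def additive_extension_def monomial_value_var sym_const_def
  by (simp add: mult_single)

lemma polynomial_induct [case_names const var add mult]:
  fixes p :: "('x \<Rightarrow>\<^sub>0 nat) \<Rightarrow>\<^sub>0 'k::field"
  assumes c: "\<And>c. P (sym_const c)" and v: "\<And>v. P (sym_var v)"
    and a: "\<And>p q. P p \<Longrightarrow> P q \<Longrightarrow> P (p + q)" and m: "\<And>p q. P p \<Longrightarrow> P q \<Longrightarrow> P (p * q)"
  shows "P p"
proof (induction p rule: poly_mapping_single_induct)
  case 1
  show ?case using c[of 0] by (simp add: sym_const_def)
next
  case (2 m c)
  have P1: "P 1" using c[of 1] by (simp add: sym_const_def)
  have pw: "P (x ^ n)" if "P x" for x n by (induction n) (use P1 m that in auto)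
  have "P (\<Prod>v\<in>A. sym_var v ^ Poly_Mapping.lookup m v)" for A :: "'x set"
    by (induction A rule: infinite_finite_induct) (use P1 m pw v in auto)
  then have "P (monomial_value (\<lambda>v. sym_var v) m)" unfolding monomial_value_def .
  moreover have "monomial_value (\<lambda>v. sym_var v) m = (Poly_Mapping.single m 1 :: ('x \<Rightarrow>\<^sub>0 nat) \<Rightarrow>\<^sub>0 'k)"
    unfolding monomial_value_var by (simp add: poly_mapping_expansion)
  ultimately have "P (Poly_Mapping.single m 1)" by metis
  from \<open>\<And>p q. P p \<Longrightarrow> P q \<Longrightarrow> P (p * q)\<close>[OF c[of c] this] show ?case by (simp add: sym_const_def mult_single)
qed (rule a)

definition algebra_hom :: "((('x \<Rightarrow>\<^sub>0 nat) \<Rightarrow>\<^sub>0 'k::field) \<Rightarrow> 'a::comm_ring_1) \<Rightarrow> bool" where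
  "algebra_hom h \<longleftrightarrow> (\<forall>p q. h (p + q) = h p + h q) \<and> (\<forall>p q. h (p * q) = h p * h q)"

lemma algebra_hom_eval: "coefficient_hom \<kappa> \<Longrightarrow> algebra_hom (poly_eval \<kappa> f)"
  by (simp add: algebra_hom_def poly_eval_add poly_eval_mult)

lemma algebra_hom_comp: "algebra_hom h \<Longrightarrow> algebra_hom h' \<Longrightarrow> algebra_hom (\<lambda>p. h (h' p))"
  by (simp add: algebra_hom_def)

lemma algebra_hom_id: "algebra_hom (\<lambda>p. p)"
  by (simp add: algebra_hom_def)

lemma algebra_hom_eqI:
  assumes "algebra_hom h" "algebra_hom h'" "\<And>c. h (sym_const c) = h' (sym_const c)" "\<And>v. h (sym_var v) = h' (sym_var v)"
  shows "h p = h' p"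
  by (induction p rule: polynomial_induct) (use assms in \<open>auto simp: algebra_hom_def\<close>)

section \<open>Polynomials in the coordinates of a vector space\<close>

text \<open>The dimension \<open>d\<close> is a value and not a type, so the ring has countably many
  variables; \<open>Sym(V)\<close> becomes the subring \<open>PS\<close> of polynomials in the
  variables below \<open>d\<close>.\<close>

type_synonym 'k mpoly = "(nat \<Rightarrow>\<^sub>0 nat) \<Rightarrow>\<^sub>0 'k"

locale linear_coordinates = vector_space sV
  for sV :: "'k::field \<Rightarrow> 'v::ab_group_add \<Rightarrow> 'v" +
  fixes d :: nat and b :: "nat \<Rightarrow> 'v" and cd :: "'v \<Rightarrow> nat \<Rightarrow> 'k"
  assumes cd_add: "cd (v + w) j = cd v j + cd w j" and cd_scale: "cd (sV c v) j = c * cd v j"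
    and cd_expansion: "(\<Sum>j<d. sV (cd v j) (b j)) = v"
    and cd_b: "i < d \<Longrightarrow> j < d \<Longrightarrow> cd (b i) j = (if i = j then 1 else 0)"
begin

lemma cd_0: "cd 0 j = 0" using cd_scale[of 0 0 j] by simp
lemma cd_sum: "cd (sum f A) j = (\<Sum>a\<in>A. cd (f a) j)"
  by (induction A rule: infinite_finite_induct) (simp_all add: cd_0 cd_add)
lemma cd_eqI: "(\<And>j. j < d \<Longrightarrow> cd v j = cd w j) \<Longrightarrow> v = w"
  using cd_expansion[of v] cd_expansion[of w] by (metis (no_types, lifting) lessThan_iff sum.cong)

definition io :: "'v \<Rightarrow> 'k mpoly" where
  "io v = (\<Sum>j<d. sym_const (cd v j) * sym_var j)"

lemma const_hom: "sym_const (x + y) = sym_const x + (sym_const y :: 'k mpoly)"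
  "sym_const (x * y) = sym_const x * (sym_const y :: 'k mpoly)" "sym_const 1 = (1 :: 'k mpoly)" "sym_const 0 = (0 :: 'k mpoly)"
  by (simp_all add: sym_const_def single_add mult_single)

lemma io_add: "io (v + w) = io v + io w"
  by (simp add: io_def cd_add const_hom distrib_right sum.distrib)
lemma io_scale: "io (sV c v) = sym_const c * io v"
  by (simp add: io_def cd_scale const_hom sum_distrib_left mult.assoc)
lemma io_0: "io 0 = 0" by (simp add: io_def cd_0 const_hom)
lemma io_sum: "io (sum f A) = (\<Sum>a\<in>A. io (f a))"
  by (induction A rule: infinite_finite_induct) (simp_all add: io_0 io_add)
lemma io_diff: "io (v - w) = io v - io w"
  using io_add[of "v - w" w] by simp

lemma io_b: assumes "j < d" shows "io (b j) = sym_var j"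
proof -
  have "io (b j) = (\<Sum>i<d. if i = j then sym_var j else 0)"
    unfolding io_def by (intro sum.cong refl) (use assms in \<open>auto simp: cd_b const_hom\<close>)
  then show ?thesis using assms by simp
qed

lemma lookup_io: assumes "j < d" shows "Poly_Mapping.lookup (io v) (Poly_Mapping.single j 1) = cd v j"
proof -
  have inj: "Poly_Mapping.single i (1::nat) = Poly_Mapping.single j 1 \<longleftrightarrow> i = j" for i
    by (metis lookup_single_eq lookup_single_not_eq zero_neq_one)
  have "Poly_Mapping.lookup (sym_const (cd v i) * sym_var i :: 'k mpoly) (Poly_Mapping.single j 1) = (if i = j then cd v j else 0)" for i
    by (simp add: sym_const_def sym_var_def mult_single lookup_single when_def inj del: One_nat_def)
  then show ?thesis unfolding io_def lookup_sum using assms by simp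
qed

lemma io_inject: "io v = io w \<Longrightarrow> v = w"
  using lookup_io by (metis cd_eqI)

text \<open>The map that presents \<open>Sym(V)\<close> as \<open>PS\<close>: its kernel will be
  \<open>sym_ideal sV\<close>, and \<open>eta\<close> is a section of it over
  \<open>PS\<close>.\<close>

definition theta :: "(('v \<Rightarrow>\<^sub>0 nat) \<Rightarrow>\<^sub>0 'k) \<Rightarrow> 'k mpoly" where "theta = poly_eval sym_const io"

definition eta :: "'k mpoly \<Rightarrow> ('v \<Rightarrow>\<^sub>0 nat) \<Rightarrow>\<^sub>0 'k" where
  "eta = poly_eval sym_const (\<lambda>j. if j < d then sym_var (b j) else 0)"

text \<open>Variables from \<open>d\<close> on are fixed, so that \<open>id\<close> acts as the
  identity on the whole type and not only on \<open>PS\<close>.\<close>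

definition actP :: "('v \<Rightarrow> 'v) \<Rightarrow> 'k mpoly \<Rightarrow> 'k mpoly" where
  "actP g = poly_eval sym_const (\<lambda>j. if j < d then io (g (b j)) else sym_var j)"

definition aug :: "'k mpoly \<Rightarrow> 'k" where "aug = poly_eval (\<lambda>c. c) (\<lambda>_. 0)"

definition PS :: "'k mpoly set" where
  "PS = {p. \<forall>m\<in>Poly_Mapping.keys p. Poly_Mapping.keys m \<subseteq> {..<d}}"

lemma hom_id: "coefficient_hom (\<lambda>c::'k. c)" by (simp add: coefficient_hom_def)
lemmas C = coefficient_hom_const hom_id

lemma algebra_homs: "algebra_hom theta" "algebra_hom eta" "algebra_hom (actP g)" "algebra_hom aug"
  unfolding theta_def eta_def actP_def aug_def by (intro algebra_hom_eval C)+

lemma theta_const: "theta (sym_const c) = sym_const c" and theta_var: "theta (sym_var v) = io v"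
  unfolding theta_def by (simp_all add: poly_eval_const poly_eval_var C)
lemma eta_const: "eta (sym_const c) = sym_const c" and eta_var: "eta (sym_var j) = (if j < d then sym_var (b j) else 0)"
  unfolding eta_def by (simp_all add: poly_eval_const poly_eval_var C)
lemma actP_const: "actP g (sym_const c) = sym_const c"
  and actP_var: "actP g (sym_var j) = (if j < d then io (g (b j)) else sym_var j)"
  unfolding actP_def by (simp_all add: poly_eval_const poly_eval_var C)
lemma aug_const: "aug (sym_const c) = c" and aug_var: "aug (sym_var j) = 0"
  unfolding aug_def by (simp_all add: poly_eval_const poly_eval_var C)

lemma hom_add: "algebra_hom h \<Longrightarrow> h (p + q) = h p + h q" and hom_mult: "algebra_hom h \<Longrightarrow> h (p * q) = h p * h q"
  by (simp_all add: algebra_hom_def)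
lemma hom_0: "algebra_hom h \<Longrightarrow> h 0 = 0"
  using hom_add[of h 0 0] by (metis add.right_neutral add_cancel_left_left)
lemma hom_uminus: "algebra_hom h \<Longrightarrow> h (- p) = - h p"
  using hom_add[of h p "- p"] hom_0[of h] by (simp add: minus_unique)
lemma hom_diff: "algebra_hom h \<Longrightarrow> h (p - q) = h p - h q"
  using hom_add[of h p "- q"] hom_uminus[of h q] by simp
lemma hom_sum: "algebra_hom h \<Longrightarrow> h (sum f A) = (\<Sum>a\<in>A. h (f a))"
  by (induction A rule: infinite_finite_induct) (simp_all add: hom_0 hom_add)

lemma io_linear_combination: "Vector_Spaces.linear sV sV g \<Longrightarrow> io (g v) = (\<Sum>j<d. sym_const (cd v j) * io (g (b j)))"
proof -
  assume "Vector_Spaces.linear sV sV g"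
  then interpret g: Vector_Spaces.linear sV sV g .
  have "g v = (\<Sum>j<d. sV (cd v j) (g (b j)))"
    using arg_cong[OF cd_expansion[of v], of g] by (simp add: g.sum g.scale)
  then show ?thesis by (simp add: io_sum io_scale)
qed

lemma actP_io: assumes "Vector_Spaces.linear sV sV g" shows "actP g (io v) = io (g v)"
  unfolding io_linear_combination[OF assms, of v]
  by (simp add: io_def[of v] hom_sum hom_mult algebra_homs actP_const actP_var)

lemma actP_id: "actP id p = p"
  by (rule algebra_hom_eqI[OF algebra_homs(3) algebra_hom_id]) (simp_all add: actP_const actP_var io_b)

lemma actP_comp:
  assumes "Vector_Spaces.linear sV sV g" shows "actP (g \<circ> h) p = actP g (actP h p)"
  by (rule algebra_hom_eqI[OF algebra_homs(3) algebra_hom_comp[OF algebra_homs(3) algebra_homs(3)]])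
     (simp_all add: actP_const actP_var actP_io[OF assms])

lemma aug_io: "aug (io v) = 0"
  by (simp add: io_def hom_sum hom_mult algebra_homs aug_var)

lemma aug_actP: "aug (actP g p) = aug p"
  by (rule algebra_hom_eqI[OF algebra_hom_comp[OF algebra_homs(4) algebra_homs(3)] algebra_homs(4)])
     (simp_all add: actP_const actP_var aug_const aug_var aug_io)

lemma theta_rename:
  assumes "Vector_Spaces.linear sV sV g" shows "theta (sym_rename g p) = actP g (theta p)"
  unfolding sym_rename_eval
  by (rule algebra_hom_eqI[OF algebra_hom_comp[OF algebra_homs(1) algebra_hom_eval[OF C(1)]] algebra_hom_comp[OF algebra_homs(3) algebra_homs(1)]])
     (simp_all add: poly_eval_const poly_eval_var C theta_const theta_var actP_const actP_io[OF assms])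

lemma PS_const: "sym_const c \<in> PS"
  by (auto simp: PS_def sym_const_def)
lemma PS_var: "j < d \<Longrightarrow> sym_var j \<in> PS"
  by (auto simp: PS_def sym_var_def)
lemma PS_0: "0 \<in> PS" by (simp add: PS_def)
lemma PS_1: "1 \<in> PS" using PS_const[of 1] by (simp add: const_hom)
lemma PS_add: "p \<in> PS \<Longrightarrow> q \<in> PS \<Longrightarrow> p + q \<in> PS"
  using Poly_Mapping.keys_add[of p q] by (auto simp: PS_def)
lemma PS_uminus: "p \<in> PS \<Longrightarrow> - p \<in> PS"
  by (simp add: PS_def in_keys_iff)
lemma PS_mult: assumes "p \<in> PS" "q \<in> PS" shows "p * q \<in> PS"
  unfolding PS_def
proof (intro CollectI ballI)
  fix m assume "m \<in> Poly_Mapping.keys (p * q)"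
  then obtain u w where m: "m = u + w" "u \<in> Poly_Mapping.keys p" "w \<in> Poly_Mapping.keys q"
    using Poly_Mapping.keys_mult[of p q] by blast
  then show "Poly_Mapping.keys m \<subseteq> {..<d}"
    using assms Poly_Mapping.keys_add[of u w] by (fastforce simp: PS_def)
qed
lemma PS_sum: "(\<And>a. a \<in> A \<Longrightarrow> f a \<in> PS) \<Longrightarrow> sum f A \<in> PS"
  by (induction A rule: infinite_finite_induct) (simp_all add: PS_0 PS_add)
lemma PS_single: "Poly_Mapping.keys m \<subseteq> {..<d} \<Longrightarrow> Poly_Mapping.single m c \<in> PS"
  by (auto simp: PS_def)

lemma PS_io: "io v \<in> PS"
  unfolding io_def by (intro PS_sum PS_mult PS_const PS_var) simp

lemma PS_theta: "theta p \<in> PS"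
  by (induction p rule: polynomial_induct)
     (simp_all add: theta_const theta_var PS_const PS_io hom_add hom_mult algebra_homs PS_add PS_mult)

lemma theta_eta: assumes "p \<in> PS" shows "theta (eta p) = p"
proof -
  have h: "theta (eta p) = poly_eval sym_const (\<lambda>j. if j < d then sym_var j else 0) p" for p
    by (rule algebra_hom_eqI[OF algebra_hom_comp[OF algebra_homs(1,2)] algebra_hom_eval[OF C(1)]])
       (simp_all add: eta_const eta_var theta_const theta_var poly_eval_const poly_eval_var C io_b hom_0 algebra_homs)
  have "theta (eta p) = (\<Sum>m\<in>Poly_Mapping.keys p. theta (eta (Poly_Mapping.single m (Poly_Mapping.lookup p m))))"
    using arg_cong[OF poly_mapping_expansion[of p], of "\<lambda>p. theta (eta p)"] by (simp add: hom_sum algebra_homs)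
  also have "\<dots> = (\<Sum>m\<in>Poly_Mapping.keys p. Poly_Mapping.single m (Poly_Mapping.lookup p m))"
  proof (rule sum.cong[OF refl])
    fix m assume "m \<in> Poly_Mapping.keys p"
    then have "Poly_Mapping.keys m \<subseteq> {..<d}" using assms by (auto simp: PS_def)
    then have "monomial_value (\<lambda>j. if j < d then sym_var j else 0) m = (monomial_value (\<lambda>j. sym_var j) m :: 'k mpoly)"
      unfolding monomial_value_def by (intro prod.cong) auto
    then show "theta (eta (Poly_Mapping.single m (Poly_Mapping.lookup p m))) = Poly_Mapping.single m (Poly_Mapping.lookup p m)"
      unfolding h poly_eval_single[OF C(1)] monomial_value_var
      by (simp add: poly_mapping_expansion monomial_value_var sym_const_def mult_single)
  qed
  finally show ?thesis by (simp only: poly_mapping_expansion)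
qed

lemma PS_actP: assumes "Vector_Spaces.linear sV sV g" "p \<in> PS" shows "actP g p \<in> PS"
  using PS_theta[of "sym_rename g (eta p)"] by (simp add: theta_rename assms theta_eta)

text \<open>Substituting for one variable eliminates the linear form \<open>io u\<close> and detects divisibility by it.\<close>

lemma linear_form_cancel:
  assumes u: "u \<noteq> 0" and w: "\<And>c. w \<noteq> sV c u" and dv: "io u dvd c * io w"
  shows "io u dvd c"
proof -
  obtain i where i: "i < d" "cd u i \<noteq> 0" using u cd_eqI[of u 0] cd_0 by auto
  \<comment> \<open>Solves \<open>io u = 0\<close> for the variable \<open>i\<close>, in which
    \<open>u\<close> has a nonzero coordinate. On linear forms this subtracts the multiple of
    \<open>u\<close> that clears the \<open>i\<close>-th coordinate.\<close>
  define h where "h = poly_eval sym_const (\<lambda>j. if j = i then sym_var i - sym_const (inverse (cd u i)) * io u else sym_var j :: 'k mpoly)"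
  have h: "algebra_hom h" "\<And>c. h (sym_const c) = sym_const c"
    "\<And>j. h (sym_var j) = (if j = i then sym_var i - sym_const (inverse (cd u i)) * io u else sym_var j)"
    unfolding h_def by (simp_all add: algebra_hom_eval poly_eval_const poly_eval_var C)
  have h_io: "h (io v) = io (v - sV (cd v i * inverse (cd u i)) u)" for v
  proof -
    have "h (io v) = (\<Sum>j<d. sym_const (cd v j) * sym_var j - (if j = i then sym_const (cd v i * inverse (cd u i)) * io u else 0))"
      unfolding io_def[of v] hom_sum[OF h(1)] hom_mult[OF h(1)] h(2,3)
      by (intro sum.cong refl) (simp add: const_hom right_diff_distrib mult.assoc)
    also have "\<dots> = io v - sym_const (cd v i * inverse (cd u i)) * io u"
      unfolding sum_subtractf io_def[of v] using i by simp
    finally show ?thesis by (simp add: io_diff io_scale)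
  qed
  \<comment> \<open>\<open>h\<close> is the identity modulo \<open>io u\<close>, so it remains to
    see that \<open>h c\<close> vanishes.\<close>
  have "io u dvd p - h p" for p
  proof (induction p rule: polynomial_induct)
    case (const c) show ?case by (simp add: h)
  next
    case (var v) show ?case by (simp add: h)
  next
    case (add p q)
    have "p + q - h (p + q) = (p - h p) + (q - h q)" by (simp add: hom_add h)
    then show ?case using add dvd_add by metis
  next
    case (mult p q)
    have "p * q - h (p * q) = (p - h p) * q + h p * (q - h q)" by (simp add: hom_mult h algebra_simps)
    then show ?case using mult by (metis dvd_add dvd_mult dvd_mult2)
  qed
  moreover have "h c = 0"
  proof -
    obtain z where "c * io w = io u * z" using dv by (auto elim: dvdE)
    then have "h c * h (io w) = h (io u) * h z" by (metis h(1) hom_mult)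
    moreover have "h (io u) = 0" unfolding h_io using i by (simp add: io_0)
    moreover have "h (io w) \<noteq> 0"
    proof
      assume "h (io w) = 0"
      then have "io (w - sV (cd w i * inverse (cd u i)) u) = io 0" by (simp add: h_io io_0)
      then have "w = sV (cd w i * inverse (cd u i)) u" by (metis eq_iff_diff_eq_0 io_inject)
      then show False using w by blast
    qed
    ultimately show ?thesis by simp
  qed
  ultimately show ?thesis using diff_zero by metis
qed

end

section \<open>Vectors moved by a linear group\<close>

context linear_coordinates begin

lemma cd_linear: "Vector_Spaces.linear sV sV g \<Longrightarrow> g v = (\<Sum>j<d. sV (cd v j) (g (b j)))"
proof -
  assume "Vector_Spaces.linear sV sV g"
  then interpret g: Vector_Spaces.linear sV sV g .
  show ?thesis using arg_cong[OF cd_expansion[of v], of g] by (simp add: g.sum g.scale)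
qed

lemma linear_eq_id: assumes "Vector_Spaces.linear sV sV g" "\<And>j. j < d \<Longrightarrow> g (b j) = b j" shows "g = id"
proof
  fix v
  have "g v = (\<Sum>j<d. sV (cd v j) (b j))" unfolding cd_linear[OF assms(1), of v] using assms(2) by simp
  then show "g v = id v" by (simp add: cd_expansion)
qed

text \<open>Vectors on the moment curve with coordinates \<open>t ^ j\<close>: for
  \<open>g \<noteq> id\<close> some coordinate of \<open>g v - v\<close> is a nonzero polynomial in
  \<open>t\<close>, and an infinite field has an element avoiding the finitely many roots.\<close>

lemma generic_vector:
  assumes G: "finite G" "\<And>g. g \<in> G \<Longrightarrow> Vector_Spaces.linear sV sV g" and inf: "infinite (UNIV :: 'k set)"
  shows "\<exists>v. \<forall>g\<in>G. g \<noteq> id \<longrightarrow> g v \<noteq> v"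
proof -
  define f where "f g i = (\<Sum>j<d. monom (cd (g (b j) - b j) i) j)" for g i
  have "\<exists>i. f g i \<noteq> 0" if g: "g \<in> G" "g \<noteq> id" for g
  proof (rule ccontr)
    assume "\<not> (\<exists>i. f g i \<noteq> 0)"
    then have 0: "Polynomial.coeff (f g i) j = 0" for i j by simp
    have "Polynomial.coeff (f g i) j = cd (g (b j) - b j) i" if "j < d" for i j
      unfolding f_def coeff_sum using that by (simp add: coeff_monom)
    then have "cd (g (b j) - b j) i = 0" if "j < d" for i j using 0 that by metis
    then have "g (b j) - b j = 0" if "j < d" for j using that cd_eqI[of "g (b j) - b j" 0] by (simp add: cd_0)
    then show False using linear_eq_id[OF G(2)] g by (metis eq_iff_diff_eq_0)
  qed
  then obtain i where i: "\<And>g. g \<in> G \<Longrightarrow> g \<noteq> id \<Longrightarrow> f g (i g) \<noteq> 0" by metis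
  have "finite (\<Union>g\<in>G-{id}. {t. poly (f g (i g)) t = 0})"
    using G(1) i by (auto intro!: poly_roots_finite)
  then obtain t where t: "\<And>g. g \<in> G \<Longrightarrow> g \<noteq> id \<Longrightarrow> poly (f g (i g)) t \<noteq> 0"
    using ex_new_if_finite[OF inf] by blast
  define v where "v = (\<Sum>j<d. sV (t ^ j) (b j))"
  have "cd (g v - v) (i g) = poly (f g (i g)) t" if g: "g \<in> G" for g
  proof -
    interpret g: Vector_Spaces.linear sV sV g by (rule G(2)[OF g])
    have "g v - v = (\<Sum>j<d. sV (t ^ j) (g (b j) - b j))"
      by (simp add: v_def g.sum g.scale sum_subtractf scale_right_diff_distrib)
    then show ?thesis by (simp add: cd_sum cd_scale f_def poly_sum poly_monom mult.commute)
  qed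
  then have "g v \<noteq> v" if "g \<in> G" "g \<noteq> id" for g using t[OF that] that(1) cd_0 by fastforce
  then show ?thesis by blast
qed

text \<open>If all \<open>g y - y\<close> were multiples of one nonzero \<open>g x - x\<close>, the
  fixed space and \<open>x\<close> together would span \<open>V\<close>, so \<open>g\<close> would
  fix a hyperplane.\<close>

lemma no_reflection_vectors:
  assumes lin: "Vector_Spaces.linear sV sV g" and ord: "bij g" "m > 0" "(g ^^ m) = id"
    and g: "g \<noteq> id" "\<not> pseudo_reflection sV g"
  shows "\<exists>x y. g x - x \<noteq> 0 \<and> (\<forall>c. g y - y \<noteq> sV c (g x - x))"
proof (rule ccontr)
  assume "\<not> ?thesis"
  then have n: "\<And>x y. g x - x \<noteq> 0 \<Longrightarrow> \<exists>c. g y - y = sV c (g x - x)" by blast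
  interpret g: Vector_Spaces.linear sV sV g by (rule lin)
  obtain x where x: "g x \<noteq> x" using g(1) by (metis ext id_apply)
  define H where "H = {y. g y = y}"
  have H: "subspace H" by (auto simp: H_def subspace_def g.add g.scale)
  obtain B where B: "B \<subseteq> H" "independent B" "H \<subseteq> span B" "card B = dim H" using basis_exists by blast
  have spB: "span B = H" using span_subspace[OF B(1,3) H] .
  have xB: "x \<notin> span B" using x by (simp add: spB H_def)
  have "independent (insert x B)" by (rule independent_insertI[OF xB B(2)])
  moreover have "UNIV \<subseteq> span (insert x B)"
  proof
    fix y
    have "g x - x \<noteq> 0" using x by simp
    from n[OF this, of y] obtain c where "g y - y = sV c (g x - x)" by (elim exE) (rule that)
    then have "g (y - sV c x) = y - sV c x"
      by (simp add: g.diff g.scale scale_right_diff_distrib algebra_simps)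
    then have "y - sV c x \<in> span B" by (simp add: spB H_def)
    then show "y \<in> span (insert x B)" unfolding span_insert by blast
  qed
  ultimately have "dim UNIV = card (insert x B)" using basis_card_eq_dim[of "insert x B" UNIV] by simp
  moreover have "finite B"
  proof -
    have "UNIV \<subseteq> span (b ` {..<d})"
    proof
      fix v :: 'v
      have "(\<Sum>j<d. sV (cd v j) (b j)) \<in> span (b ` {..<d})"
        by (intro span_sum span_scale span_base) auto
      then show "v \<in> span (b ` {..<d})" by (simp only: cd_expansion)
    qed
    then show ?thesis using independent_span_bound[of "b ` {..<d}" B] B(2) by auto
  qed
  moreover have "x \<notin> B" using xB span_base[of x B] by blast
  ultimately have "dim H + 1 = dim UNIV" using B(4) by simp
  then have "pseudo_reflection sV g"
    unfolding pseudo_reflection_def GL_def using lin ord g(1) H by (auto simp: H_def)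
  then show False using g(2) by simp
qed

end

section \<open>The Frobenius map on polynomials\<close>

text \<open>\<open>rt\<close> is the inverse of the Frobenius map \<open>a \<mapsto> a ^ q\<close>
  on \<open>k\<close>; its additivity makes the coordinates \<open>rc\<close> additive.\<close>

locale frobenius_coordinates = linear_coordinates sV d b cd
  for sV :: "'k::field \<Rightarrow> 'v::ab_group_add \<Rightarrow> 'v" and d b cd +
  fixes q :: nat and rt :: "'k \<Rightarrow> 'k"
  assumes q_pos: "q > 0" and q_add: "(x + y :: 'k mpoly) ^ q = x ^ q + y ^ q"
    and rt_add: "rt (a + a') = rt a + rt a'" and rt_mult: "rt (a * a') = rt a * rt a'" and rt_power: "rt (a ^ q) = a"
    and power_rt: "rt a ^ q = a"
begin

lemma rt_0: "rt 0 = 0" using rt_power[of 0] q_pos by (simp add: zero_power)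

definition qm :: "(nat \<Rightarrow>\<^sub>0 nat) \<Rightarrow> (nat \<Rightarrow>\<^sub>0 nat)" where "qm m = Poly_Mapping.map ((*) q) m"
definition nmod :: "(nat \<Rightarrow>\<^sub>0 nat) \<Rightarrow> (nat \<Rightarrow>\<^sub>0 nat)" where "nmod m = Poly_Mapping.map (\<lambda>x. x mod q) m"
definition ndiv :: "(nat \<Rightarrow>\<^sub>0 nat) \<Rightarrow> (nat \<Rightarrow>\<^sub>0 nat)" where "ndiv m = Poly_Mapping.map (\<lambda>x. x div q) m"

lemma lookup_qm: "Poly_Mapping.lookup (qm m) j = q * Poly_Mapping.lookup m j"
  and lookup_nmod: "Poly_Mapping.lookup (nmod m) j = Poly_Mapping.lookup m j mod q"
  and lookup_ndiv: "Poly_Mapping.lookup (ndiv m) j = Poly_Mapping.lookup m j div q"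
  by (simp_all add: qm_def nmod_def ndiv_def Poly_Mapping.map.rep_eq when_def)

lemma nmod_qm: "nmod (qm m + n) = nmod n"
  by (rule poly_mapping_eqI) (simp add: lookup_nmod lookup_qm lookup_add)
lemma ndiv_qm: "ndiv (qm m + n) = m + ndiv n"
  by (rule poly_mapping_eqI) (use q_pos in \<open>simp add: lookup_ndiv lookup_qm lookup_add\<close>)
lemma qm_ndiv_nmod: "qm (ndiv n) + nmod n = n"
  by (rule poly_mapping_eqI) (simp add: lookup_nmod lookup_ndiv lookup_qm lookup_add)
lemma sum_const_qm: "(\<Sum>_<q. m) = qm m"
proof (rule poly_mapping_eqI)
  fix j
  have "Poly_Mapping.lookup (\<Sum>_<n. m) j = n * Poly_Mapping.lookup m j" for n
    by (induction n) (simp_all add: lookup_add del: sum_constant)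
  then show "Poly_Mapping.lookup (\<Sum>_<q. m) j = Poly_Mapping.lookup (qm m) j" by (simp add: lookup_qm)
qed

definition Box :: "(nat \<Rightarrow>\<^sub>0 nat) set" where
  "Box = {a. Poly_Mapping.keys a \<subseteq> {..<d} \<and> (\<forall>j. Poly_Mapping.lookup a j < q)}"

text \<open>The terms with exponents congruent to \<open>a\<close> modulo \<open>q\<close>, divided
  by the monomial \<open>a\<close>, form a \<open>q\<close>-th power; this is its root.\<close>

definition rc :: "(nat \<Rightarrow>\<^sub>0 nat) \<Rightarrow> 'k mpoly \<Rightarrow> 'k mpoly" where
  "rc a = additive_extension (\<lambda>n c. if nmod n = a then Poly_Mapping.single (ndiv n) (rt c) else 0)"

lemma rc_F: "(if nmod n = a then Poly_Mapping.single (ndiv n) (rt 0) else 0) = 0"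
  "(if nmod n = a then Poly_Mapping.single (ndiv n) (rt (c + e)) else 0) =
   (if nmod n = a then Poly_Mapping.single (ndiv n) (rt c) else 0) + (if nmod n = a then Poly_Mapping.single (ndiv n) (rt e) else 0)"
  by (simp_all add: rt_0 rt_add single_add)

lemma rc_add: "rc a (p + p') = rc a p + rc a p'"
  unfolding rc_def by (rule additive_extension_add) (rule rc_F)+
lemma rc_0: "rc a 0 = 0"
  unfolding rc_def by (rule additive_extension_0) (rule rc_F)+
lemma rc_single: "rc a (Poly_Mapping.single n c) = (if nmod n = a then Poly_Mapping.single (ndiv n) (rt c) else 0)"
  unfolding rc_def by (rule additive_extension_single) (rule rc_F)+

lemma rc_smult: "rc a (s ^ q * t) = s * rc a t"
proof (induction s rule: poly_mapping_single_induct)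
  case 1
  show ?case using q_pos by (simp add: zero_power rc_0)
next
  case (2 m c)
  show ?case
  proof (induction t rule: poly_mapping_single_induct)
    case (2 n e)
    show ?case
      by (simp add: single_power sum_const_qm mult_single rc_single nmod_qm ndiv_qm rt_mult rt_power del: sum_constant)
  qed (simp_all add: rc_0 rc_add distrib_left)
next
  case (3 s s')
  then show ?case by (simp add: q_add distrib_right rc_add)
qed

lemma keys_ndiv: "Poly_Mapping.keys (ndiv m) \<subseteq> Poly_Mapping.keys m"
  by (rule subsetI, rule ccontr) (simp add: in_keys_iff lookup_ndiv)
lemma keys_nmod: "Poly_Mapping.keys (nmod m) \<subseteq> Poly_Mapping.keys m"
  by (rule subsetI, rule ccontr) (simp add: in_keys_iff lookup_nmod)
lemma qm_0: "qm 0 = 0"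
  by (rule poly_mapping_eqI) (simp add: lookup_qm)

lemma rc_PS: assumes "p \<in> PS" shows "rc a p \<in> PS"
  unfolding rc_def additive_extension_def
  using assms keys_ndiv by (intro PS_sum) (fastforce simp: PS_def split: if_splits)

text \<open>The bound may vary with the coordinate because, besides the full box, the boxes with
  sides \<open>q - \<delta> j\<close> are counted.\<close>

lemma finite_bounded: "finite {a :: nat \<Rightarrow>\<^sub>0 nat. Poly_Mapping.keys a \<subseteq> {..<d} \<and> (\<forall>j<d. Poly_Mapping.lookup a j < f j)}"
  and card_bounded: "card {a :: nat \<Rightarrow>\<^sub>0 nat. Poly_Mapping.keys a \<subseteq> {..<d} \<and> (\<forall>j<d. Poly_Mapping.lookup a j < f j)} = (\<Prod>j<d. f j)"
proof -
  let ?A = "{a :: nat \<Rightarrow>\<^sub>0 nat. Poly_Mapping.keys a \<subseteq> {..<d} \<and> (\<forall>j<d. Poly_Mapping.lookup a j < f j)}"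
  have "bij_betw (\<lambda>a. restrict (Poly_Mapping.lookup a) {..<d}) ?A (\<Pi>\<^sub>E j\<in>{..<d}. {..<f j})"
  proof (rule bij_betw_byWitness[of _ "\<lambda>h. \<Sum>j<d. Poly_Mapping.single j (h j)"])
    have lk: "Poly_Mapping.lookup (\<Sum>j<d. Poly_Mapping.single j (h j)) i = (if i < d then h i else 0)" for h :: "nat \<Rightarrow> nat" and i
      unfolding lookup_sum by (simp add: lookup_single when_def)
    show "\<forall>a\<in>?A. (\<Sum>j<d. Poly_Mapping.single j (restrict (Poly_Mapping.lookup a) {..<d} j)) = a"
    proof (intro ballI poly_mapping_eqI)
      fix a i assume a: "a \<in> ?A"
      show "Poly_Mapping.lookup (\<Sum>j<d. Poly_Mapping.single j (restrict (Poly_Mapping.lookup a) {..<d} j)) i = Poly_Mapping.lookup a i"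
        unfolding lk using a by (auto simp: in_keys_iff)
    qed
    show "\<forall>h\<in>\<Pi>\<^sub>E j\<in>{..<d}. {..<f j}. restrict (Poly_Mapping.lookup (\<Sum>j<d. Poly_Mapping.single j (h j))) {..<d} = h"
      by (intro ballI ext) (auto simp: lk PiE_def extensional_def)
    show "(\<lambda>a. restrict (Poly_Mapping.lookup a) {..<d}) ` ?A \<subseteq> (\<Pi>\<^sub>E j\<in>{..<d}. {..<f j})" by (auto split: if_splits)
    show "(\<lambda>h. \<Sum>j<d. Poly_Mapping.single j (h j)) ` (\<Pi>\<^sub>E j\<in>{..<d}. {..<f j}) \<subseteq> ?A"
    proof (rule image_subsetI, rule CollectI, intro conjI subsetI allI impI)
      fix h :: "nat \<Rightarrow> nat" and i assume "i \<in> Poly_Mapping.keys (\<Sum>j<d. Poly_Mapping.single j (h j))"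
      then show "i \<in> {..<d}" by (simp add: in_keys_iff lk split: if_splits)
    next
      fix h i assume h: "h \<in> (\<Pi>\<^sub>E j\<in>{..<d}. {..<f j})" and i: "i < d"
      show "Poly_Mapping.lookup (\<Sum>j<d. Poly_Mapping.single j (h j)) i < f i"
        using PiE_mem[OF h, of i] i by (simp add: lk)
    qed
  qed
  note bij = this
  have fin: "finite (\<Pi>\<^sub>E j\<in>{..<d}. {..<f j})" by (rule finite_PiE) simp_all
  show "finite ?A" using bij_betw_finite[OF bij] fin by simp
  have "card (\<Pi>\<^sub>E j\<in>{..<d}. {..<f j}) = (\<Prod>j<d. f j)" by (subst card_PiE) simp_all
  then show "card ?A = (\<Prod>j<d. f j)" using bij_betw_same_card[OF bij] by simp
qed

lemma Box_bounded: "Box = {a. Poly_Mapping.keys a \<subseteq> {..<d} \<and> (\<forall>j<d. Poly_Mapping.lookup a j < q)}"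
proof -
  have "Poly_Mapping.lookup a j = 0" if "Poly_Mapping.keys a \<subseteq> {..<d}" "\<not> j < d" for a :: "nat \<Rightarrow>\<^sub>0 nat" and j
    using that by (auto simp: in_keys_iff)
  then show ?thesis unfolding Box_def using q_pos by (metis (no_types, lifting))
qed

lemma finite_Box: "finite Box" and card_Box: "card Box = q ^ d"
  unfolding Box_bounded using finite_bounded[of "\<lambda>_. q"] card_bounded[of "\<lambda>_. q"] by simp_all

lemma nmod_Box: "Poly_Mapping.keys n \<subseteq> {..<d} \<Longrightarrow> nmod n \<in> Box"
  using q_pos keys_nmod[of n] by (auto simp: Box_def lookup_nmod)

lemma rc_expansion: assumes "p \<in> PS" shows "(\<Sum>a\<in>Box. rc a p ^ q * Poly_Mapping.single a 1) = p"
proof -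
  have single: "(\<Sum>a\<in>Box. rc a (Poly_Mapping.single n c) ^ q * Poly_Mapping.single a 1) = Poly_Mapping.single n c"
    if n: "Poly_Mapping.keys n \<subseteq> {..<d}" for n c
  proof -
    have "(\<Sum>a\<in>Box. rc a (Poly_Mapping.single n c) ^ q * Poly_Mapping.single a 1)
        = (\<Sum>a\<in>Box. if a = nmod n then Poly_Mapping.single n c else 0)"
      by (intro sum.cong refl)
         (use q_pos in \<open>auto simp: rc_single single_power sum_const_qm power_rt mult_single qm_ndiv_nmod zero_power simp del: sum_constant\<close>)
    then show ?thesis using nmod_Box[OF n] finite_Box by simp
  qed
  have "(\<Sum>a\<in>Box. rc a (\<Sum>n\<in>A. Poly_Mapping.single n (f n)) ^ q * Poly_Mapping.single a 1) = (\<Sum>n\<in>A. Poly_Mapping.single n (f n))"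
    if "\<And>n. n \<in> A \<Longrightarrow> Poly_Mapping.keys n \<subseteq> {..<d}" for A f
    using that
  proof (induction A rule: infinite_finite_induct)
    case (insert n A)
    then show ?case by (simp add: rc_add q_add distrib_right sum.distrib single)
  qed (use q_pos in \<open>simp_all add: rc_0 zero_power\<close>)
  from this[of "Poly_Mapping.keys p" "Poly_Mapping.lookup p"] show ?thesis
    using assms by (simp add: poly_mapping_expansion PS_def)
qed

lemma keys_nonempty: assumes "p \<noteq> (0 :: 'm \<Rightarrow>\<^sub>0 'z::comm_monoid_add)" shows "Poly_Mapping.keys p \<noteq> {}"
proof
  assume "Poly_Mapping.keys p = {}"
  then have "p = 0" using poly_mapping_expansion[of p] by simp
  then show False using assms by simp
qed

lemma aug_lookup: "aug p = Poly_Mapping.lookup p 0"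
proof (induction p rule: poly_mapping_single_induct)
  case (2 m c)
  have "monomial_value (\<lambda>_. 0::'k) m = 0" if m0: "m \<noteq> 0"
  proof -
    obtain v where "v \<in> Poly_Mapping.keys m" using keys_nonempty[OF m0] by blast
    then show ?thesis unfolding monomial_value_def
      by (intro prod_zero) (auto simp: in_keys_iff zero_power intro!: bexI[of _ v])
  qed
  then show ?case unfolding aug_def poly_eval_single[OF hom_id]
    by (cases "m = 0") (simp_all add: monomial_value_0 lookup_single when_def)
qed (simp_all add: hom_0 hom_add algebra_homs lookup_add)

text \<open>Only the monomial \<open>a\<close> itself contributes a constant term to
  \<open>rc a p\<close>. So the reduced coordinates are the \<open>q\<close>-th roots of the
  coefficients inside the box.\<close>

lemma aug_rc: assumes "a \<in> Box" shows "aug (rc a p) = rt (Poly_Mapping.lookup p a)"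
proof (induction p rule: poly_mapping_single_induct)
  case (2 n c)
  have "nmod n = a \<and> ndiv n = 0 \<longleftrightarrow> n = a"
  proof
    assume "nmod n = a \<and> ndiv n = 0"
    then show "n = a" using qm_ndiv_nmod[of n] by (simp add: qm_0)
  next
    assume "n = a"
    then show "nmod n = a \<and> ndiv n = 0" using assms
      by (auto intro!: poly_mapping_eqI simp: lookup_nmod lookup_ndiv Box_def)
  qed
  then show ?case by (auto simp: rc_single aug_lookup lookup_single when_def rt_0)
qed (simp_all add: rc_0 rc_add hom_0 hom_add algebra_homs lookup_add rt_0 rt_add)

text \<open>The smallest monomial of a multiple \<open>p * x\<^sup>b\<close> is the sum of the smallest monomial of \<open>p\<close> and
  \<open>b\<close>; hence those multiples for which it lies in the box are independent modulo \<open>q\<close>-th powers.\<close>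

lemma box_independent:
  assumes p: "p \<in> PS" "p \<noteq> 0"
  defines "\<delta> \<equiv> Min (Poly_Mapping.keys p)"
  defines "Y \<equiv> {c. Poly_Mapping.keys c \<subseteq> {..<d} \<and> (\<forall>j<d. Poly_Mapping.lookup c j < q - Poly_Mapping.lookup \<delta> j)}"
  assumes u: "\<And>a. a \<in> Box \<Longrightarrow> (\<Sum>c\<in>Y. u c * aug (rc a (p * Poly_Mapping.single c 1))) = 0" and c: "c \<in> Y"
  shows "u c = 0"
proof (rule ccontr)
  assume "u c \<noteq> 0"
  have finY: "finite Y" unfolding Y_def by (rule finite_bounded)
  let ?Z = "{c\<in>Y. u c \<noteq> 0}"
  have Z: "finite ?Z" "?Z \<noteq> {}" using finY c \<open>u c \<noteq> 0\<close> by auto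
  \<comment> \<open>Minimality makes \<open>\<delta> + c0\<close> an exponent to which no other term
    of the combination contributes.\<close>
  define c0 where "c0 = Min ?Z"
  have c0: "c0 \<in> ?Z" "\<And>c. c \<in> ?Z \<Longrightarrow> c0 \<le> c" using Min_in[OF Z] Min_le[OF Z(1)] by (auto simp: c0_def)
  have kp: "Poly_Mapping.keys p \<noteq> {}" by (rule keys_nonempty[OF p(2)])
  have \<delta>: "\<delta> \<in> Poly_Mapping.keys p" "\<And>m. m \<in> Poly_Mapping.keys p \<Longrightarrow> \<delta> \<le> m"
    using Min_in[OF finite_keys kp] Min_le[OF finite_keys] by (auto simp: \<delta>_def)
  have \<delta>d: "Poly_Mapping.keys \<delta> \<subseteq> {..<d}" using \<delta>(1) p(1) by (auto simp: PS_def)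
  have lk: "Poly_Mapping.lookup (p * Poly_Mapping.single c 1) (m + c) = Poly_Mapping.lookup p m" for c m
  proof (induction p rule: poly_mapping_single_induct)
    case (2 n e)
    show ?case by (simp add: mult_single lookup_single when_def)
  qed (simp_all add: distrib_right lookup_add)
  \<comment> \<open>The definition of \<open>Y\<close> leaves exactly the room for a shift by
    \<delta>; if \<delta> itself lies outside the box, truncated subtraction makes \<open>Y\<close>
    empty.\<close>
  have a: "\<delta> + c0 \<in> Box"
    unfolding Box_bounded using c0(1) \<delta>d Poly_Mapping.keys_add[of \<delta> c0] by (fastforce simp: Y_def lookup_add)
  have "u c * aug (rc (\<delta> + c0) (p * Poly_Mapping.single c 1)) = 0" if c: "c \<in> Y" "c \<noteq> c0" for c
  proof (cases "u c = 0")
    case False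
    then have "c0 < c" using c0(2)[of c] c by auto
    have "\<delta> + c0 \<notin> Poly_Mapping.keys (p * Poly_Mapping.single c 1)"
    proof
      assume "\<delta> + c0 \<in> Poly_Mapping.keys (p * Poly_Mapping.single c 1)"
      then obtain m where m: "m \<in> Poly_Mapping.keys p" "\<delta> + c0 = m + c"
        using Poly_Mapping.keys_mult[of p "Poly_Mapping.single c 1"] by (auto split: if_splits)
      have "\<delta> + c0 < m + c" using add_le_less_mono[OF \<delta>(2)[OF m(1)] \<open>c0 < c\<close>] .
      then show False using m(2) by simp
    qed
    then show ?thesis by (simp add: aug_rc[OF a] in_keys_iff rt_0)
  qed simp
  note others = this
  have "(\<Sum>c\<in>Y. u c * aug (rc (\<delta> + c0) (p * Poly_Mapping.single c 1))) = u c0 * aug (rc (\<delta> + c0) (p * Poly_Mapping.single c0 1))"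
  proof -
    have "(\<Sum>c\<in>Y-{c0}. u c * aug (rc (\<delta> + c0) (p * Poly_Mapping.single c 1))) = 0"
      by (rule sum.neutral, rule ballI, rule others) auto
    then show ?thesis using c0(1) finY by (subst sum.remove[of _ c0]) simp_all
  qed
  then have "u c0 * rt (Poly_Mapping.lookup p \<delta>) = 0" using u[OF a] by (simp add: aug_rc[OF a] lk)
  moreover have "rt (Poly_Mapping.lookup p \<delta>) \<noteq> 0"
    using \<delta>(1) power_rt[of "Poly_Mapping.lookup p \<delta>"] q_pos by (auto simp: in_keys_iff zero_power)
  ultimately show False using c0(1) by simp
qed

end

section \<open>Representations in coordinates\<close>

context vector_space begin

lemma finite_subspace_coordinates:
  assumes "finite B" "independent B" "span B = U"
  obtains e co where "\<And>j. j < dim U \<Longrightarrow> e j \<in> U" "\<And>u. u \<in> U \<Longrightarrow> (\<Sum>j<dim U. scale (co u j) (e j)) = u"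
    "\<And>u v j. u \<in> U \<Longrightarrow> v \<in> U \<Longrightarrow> co (u + v) j = co u j + co v j"
    "\<And>c u j. u \<in> U \<Longrightarrow> co (scale c u) j = c * co u j"
    "\<And>i j. i < dim U \<Longrightarrow> j < dim U \<Longrightarrow> co (e i) j = (if i = j then 1 else 0)"
proof -
  have dim: "dim U = card B" using dim_span_eq_card_independent[OF assms(2)] assms(3) by simp
  obtain h where h: "bij_betw h {0..<card B} B" using ex_bij_betw_nat_finite[OF assms(1)] by blast
  have h_lt: "{0..<card B} = {..<card B}" by auto
  have hB: "h j \<in> B" if "j < dim U" for j using h that by (auto simp: bij_betw_def dim)
  show thesis
  proof (rule that[of h "\<lambda>u j. representation B u (h j)"])
    show "h j \<in> U" if "j < dim U" for j using hB[OF that] span_base assms(3) by blast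
    show "(\<Sum>j<dim U. scale (representation B u (h j)) (h j)) = u" if "u \<in> U" for u
    proof -
      have "(\<Sum>j<dim U. scale (representation B u (h j)) (h j)) = (\<Sum>x\<in>B. scale (representation B u x) x)"
        unfolding dim h_lt[symmetric] by (rule sum.reindex_bij_betw[OF h])
      also have "\<dots> = u" using sum_representation_eq[OF assms(2) _ assms(1)] that assms(3) by blast
      finally show ?thesis .
    qed
    show "representation B (u + v) (h j) = representation B u (h j) + representation B v (h j)" if "u \<in> U" "v \<in> U" for u v j
      using representation_add[OF assms(2)] that assms(3) by simp
    show "representation B (scale c u) (h j) = c * representation B u (h j)" if "u \<in> U" for c u j
      using representation_scale[OF assms(2)] that assms(3) by simp
    show "representation B (h i) (h j) = (if i = j then 1 else 0)" if "i < dim U" "j < dim U" for i j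
      using representation_basis[OF assms(2) hB[OF that(1)]] h that by (auto simp: bij_betw_def inj_on_def dim)
  qed
qed

end

text \<open>Take a nonzero polynomial \<open>p\<close> of least degree such that
  \<open>p(Q)\<close>, written \<open>pe p\<close>, kills some nonzero \<open>x\<close>; there is
  one because \<open>r + 1\<close> iterates of a vector are dependent. With
  \<open>p = (X - z) * t\<close>, minimality makes \<open>t(Q) x\<close> nonzero, and it is an
  eigenvector for \<open>z\<close>.\<close>

lemma matrix_eigenvector:
  fixes Q :: "nat \<Rightarrow> nat \<Rightarrow> 'k::alg_closed_field"
  assumes "r > 0"
  shows "\<exists>c x. (\<exists>j<r. x j \<noteq> 0) \<and> (\<forall>j<r. (\<Sum>k<r. Q j k * x k) = c * x j)"
proof -
  define f where "f x = (\<lambda>j. \<Sum>k<r. Q j k * x k)" for x :: "nat \<Rightarrow> 'k"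
  define pe where "pe p x = (\<lambda>j. \<Sum>i\<le>degree p. Polynomial.coeff p i * (f ^^ i) x j)" for p x
  have pe: "pe p x j = (\<Sum>i\<le>n. Polynomial.coeff p i * (f ^^ i) x j)" if "degree p \<le> n" for p x j n
    unfolding pe_def by (rule sum.mono_neutral_left) (use that in \<open>auto simp: coeff_eq_0\<close>)
  let ?P = "\<lambda>n. \<exists>p x. p \<noteq> 0 \<and> degree p = n \<and> (\<exists>j<r. x j \<noteq> 0) \<and> (\<forall>j<r. pe p x j = 0)"
  have "\<exists>n. ?P n"
  proof -
    \<comment> \<open>Any starting vector with a nonzero entry below \<open>r\<close> would do; this
      one has it because \<open>r > 0\<close>.\<close>
    define x where "x = (\<lambda>j::nat. 1::'k)"
    have "\<exists>s. (\<exists>i\<in>{..r}. s i \<noteq> 0) \<and> (\<forall>j\<in>{..<r}. (\<Sum>i\<in>{..r}. s i * (f ^^ i) x j) = 0)"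
      by (rule linear_relation_UNIV) auto
    then obtain s i0 where s: "i0 \<le> r" "s i0 \<noteq> 0" "\<And>j. j < r \<Longrightarrow> (\<Sum>i\<le>r. s i * (f ^^ i) x j) = 0" by auto
    define p where "p = (\<Sum>i\<le>r. monom (s i) i)"
    have cp: "Polynomial.coeff p i = (if i \<le> r then s i else 0)" for i
      by (simp add: p_def coeff_sum)
    have "p \<noteq> 0" using cp[of i0] s by auto
    moreover have "degree p \<le> r" by (rule degree_le) (simp add: cp)
    then have "pe p x j = 0" if "j < r" for j using pe[of p r x j] s(3)[OF that] by (simp add: cp)
    ultimately have "?P (degree p)" using assms
      by (intro exI[of _ p] exI[of _ x]) (auto simp: x_def)
    then show ?thesis ..
  qed
  then have L: "?P (LEAST n. ?P n)" by (rule LeastI_ex)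
  have L': "(LEAST n. ?P n) \<le> m" if "?P m" for m using that by (rule Least_le)
  obtain p x where p: "p \<noteq> 0" "degree p = (LEAST n. ?P n)" and x: "\<exists>j<r. x j \<noteq> 0" and 0: "\<And>j. j < r \<Longrightarrow> pe p x j = 0"
    using L by blast
  have "degree p > 0"
  proof (rule ccontr)
    assume "\<not> degree p > 0"
    then obtain c where c: "p = [:c:]" by (metis degree_eq_zeroE not_gr_zero)
    then have "c * x j = 0" if "j < r" for j using 0[OF that] by (simp add: pe_def)
    then show False using x p(1) c by auto
  qed
  then obtain z where "poly p z = 0" using alg_closed_imp_poly_has_root by blast
  then obtain t where t: "p = [:- z, 1:] * t" by (metis poly_eq_0_iff_dvd dvdE)
  have t0: "t \<noteq> 0" using p(1) t by auto
  have deg: "degree p = Suc (degree t)" unfolding t using t0 by (subst degree_mult_eq) auto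
  define y where "y = pe t x"
  have "\<exists>j<r. y j \<noteq> 0"
  proof (rule ccontr)
    assume "\<not> (\<exists>j<r. y j \<noteq> 0)"
    then have "?P (degree t)" using t0 x by (intro exI[of _ t] exI[of _ x]) (auto simp: y_def)
    then show False using L'[of "degree t"] p(2) deg by simp
  qed
  moreover have "(\<Sum>k<r. Q j k * y k) = z * y j" if j: "j < r" for j
  proof -
    let ?n = "degree t"
    have "(\<Sum>k<r. Q j k * y k) = (\<Sum>i\<le>?n. Polynomial.coeff t i * (f ^^ Suc i) x j)"
      unfolding y_def pe_def sum_distrib_left by (subst sum.swap) (simp add: f_def sum_distrib_left mult_ac)
    moreover have "0 = (\<Sum>i\<le>Suc ?n. Polynomial.coeff p i * (f ^^ i) x j)" using 0[OF j] deg by (simp add: pe_def)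
    moreover have "\<dots> = (\<Sum>i\<le>Suc ?n. Polynomial.coeff (pCons 0 t) i * (f ^^ i) x j) - z * (\<Sum>i\<le>Suc ?n. Polynomial.coeff t i * (f ^^ i) x j)"
      unfolding t sum_distrib_left sum_subtractf[symmetric] by (intro sum.cong refl) (simp add: algebra_simps)
    moreover have "(\<Sum>i\<le>Suc ?n. Polynomial.coeff (pCons 0 t) i * (f ^^ i) x j) = (\<Sum>i\<le>?n. Polynomial.coeff t i * (f ^^ Suc i) x j)"
      by (subst sum.atMost_Suc_shift) simp
    moreover have "(\<Sum>i\<le>Suc ?n. Polynomial.coeff t i * (f ^^ i) x j) = y j" using pe[of t "Suc ?n" x j] by (simp add: y_def)
    ultimately show ?thesis by simp
  qed
  ultimately show ?thesis by blast
qed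

section \<open>Matrices of representations and Schur's lemma\<close>

locale coordinate_representation = finite_map_group G + vector_space sW
  for G :: "('v \<Rightarrow> 'v) set" and sW :: "'k::field \<Rightarrow> 'w::ab_group_add \<Rightarrow> 'w" +
  fixes U :: "'w set" and \<rho> :: "('v \<Rightarrow> 'v) \<Rightarrow> 'w \<Rightarrow> 'w" and r :: nat and e :: "nat \<Rightarrow> 'w" and co :: "'w \<Rightarrow> nat \<Rightarrow> 'k"
  assumes rep: "Defs.representation sW G U \<rho>"
    and e_U: "j < r \<Longrightarrow> e j \<in> U" and co_expansion: "u \<in> U \<Longrightarrow> (\<Sum>j<r. sW (co u j) (e j)) = u"
    and co_add: "u \<in> U \<Longrightarrow> v \<in> U \<Longrightarrow> co (u + v) j = co u j + co v j"
    and co_scale: "u \<in> U \<Longrightarrow> co (sW c u) j = c * co u j"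
    and co_e: "i < r \<Longrightarrow> j < r \<Longrightarrow> co (e i) j = (if i = j then 1 else 0)"
begin

lemma subU: "subspace U" using rep by (simp add: Defs.representation_def)
lemmas U_0 = subspace_0[OF subU] and U_add = subspace_add[OF subU] and U_scale = subspace_scale[OF subU]
  and U_sum = subspace_sum[OF subU]
lemma rho_U: "g \<in> G \<Longrightarrow> u \<in> U \<Longrightarrow> \<rho> g u \<in> U"
  and rho_add: "g \<in> G \<Longrightarrow> u \<in> U \<Longrightarrow> v \<in> U \<Longrightarrow> \<rho> g (u + v) = \<rho> g u + \<rho> g v"
  and rho_scale: "g \<in> G \<Longrightarrow> u \<in> U \<Longrightarrow> \<rho> g (sW c u) = sW c (\<rho> g u)"
  and rho_id: "u \<in> U \<Longrightarrow> \<rho> id u = u"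
  and rho_comp: "g \<in> G \<Longrightarrow> h \<in> G \<Longrightarrow> u \<in> U \<Longrightarrow> \<rho> (g \<circ> h) u = \<rho> g (\<rho> h u)"
  using rep by (simp_all add: Defs.representation_def)
lemma rho_0: "g \<in> G \<Longrightarrow> \<rho> g 0 = 0" using rho_scale[of g 0 0] U_0 by simp
lemma rho_sum: "g \<in> G \<Longrightarrow> (\<And>a. a \<in> A \<Longrightarrow> f a \<in> U) \<Longrightarrow> \<rho> g (sum f A) = (\<Sum>a\<in>A. \<rho> g (f a))"
  by (induction A rule: infinite_finite_induct) (simp_all add: rho_0 rho_add U_sum)
lemma co_0: "co 0 j = 0" using co_scale[of 0 0 j] U_0 by simp
lemma co_sum: "(\<And>a. a \<in> A \<Longrightarrow> f a \<in> U) \<Longrightarrow> co (sum f A) j = (\<Sum>a\<in>A. co (f a) j)"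
  by (induction A rule: infinite_finite_induct) (simp_all add: co_0 co_add U_sum)
lemma co_eqI: assumes "u \<in> U" "v \<in> U" "\<And>j. j < r \<Longrightarrow> co u j = co v j" shows "u = v"
proof -
  have "(\<Sum>j<r. sW (co u j) (e j)) = (\<Sum>j<r. sW (co v j) (e j))" using assms(3) by simp
  then show ?thesis by (simp only: co_expansion assms(1,2))
qed
lemma co_combination: "j < r \<Longrightarrow> co (\<Sum>i<r. sW (f i) (e i)) j = f j"
proof -
  assume j: "j < r"
  have "co (\<Sum>i<r. sW (f i) (e i)) j = (\<Sum>i<r. f i * co (e i) j)"
    by (subst co_sum) (auto simp: e_U U_scale co_scale)
  also have "\<dots> = (\<Sum>i<r. if i = j then f j else 0)" by (intro sum.cong refl) (use j in \<open>auto simp: co_e\<close>)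
  finally show ?thesis using j by simp
qed

definition D :: "('v \<Rightarrow> 'v) \<Rightarrow> nat \<Rightarrow> nat \<Rightarrow> 'k" where "D g j k = co (\<rho> g (e k)) j"

lemma co_rho: assumes "g \<in> G" "u \<in> U" shows "co (\<rho> g u) j = (\<Sum>k<r. D g j k * co u k)"
proof -
  have "\<rho> g u = \<rho> g (\<Sum>k<r. sW (co u k) (e k))" by (simp only: co_expansion assms(2))
  also have "\<dots> = (\<Sum>k<r. sW (co u k) (\<rho> g (e k)))"
    by (subst rho_sum) (simp_all add: assms(1) U_scale e_U rho_scale)
  finally have "\<rho> g u = (\<Sum>k<r. sW (co u k) (\<rho> g (e k)))" .
  then have "co (\<rho> g u) j = (\<Sum>k<r. co (sW (co u k) (\<rho> g (e k))) j)"
    using co_sum[of "{..<r}" "\<lambda>k. sW (co u k) (\<rho> g (e k))" j] by (simp add: U_scale rho_U assms(1) e_U)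
  then show ?thesis by (simp add: co_scale rho_U assms(1) e_U D_def mult.commute)
qed

lemma mrep_D: "mrep r D"
  unfolding mrep_def
proof (intro conjI allI impI ballI)
  fix j k assume "j < r" "k < r"
  then show "D id j k = (if j = k then 1 else 0)" by (simp only: D_def rho_id e_U co_e eq_commute)
next
  fix g h j k assume "g \<in> G" "h \<in> G" "j < r" "k < r"
  then show "D (g \<circ> h) j k = (\<Sum>l<r. D g j l * D h l k)"
    unfolding D_def[of "g \<circ> h"] by (simp add: rho_comp e_U co_rho rho_U D_def[of h])
qed

end

locale two_representations = A: coordinate_representation G sW U \<rho> r e co + B: coordinate_representation G sW U' \<rho>' r' e' co'
  for G :: "('v \<Rightarrow> 'v) set" and sW :: "'k::field \<Rightarrow> 'w::ab_group_add \<Rightarrow> 'w" and U \<rho> r e co U' \<rho>' r' e' co'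
begin

definition qmap :: "(nat \<Rightarrow> nat \<Rightarrow> 'k) \<Rightarrow> 'w \<Rightarrow> 'w" where
  "qmap Q u = (\<Sum>j<r'. sW (\<Sum>k<r. Q j k * co u k) (e' j))"

lemma qmap_U: "qmap Q u \<in> U'"
  unfolding qmap_def by (intro B.U_sum B.U_scale B.e_U) simp
lemma qmap_co: "j < r' \<Longrightarrow> co' (qmap Q u) j = (\<Sum>k<r. Q j k * co u k)"
  unfolding qmap_def by (rule B.co_combination)
lemma qmap_add: "u \<in> U \<Longrightarrow> v \<in> U \<Longrightarrow> qmap Q (u + v) = qmap Q u + qmap Q v"
  by (intro B.co_eqI qmap_U B.U_add) (simp_all add: qmap_co B.co_add qmap_U A.co_add distrib_left sum.distrib)
lemma qmap_scale: "u \<in> U \<Longrightarrow> qmap Q (sW c u) = sW c (qmap Q u)"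
  by (intro B.co_eqI qmap_U B.U_scale)
     (simp_all add: qmap_co B.co_scale qmap_U A.co_scale sum_distrib_left mult_ac)
lemma qmap_equivariant:
  assumes "A.intertwiner r A.D r' B.D Q" "g \<in> G" "u \<in> U"
  shows "qmap Q (\<rho> g u) = \<rho>' g (qmap Q u)"
proof (intro B.co_eqI qmap_U B.rho_U assms(2))
  fix j assume j: "j < r'"
  have "co' (qmap Q (\<rho> g u)) j = (\<Sum>k<r. \<Sum>l<r. Q j k * A.D g k l * co u l)"
    by (simp add: qmap_co[OF j] A.co_rho assms sum_distrib_left mult.assoc)
  also have "\<dots> = (\<Sum>l<r. (\<Sum>k<r. Q j k * A.D g k l) * co u l)"
    by (subst sum.swap) (simp add: sum_distrib_right)
  also have "\<dots> = (\<Sum>l<r. (\<Sum>k<r'. B.D g j k * Q k l) * co u l)"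
    using assms(1,2) j unfolding A.intertwiner_def by simp
  also have "\<dots> = (\<Sum>k<r'. B.D g j k * co' (qmap Q u) k)"
    unfolding sum_distrib_right by (subst sum.swap) (simp add: qmap_co sum_distrib_left mult.assoc)
  also have "\<dots> = co' (\<rho>' g (qmap Q u)) j" by (simp add: B.co_rho assms(2) qmap_U)
  finally show "co' (qmap Q (\<rho> g u)) j = co' (\<rho>' g (qmap Q u)) j" .
qed

text \<open>The kernel of \<open>qmap Q\<close> is an invariant subspace. Containing
  \<open>u0 \<noteq> 0\<close>, it is all of \<open>U\<close>, and column \<open>k\<close> of
  \<open>Q\<close> is the image of \<open>e k\<close>.\<close>

lemma schur_kernel:
  assumes irr: "irreducible_representation sW G U \<rho>" and Q: "A.intertwiner r A.D r' B.D Q"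
    and u0: "u0 \<in> U" "u0 \<noteq> 0" "qmap Q u0 = 0" and jk: "j < r'" "k < r"
  shows "Q j k = 0"
proof -
  let ?K = "{u\<in>U. qmap Q u = 0}"
  have q0: "qmap Q 0 = 0" using qmap_scale[OF A.U_0, of Q 0] by simp
  have "A.subspace ?K"
    unfolding A.subspace_def using A.U_0 A.U_add A.U_scale q0 by (auto simp: qmap_add qmap_scale)
  moreover have "\<forall>g\<in>G. \<forall>u\<in>?K. \<rho> g u \<in> ?K" using A.rho_U B.rho_0 by (auto simp: qmap_equivariant[OF Q])
  ultimately have "?K = {0} \<or> ?K = U"
    using irr unfolding irreducible_representation_def by blast
  then have "?K = U" using u0 by blast
  then have "qmap Q (e k) = 0" using A.e_U[OF jk(2)] by blast
  then have "(\<Sum>i<r. Q j i * co (e k) i) = 0" using qmap_co[OF jk(1), of Q "e k"] by (simp add: B.co_0)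
  moreover have "(\<Sum>i<r. Q j i * co (e k) i) = (\<Sum>i<r. if i = k then Q j k else 0)"
    by (intro sum.cong refl) (use jk in \<open>auto simp: A.co_e\<close>)
  ultimately show ?thesis using jk(2) by simp
qed

text \<open>A nonzero entry makes \<open>qmap Q\<close> injective by the kernel argument; its image
  is a nonzero invariant subspace of an irreducible target, so it would be an isomorphism.\<close>

lemma schur_nonisomorphic:
  assumes irr: "irreducible_representation sW G U \<rho>" "irreducible_representation sW G U' \<rho>'"
    and Q: "A.intertwiner r A.D r' B.D Q" and niso: "\<not> isomorphic_representations G sW U \<rho> sW U' \<rho>'"
    and jk: "j < r'" "k < r"
  shows "Q j k = 0"
proof (rule ccontr)
  assume nz: "Q j k \<noteq> 0"
  have ker: "u = 0" if "u \<in> U" "qmap Q u = 0" for u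
    using schur_kernel[OF irr(1) Q that(1) _ that(2) jk] nz by blast
  have inj: "inj_on (qmap Q) U"
  proof (rule inj_onI)
    fix u v assume uv: "u \<in> U" "v \<in> U" "qmap Q u = qmap Q v"
    have "qmap Q (u + sW (-1) v) = qmap Q u + sW (-1) (qmap Q v)"
      by (simp only: qmap_add qmap_scale uv(1,2) A.U_scale)
    then have "qmap Q (u + sW (-1) v) = 0" using uv(3) by simp
    then have "u + sW (-1) v = 0" using ker uv A.U_add A.U_scale by blast
    then show "u = v" by simp
  qed
  have "A.subspace (qmap Q ` U)" unfolding A.subspace_def
  proof (intro conjI allI ballI)
    show "0 \<in> qmap Q ` U" using qmap_scale[OF A.U_0, of Q 0] A.U_0 by force
  next
    fix x y assume "x \<in> qmap Q ` U" "y \<in> qmap Q ` U"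
    then show "x + y \<in> qmap Q ` U" using A.U_add by (force simp flip: qmap_add)
  next
    fix c x assume "x \<in> qmap Q ` U"
    then show "sW c x \<in> qmap Q ` U" using A.U_scale by (force simp flip: qmap_scale)
  qed
  moreover have "\<forall>g\<in>G. \<forall>u\<in>qmap Q ` U. \<rho>' g u \<in> qmap Q ` U"
    using A.rho_U by (auto simp flip: qmap_equivariant[OF Q])
  moreover have "qmap Q ` U \<subseteq> U'" using qmap_U by blast
  ultimately have "qmap Q ` U = {0} \<or> qmap Q ` U = U'"
    using irr(2) unfolding irreducible_representation_def by blast
  moreover have "qmap Q ` U \<noteq> {0}"
  proof
    assume "qmap Q ` U = {0}"
    then have "U \<subseteq> {0}" using ker by blast
    then show False using irr(1) A.U_0 unfolding irreducible_representation_def by blast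
  qed
  ultimately have "bij_betw (qmap Q) U U'" using inj by (simp add: bij_betw_def)
  then have "isomorphic_representations G sW U \<rho> sW U' \<rho>'"
    unfolding isomorphic_representations_def
    by (intro exI[of _ "qmap Q"]) (simp add: qmap_add qmap_scale qmap_equivariant[OF Q])
  then show False using niso by blast
qed

end

text \<open>\<open>Q\<close> minus an eigenvalue is again an intertwiner and has a nonzero kernel,
  so it vanishes. The eigenvector is a hypothesis because the field of this locale is
  arbitrary.\<close>

lemma (in coordinate_representation) schur_scalar:
  assumes irr: "irreducible_representation sW G U \<rho>" and Q: "intertwiner r D r D Q"
    and eig: "\<exists>c x. (\<exists>j<r. x j \<noteq> 0) \<and> (\<forall>j<r. (\<Sum>k<r. Q j k * x k) = c * x j)"
  shows "\<exists>c. \<forall>j<r. \<forall>k<r. Q j k = (if j = k then c else 0)"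
proof -
  interpret two_representations G sW U \<rho> r e co U \<rho> r e co by unfold_locales
  obtain c x i where x: "i < r" "x i \<noteq> 0" "\<And>j. j < r \<Longrightarrow> (\<Sum>k<r. Q j k * x k) = c * x j"
    using eig by blast
  define u0 where "u0 = (\<Sum>i<r. sW (x i) (e i))"
  have u0: "u0 \<in> U" unfolding u0_def by (intro U_sum U_scale e_U) simp
  have co_u0: "co u0 j = x j" if "j < r" for j unfolding u0_def by (rule co_combination[OF that])
  have "u0 \<noteq> 0" using co_u0[OF x(1)] x(2) co_0 by auto
  define Q' where "Q' j k = Q j k - (if j = k then c else 0)" for j k
  have Q': "intertwiner r D r D Q'"
    unfolding intertwiner_def
  proof (intro ballI allI impI)
    fix g j k assume g: "g \<in> G" and jk: "j < r" "k < r"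
    have "(\<Sum>l<r. D g j l * (if l = k then c else 0)) = (\<Sum>l<r. if l = k then D g j k * c else 0)"
      by (intro sum.cong refl) auto
    moreover have "(\<Sum>l<r. (if j = l then c else 0) * D g l k) = (\<Sum>l<r. if l = j then c * D g j k else 0)"
      by (intro sum.cong refl) auto
    ultimately show "(\<Sum>l<r. D g j l * Q' l k) = (\<Sum>l<r. Q' j l * D g l k)"
      using Q g jk unfolding intertwiner_def Q'_def
      by (simp add: right_diff_distrib left_diff_distrib sum_subtractf mult.commute)
  qed
  have "qmap Q' u0 = 0"
  proof (rule co_eqI[OF qmap_U U_0])
    fix j assume j: "j < r"
    have "(\<Sum>k<r. (if j = k then c else 0) * x k) = (\<Sum>k<r. if k = j then c * x j else 0)"
      by (intro sum.cong refl) auto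
    then have "(\<Sum>k<r. Q' j k * co u0 k) = 0"
      using x(3)[OF j] j by (simp add: co_u0 Q'_def left_diff_distrib sum_subtractf)
    then show "co (qmap Q' u0) j = co 0 j" by (simp add: qmap_co[OF j] co_0)
  qed
  then have "Q' j k = 0" if "j < r" "k < r" for j k
    by (rule schur_kernel[OF irr Q' u0 \<open>u0 \<noteq> 0\<close> _ that])
  then show ?thesis by (intro exI[of _ c]) (auto simp: Q'_def)
qed

text \<open>The orbit of a nonzero vector is finite and spans a nonzero invariant subspace, which is
  all of \<open>U\<close>.\<close>

lemma (in vector_space) irreducible_finite_basis:
  assumes fin: "finite G" and id: "id \<in> G" and comp: "\<And>g h. g \<in> G \<Longrightarrow> h \<in> G \<Longrightarrow> g \<circ> h \<in> G"
    and irr: "irreducible_representation scale G U \<rho>"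
  obtains B where "finite B" "independent B" "span B = U"
proof -
  have rep: "Defs.representation scale G U \<rho>" and sub: "subspace U" and "U \<noteq> {0}"
    using irr by (auto simp: irreducible_representation_def Defs.representation_def)
  then obtain w where w: "w \<in> U" "w \<noteq> 0" using subspace_0 by blast
  let ?O = "(\<lambda>g. \<rho> g w) ` G"
  have OU: "?O \<subseteq> U" using rep w(1) by (auto simp: Defs.representation_def)
  have sO: "span ?O \<subseteq> U" using span_minimal[OF OU sub] .
  have "\<rho> g u \<in> span ?O" if g: "g \<in> G" and u: "u \<in> span ?O" for g u
  proof -
    have "u \<in> U \<and> \<rho> g u \<in> span ?O" using u
    proof (induction rule: span_induct_alt)
      case base
      have "\<rho> g (scale 0 0) = scale 0 (\<rho> g 0)"
        using rep g subspace_0[OF sub] unfolding Defs.representation_def by blast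
      then show ?case using subspace_0[OF sub] span_zero by simp
    next
      case (step c x y)
      then obtain h where h: "h \<in> G" "x = \<rho> h w" by auto
      have xU: "x \<in> U" using step OU by blast
      have "\<rho> g x = \<rho> (g \<circ> h) w" using rep g h w(1) by (simp add: Defs.representation_def)
      moreover have "\<rho> (g \<circ> h) w \<in> ?O" using comp[OF g h(1)] by (rule imageI)
      ultimately have "\<rho> g x \<in> span ?O" by (simp only: span_base)
      moreover have "\<rho> g (scale c x + y) = scale c (\<rho> g x) + \<rho> g y"
        using rep g xU step subspace_scale[OF sub xU] by (simp add: Defs.representation_def)
      ultimately show ?case
        using step xU sub by (auto intro: span_add span_scale subspace_add subspace_scale)
    qed
    then show ?thesis by blast
  qed
  then have "span ?O = {0} \<or> span ?O = U"
    using irr sO subspace_span[of ?O] unfolding irreducible_representation_def by blast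
  moreover have "w \<in> span ?O"
  proof -
    have "\<rho> id w = w" using rep w(1) by (simp add: Defs.representation_def)
    then show ?thesis using id span_base[of w ?O] by (metis imageI)
  qed
  ultimately have spO: "span ?O = U" using w(2) by blast
  obtain B where B: "B \<subseteq> ?O" "independent B" "?O \<subseteq> span B" using maximal_independent_subset by blast
  have "finite B" using B(1) fin finite_subset by blast
  moreover have "span B = U"
    using B(1,3) spO span_mono[OF B(1)] span_minimal[OF B(3) subspace_span] by blast
  ultimately show thesis using that B(2) by blast
qed

section \<open>The regular representation\<close>

text \<open>The scalar multiplication that appears in \<open>complete_irreducibles\<close>: the
  regular representation is realised on finitely supported sequences in order that completeness
  applies to its subrepresentations.\<close>

abbreviation pscale :: "'k::field \<Rightarrow> (nat \<Rightarrow>\<^sub>0 'k) \<Rightarrow> nat \<Rightarrow>\<^sub>0 'k" where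
  "pscale \<equiv> (\<lambda>c. Poly_Mapping.map ((*) c))"

lemma lookup_pscale: "Poly_Mapping.lookup (pscale c p) i = c * Poly_Mapping.lookup p i"
  by (simp add: Poly_Mapping.map.rep_eq when_def)

interpretation seq: vector_space "pscale :: 'k::field \<Rightarrow> _"
  by unfold_locales (auto intro!: poly_mapping_eqI simp: lookup_pscale lookup_add algebra_simps)

context finite_map_group begin

definition idx :: "('v \<Rightarrow> 'v) \<Rightarrow> nat" where
  "idx = (SOME h. bij_betw h G {0..<card G})"

lemma idx: "bij_betw idx G {0..<card G}"
  unfolding idx_def by (rule someI_ex[OF ex_bij_betw_finite_nat[OF fin_G]])

lemma idx_inj: "g \<in> G \<Longrightarrow> h \<in> G \<Longrightarrow> idx g = idx h \<longleftrightarrow> g = h"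
  using idx by (auto simp: bij_betw_def inj_on_def)

definition regular :: "(nat \<Rightarrow>\<^sub>0 'k::field) set" where
  "regular = {p. Poly_Mapping.keys p \<subseteq> {0..<card G}}"

definition reg_act :: "('v \<Rightarrow> 'v) \<Rightarrow> (nat \<Rightarrow>\<^sub>0 'k::field) \<Rightarrow> nat \<Rightarrow>\<^sub>0 'k" where
  "reg_act g p = (\<Sum>h\<in>G. Poly_Mapping.single (idx (g \<circ> h)) (Poly_Mapping.lookup p (idx h)))"

lemma regular_eqI:
  assumes "p \<in> regular" "p' \<in> regular" "\<And>h. h \<in> G \<Longrightarrow> Poly_Mapping.lookup p (idx h) = Poly_Mapping.lookup p' (idx h)"
  shows "p = p'"
proof (rule poly_mapping_eqI)
  fix i
  show "Poly_Mapping.lookup p i = Poly_Mapping.lookup p' i"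
  proof (cases "i \<in> {0..<card G}")
    case True
    then have "i \<in> idx ` G" using idx by (simp only: bij_betw_def)
    then obtain h where "h \<in> G" "i = idx h" by blast
    then show ?thesis using assms(3) by simp
  next
    case False
    then have "i \<notin> Poly_Mapping.keys p" "i \<notin> Poly_Mapping.keys p'" using assms(1,2) by (auto simp: regular_def)
    then show ?thesis by (simp only: not_in_keys_iff_lookup_eq_zero)
  qed
qed

lemma regular_subspace: "seq.subspace regular"
  unfolding seq.subspace_def
proof (intro conjI allI ballI)
  fix x y :: "nat \<Rightarrow>\<^sub>0 'k::field" and c :: 'k assume x: "x \<in> regular"
  { assume "y \<in> regular" then show "x + y \<in> regular"
      using x Poly_Mapping.keys_add[of x y] by (auto simp: regular_def) }
  show "pscale c x \<in> regular" using x by (auto simp: regular_def in_keys_iff lookup_pscale)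
qed (simp add: regular_def)

lemma idx_lt: "g \<in> G \<Longrightarrow> idx g < card G"
  using idx by (auto simp: bij_betw_def)

lemma single_regular: "g \<in> G \<Longrightarrow> Poly_Mapping.single (idx g) c \<in> regular"
  using idx_lt by (auto simp: regular_def)

lemma reg_act_regular: "g \<in> G \<Longrightarrow> reg_act g p \<in> regular"
  unfolding reg_act_def by (intro seq.subspace_sum[OF regular_subspace] single_regular comp_G)

lemma lookup_reg_act: assumes "g \<in> G" "h \<in> G"
  shows "Poly_Mapping.lookup (reg_act g p) (idx h) = Poly_Mapping.lookup p (idx (iv g \<circ> h))"
proof -
  have "Poly_Mapping.lookup (reg_act g p) (idx h)
      = (\<Sum>x\<in>G. if x = iv g \<circ> h then Poly_Mapping.lookup p (idx (iv g \<circ> h)) else 0)"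
    unfolding reg_act_def lookup_sum
  proof (intro sum.cong refl)
    fix x assume x: "x \<in> G"
    have "idx (g \<circ> x) = idx h \<longleftrightarrow> g \<circ> x = h" by (rule idx_inj[OF comp_G[OF assms(1) x] assms(2)])
    also have "\<dots> \<longleftrightarrow> x = iv g \<circ> h" using cancel_G(1,2)[OF assms(1)] by metis
    finally show "Poly_Mapping.lookup (Poly_Mapping.single (idx (g \<circ> x)) (Poly_Mapping.lookup p (idx x))) (idx h)
        = (if x = iv g \<circ> h then Poly_Mapping.lookup p (idx (iv g \<circ> h)) else 0)"
      by (simp add: lookup_single when_def)
  qed
  then show ?thesis using fin_G comp_G[OF inv_G[OF assms(1)] assms(2)] by simp
qed

lemma reg_act_id: assumes "p \<in> regular" shows "reg_act id p = p"
proof (rule regular_eqI[OF reg_act_regular[OF id_G] assms])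
  fix h assume "h \<in> G"
  show "Poly_Mapping.lookup (reg_act id p) (idx h) = Poly_Mapping.lookup p (idx h)"
    unfolding lookup_reg_act[OF id_G \<open>h \<in> G\<close>] inv_id id_comp ..
qed

lemma reg_act_comp: assumes g: "g \<in> G" and h: "h \<in> G" shows "reg_act (g \<circ> h) p = reg_act g (reg_act h p)"
proof (rule regular_eqI[OF reg_act_regular[OF comp_G[OF g h]] reg_act_regular[OF g]])
  fix x assume x: "x \<in> G"
  show "Poly_Mapping.lookup (reg_act (g \<circ> h) p) (idx x) = Poly_Mapping.lookup (reg_act g (reg_act h p)) (idx x)"
    unfolding lookup_reg_act[OF comp_G[OF g h] x] lookup_reg_act[OF g x] lookup_reg_act[OF h comp_G[OF inv_G[OF g] x]]
      iv_comp[OF g h] comp_assoc ..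
qed

lemma reg_act_add: "reg_act g (p + p') = reg_act g p + reg_act g p'"
  by (simp add: reg_act_def lookup_add single_add sum.distrib)
lemma reg_act_scale: "reg_act g (pscale c p) = pscale c (reg_act g p)"
proof -
  have s: "pscale c (sum f A) = (\<Sum>a\<in>A. pscale c (f a))" for f :: "('v \<Rightarrow> 'v) \<Rightarrow> nat \<Rightarrow>\<^sub>0 'a" and A
    by (rule seq.scale_sum_right)
  show ?thesis unfolding reg_act_def s
    by (intro sum.cong refl poly_mapping_eqI) (simp add: lookup_pscale lookup_single when_def)
qed
lemma reg_act_0: "reg_act g 0 = 0" by (simp add: reg_act_def)
lemma reg_act_sum: "reg_act g (sum f A) = (\<Sum>a\<in>A. reg_act g (f a))"
  by (induction A rule: infinite_finite_induct) (simp_all add: reg_act_0 reg_act_add)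

definition regular_sub :: "(nat \<Rightarrow>\<^sub>0 'k::field) set \<Rightarrow> bool" where
  "regular_sub I \<longleftrightarrow> seq.subspace I \<and> I \<subseteq> regular \<and> (\<forall>g\<in>G. \<forall>u\<in>I. reg_act g u \<in> I)"

text \<open>The product of the group algebra, with \<open>y\<close> expanded over \<open>G\<close>
  and acting on \<open>z\<close> from the left.\<close>

definition reg_mult :: "(nat \<Rightarrow>\<^sub>0 'k::field) \<Rightarrow> (nat \<Rightarrow>\<^sub>0 'k) \<Rightarrow> nat \<Rightarrow>\<^sub>0 'k" where
  "reg_mult y z = (\<Sum>g\<in>G. pscale (Poly_Mapping.lookup y (idx g)) (reg_act g z))"

lemma reg_mult_unit: assumes "y \<in> regular" shows "reg_mult y (Poly_Mapping.single (idx id) 1) = y"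
proof -
  have act: "reg_act g (Poly_Mapping.single (idx id) (1::'k::field)) = Poly_Mapping.single (idx g) 1" if g: "g \<in> G" for g
  proof -
    have "reg_act g (Poly_Mapping.single (idx id) (1::'k)) = (\<Sum>h\<in>G. if h = id then Poly_Mapping.single (idx g) 1 else 0)"
      unfolding reg_act_def
    proof (intro sum.cong refl)
      fix h assume h: "h \<in> G"
      show "Poly_Mapping.single (idx (g \<circ> h)) (Poly_Mapping.lookup (Poly_Mapping.single (idx id) (1::'k)) (idx h))
          = (if h = id then Poly_Mapping.single (idx g) 1 else 0)"
      proof (cases "h = id")
        case True
        then show ?thesis by (simp only: comp_id lookup_single_eq if_True refl)
      next
        case False
        then have "idx id \<noteq> idx h" using idx_inj[OF id_G h] by metis
        show ?thesis unfolding if_not_P[OF False] lookup_single_not_eq[OF \<open>idx id \<noteq> idx h\<close>] single_zero ..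
      qed
    qed
    also have "\<dots> = (if id \<in> G then Poly_Mapping.single (idx g) 1 else 0)" by (rule sum.delta[OF fin_G])
    finally show ?thesis using id_G by (simp only: if_True)
  qed
  show ?thesis
  proof (rule regular_eqI[OF _ assms])
    show "reg_mult y (Poly_Mapping.single (idx id) 1) \<in> regular"
      unfolding reg_mult_def
      by (intro seq.subspace_sum[OF regular_subspace] seq.subspace_scale[OF regular_subspace] reg_act_regular)
    fix h assume h: "h \<in> G"
    have "Poly_Mapping.lookup (reg_mult y (Poly_Mapping.single (idx id) 1)) (idx h)
        = (\<Sum>g\<in>G. if g = h then Poly_Mapping.lookup y (idx h) else 0)"
      unfolding reg_mult_def lookup_sum
      by (intro sum.cong refl) (use h in \<open>auto simp: act lookup_pscale lookup_single when_def idx_inj\<close>)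
    then show "Poly_Mapping.lookup (reg_mult y (Poly_Mapping.single (idx id) 1)) (idx h) = Poly_Mapping.lookup y (idx h)"
      using h fin_G by simp
  qed
qed

text \<open>Maschke's theorem: averaging a linear projection onto \<open>I\<close> gives an equivariant one, which is
  right multiplication by an element of \<open>I\<close>.\<close>

lemma regular_idempotent:
  fixes I :: "(nat \<Rightarrow>\<^sub>0 'k::field) set"
  assumes I: "regular_sub I" and cG: "of_nat (card G) \<noteq> (0::'k)"
  obtains e where "e \<in> I" "\<And>y. y \<in> I \<Longrightarrow> reg_mult y e = y"
proof -
  have sub: "seq.subspace I" and IR: "I \<subseteq> regular" and inv: "\<And>g u. g \<in> G \<Longrightarrow> u \<in> I \<Longrightarrow> reg_act g u \<in> I"
    using I by (auto simp: regular_sub_def)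
  interpret pair: vector_space_pair "pscale :: 'k \<Rightarrow> _" "pscale :: 'k \<Rightarrow> _" ..
  obtain f where f: "f ` UNIV \<subseteq> I" "Vector_Spaces.linear pscale pscale f" "\<forall>v\<in>I. f v = v"
    using pair.linear_exists_left_inverse_on[OF _ sub, of "\<lambda>x. x"] seq.linear_ident by auto
  interpret f: Vector_Spaces.linear "pscale :: 'k \<Rightarrow> _" "pscale :: 'k \<Rightarrow> _" f by (rule f(2))
  define P where "P y = pscale (inverse (of_nat (card G))) (\<Sum>g\<in>G. reg_act g (f (reg_act (iv g) y)))" for y
  have P_I: "P y \<in> I" for y
    unfolding P_def using f(1) inv by (intro seq.subspace_scale[OF sub] seq.subspace_sum[OF sub]) blast
  have P_id: "P y = y" if y: "y \<in> I" for y
  proof -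
    have "reg_act g (f (reg_act (iv g) y)) = y" if g: "g \<in> G" for g
    proof -
      have "f (reg_act (iv g) y) = reg_act (iv g) y" using f(3) inv[OF inv_G[OF g] y] by blast
      then have "reg_act g (f (reg_act (iv g) y)) = reg_act (g \<circ> iv g) y" by (simp only: reg_act_comp[OF g inv_G[OF g]])
      also have "\<dots> = y" unfolding inv_comp[OF g] using reg_act_id y IR by blast
      finally show ?thesis .
    qed
    then have "P y = pscale (inverse (of_nat (card G))) (\<Sum>g\<in>G. y)"
      unfolding P_def by (simp only: cong: sum.cong)
    also have "\<dots> = pscale (inverse (of_nat (card G))) (pscale (of_nat (card G)) y)"
      by (simp only: seq.sum_constant_scale)
    finally have "P y = pscale (inverse (of_nat (card G))) (pscale (of_nat (card G)) y)" .
    then show ?thesis using cG by simp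
  qed
  have P_act: "P (reg_act h y) = reg_act h (P y)" if h: "h \<in> G" for h y
  proof -
    have "(\<Sum>g\<in>G. reg_act g (f (reg_act (iv g) (reg_act h y)))) = (\<Sum>g\<in>G. reg_act (h \<circ> g) (f (reg_act (iv (h \<circ> g)) (reg_act h y))))"
      by (rule sum_G_left[OF h, symmetric])
    also have "\<dots> = (\<Sum>g\<in>G. reg_act h (reg_act g (f (reg_act (iv g) y))))"
    proof (intro sum.cong refl)
      fix g assume g: "g \<in> G"
      have "reg_act (iv (h \<circ> g)) (reg_act h y) = reg_act (iv g) y"
        unfolding reg_act_comp[OF inv_G[OF comp_G[OF h g]] h, symmetric]
        unfolding iv_comp[OF h g] cancel_G(4)[OF h] ..
      then show "reg_act (h \<circ> g) (f (reg_act (iv (h \<circ> g)) (reg_act h y))) = reg_act h (reg_act g (f (reg_act (iv g) y)))"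
        by (simp only: reg_act_comp[OF h g])
    qed
    also have "\<dots> = reg_act h (\<Sum>g\<in>G. reg_act g (f (reg_act (iv g) y)))" by (simp only: reg_act_sum)
    finally show ?thesis unfolding P_def reg_act_scale by (simp only:)
  qed
  have P_add: "P (y + z) = P y + P z" for y z
    unfolding P_def by (simp add: reg_act_add f.add sum.distrib seq.scale_right_distrib)
  have P_scale: "P (pscale c y) = pscale c (P y)" for c y
    unfolding P_def by (simp add: reg_act_scale f.scale seq.scale_sum_right mult.commute)
  have P_0: "P 0 = 0" using P_scale[of 0 0] by simp
  have P_sum: "P (sum h A) = (\<Sum>a\<in>A. P (h a))" for h :: "('v \<Rightarrow> 'v) \<Rightarrow> nat \<Rightarrow>\<^sub>0 'k" and A
    by (induction A rule: infinite_finite_induct) (simp_all add: P_0 P_add)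
  let ?e = "P (Poly_Mapping.single (idx id) 1)"
  have "reg_mult y ?e = y" if y: "y \<in> I" for y
  proof -
    have yr: "y \<in> regular" using y IR by blast
    \<comment> \<open>\<open>P\<close> commutes with the left action, so it is right multiplication
      by its value at the unit.\<close>
    have "reg_mult y ?e = P (reg_mult y (Poly_Mapping.single (idx id) 1))"
      unfolding reg_mult_def P_sum P_scale by (intro sum.cong refl) (simp only: P_act)
    also have "\<dots> = y" unfolding reg_mult_unit[OF yr] by (rule P_id[OF y])
    finally show ?thesis .
  qed
  then show thesis by (rule that[OF P_I])
qed

lemma regular_independent_finite:
  assumes "seq.independent B" "B \<subseteq> regular" shows "finite (B :: (nat \<Rightarrow>\<^sub>0 'k::field) set)"
proof -
  let ?S = "(\<lambda>i. Poly_Mapping.single i (1::'k)) ` {0..<card G}"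
  have "regular \<subseteq> seq.span ?S"
  proof
    fix p :: "nat \<Rightarrow>\<^sub>0 'k" assume p: "p \<in> regular"
    have "(\<Sum>m\<in>Poly_Mapping.keys p. Poly_Mapping.single m (Poly_Mapping.lookup p m)) \<in> seq.span ?S"
    proof (rule seq.span_sum)
      fix m assume "m \<in> Poly_Mapping.keys p"
      then have "Poly_Mapping.single m 1 \<in> ?S" using p by (auto simp: regular_def)
      then have "pscale (Poly_Mapping.lookup p m) (Poly_Mapping.single m 1) \<in> seq.span ?S"
        by (intro seq.span_scale seq.span_base)
      then show "Poly_Mapping.single m (Poly_Mapping.lookup p m) \<in> seq.span ?S" by simp
    qed
    then show "p \<in> seq.span ?S" by (simp only: poly_mapping_expansion)
  qed
  then have "B \<subseteq> seq.span ?S" using assms(2) by blast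
  then show ?thesis using seq.independent_span_bound[OF _ assms(1)] by blast
qed

text \<open>Least dimension among the nonzero invariant subspaces of \<open>J\<close> suffices: a
  basis of \<open>I'\<close> extends to one of \<open>I\<close>, which cannot be longer.\<close>

lemma regular_minimal:
  assumes J: "regular_sub J" "J \<noteq> {0}"
  obtains I :: "(nat \<Rightarrow>\<^sub>0 'k::field) set" where "I \<subseteq> J" "regular_sub I" "I \<noteq> {0}"
    "\<And>I'. regular_sub I' \<Longrightarrow> I' \<subseteq> I \<Longrightarrow> I' \<noteq> {0} \<Longrightarrow> I' = I"
proof -
  let ?P = "\<lambda>n. \<exists>I. I \<subseteq> J \<and> regular_sub I \<and> I \<noteq> {0} \<and> seq.dim I = n"
  have "?P (seq.dim J)" using J by blast
  then have "?P (LEAST n. ?P n)" by (rule LeastI)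
  then obtain I where I: "I \<subseteq> J" "regular_sub I" "I \<noteq> {0}" "seq.dim I = (LEAST n. ?P n)" by blast
  show thesis
  proof (rule that[OF I(1-3)])
    fix I' assume I': "regular_sub I'" "I' \<subseteq> I" "I' \<noteq> {0}"
    have "?P (seq.dim I')" using I' I(1) by blast
    then have le: "seq.dim I \<le> seq.dim I'" unfolding I(4) by (rule Least_le)
    obtain B where B: "B \<subseteq> I'" "seq.independent B" "I' \<subseteq> seq.span B" "card B = seq.dim I'"
      using seq.basis_exists by blast
    obtain C where C: "B \<subseteq> C" "C \<subseteq> I" "seq.independent C" "I \<subseteq> seq.span C"
      using seq.maximal_independent_subset_extend[of B I] B I'(2) by blast
    have "finite C" using regular_independent_finite[OF C(3)] C(2) I(2) by (auto simp: regular_sub_def)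
    moreover have "card C = seq.dim I" using seq.basis_card_eq_dim[OF C(2,4,3)] by simp
    ultimately have "B = C" using C(1) le B(4) card_seteq[of C B] by simp
    moreover have "seq.span B \<subseteq> I'" using seq.span_minimal[OF B(1)] I'(1) by (simp add: regular_sub_def)
    ultimately show "I' = I" using C(4) I'(2) by blast
  qed
qed

end

text \<open>With fewer matrix entries than group elements, some nonzero element of the group algebra
  acts as zero in every irreducible representation. The ideal \<open>J\<close> of such elements
  contains an irreducible \<open>I\<close>, a copy of some \<open>W i\<close>, so \<open>J\<close>
  annihilates \<open>I\<close>; but an element of \<open>I\<close> acts as a right unit on
  \<open>I\<close>.\<close>

lemma sum_of_squares:
  fixes sW :: "'k::field \<Rightarrow> 'w::ab_group_add \<Rightarrow> 'w" and n :: nat and G :: "('v \<Rightarrow> 'v) set"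
  assumes cr: "\<And>i. i \<le> n \<Longrightarrow> coordinate_representation G sW (W i) (\<rho> i) (r i) (e i) (co i)"
    and complete: "complete_irreducibles G sW n W \<rho>" and cG: "of_nat (card G) \<noteq> (0::'k)"
  shows "card G \<le> (\<Sum>i\<le>n. r i * r i)"
proof (rule ccontr)
  assume less: "\<not> card G \<le> (\<Sum>i\<le>n. r i * r i)"
  interpret finite_map_group G using cr[of 0] by (simp add: coordinate_representation_def)
  define D where "D i = coordinate_representation.D (\<rho> i) (e i) (co i)" for i
  let ?Y = "SIGMA i:{..n}. {..<r i} \<times> {..<r i}"
  have "\<exists>s. (\<exists>g\<in>G. s g \<noteq> 0) \<and> (\<forall>y\<in>?Y. (\<Sum>g\<in>G. s g * D (fst y) g (fst (snd y)) (snd (snd y))) = 0)"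
    by (rule linear_relation_UNIV) (use fin_G less in auto)
  then obtain s g0 where g0: "g0 \<in> G" "s g0 \<noteq> 0"
    and s: "\<And>i j k. i \<le> n \<Longrightarrow> j < r i \<Longrightarrow> k < r i \<Longrightarrow> (\<Sum>g\<in>G. s g * D i g j k) = 0" by force
  \<comment> \<open>The common kernel, in the group algebra, of all the matrix
    representations.\<close>
  define J where "J = {y \<in> regular. \<forall>i\<le>n. \<forall>j<r i. \<forall>k<r i. (\<Sum>g\<in>G. Poly_Mapping.lookup y (idx g) * D i g j k) = 0}"
  have mrep: "mrep (r i) (D i)" if "i \<le> n" for i
    unfolding D_def by (rule coordinate_representation.mrep_D[OF cr[OF that]])
  have J: "regular_sub J"
    unfolding regular_sub_def
  proof (intro conjI ballI)
    show "seq.subspace J" unfolding seq.subspace_def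
    proof (intro conjI allI ballI)
      fix x y :: "nat \<Rightarrow>\<^sub>0 'k" and c :: 'k assume x: "x \<in> J"
      { assume "y \<in> J" then show "x + y \<in> J" using x seq.subspace_add[OF regular_subspace, of x y]
          by (simp add: J_def lookup_add distrib_right sum.distrib) }
      show "pscale c x \<in> J" using x seq.subspace_scale[OF regular_subspace, of x c]
        by (simp add: J_def lookup_pscale mult.assoc flip: sum_distrib_left)
    qed (simp add: J_def regular_def)
    show "J \<subseteq> regular" by (auto simp: J_def)
    fix h y assume h: "h \<in> G" and y: "y \<in> J"
    have "(\<Sum>g\<in>G. Poly_Mapping.lookup (reg_act h y) (idx g) * D i g j k) = 0" if ijk: "i \<le> n" "j < r i" "k < r i" for i j k
    proof -
      have "(\<Sum>g\<in>G. Poly_Mapping.lookup (reg_act h y) (idx g) * D i g j k)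
          = (\<Sum>g\<in>G. Poly_Mapping.lookup (reg_act h y) (idx (h \<circ> g)) * D i (h \<circ> g) j k)"
        by (rule sum_G_left[OF h, symmetric])
      also have "\<dots> = (\<Sum>g\<in>G. Poly_Mapping.lookup y (idx g) * (\<Sum>l<r i. D i h j l * D i g l k))"
      proof (intro sum.cong refl)
        fix g assume g: "g \<in> G"
        show "Poly_Mapping.lookup (reg_act h y) (idx (h \<circ> g)) * D i (h \<circ> g) j k = Poly_Mapping.lookup y (idx g) * (\<Sum>l<r i. D i h j l * D i g l k)"
          unfolding lookup_reg_act[OF h comp_G[OF h g]] cancel_G(1)[OF h] mrep_comp[OF mrep[OF ijk(1)] h g ijk(2,3)] ..
      qed
      also have "\<dots> = (\<Sum>l<r i. D i h j l * (\<Sum>g\<in>G. Poly_Mapping.lookup y (idx g) * D i g l k))"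
        unfolding sum_distrib_left by (subst sum.swap) (simp only: mult.left_commute)
      also have "\<dots> = 0" using y ijk by (simp add: J_def)
      finally show ?thesis .
    qed
    then show "reg_act h y \<in> J" using reg_act_regular[OF h] by (simp add: J_def)
  qed
  define x where "x = (\<Sum>g\<in>G. Poly_Mapping.single (idx g) (s g))"
  have lx: "Poly_Mapping.lookup x (idx h) = s h" if h: "h \<in> G" for h
  proof -
    have "Poly_Mapping.lookup x (idx h) = (\<Sum>g\<in>G. if g = h then s h else 0)"
      unfolding x_def lookup_sum by (intro sum.cong refl) (auto simp: lookup_single when_def idx_inj h)
    then show ?thesis using h fin_G by simp
  qed
  have "x \<in> regular" unfolding x_def by (intro seq.subspace_sum[OF regular_subspace] single_regular)
  then have "x \<in> J" using s by (simp add: J_def lx)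
  moreover have "x \<noteq> 0" using lx[OF g0(1)] g0(2) by auto
  ultimately have "J \<noteq> {0}" by blast
  obtain I where I: "I \<subseteq> J" "regular_sub I" "I \<noteq> {0}" and min: "\<And>I'. regular_sub I' \<Longrightarrow> I' \<subseteq> I \<Longrightarrow> I' \<noteq> {0} \<Longrightarrow> I' = I"
    by (rule regular_minimal[OF J \<open>J \<noteq> {0}\<close>]) blast
  have IR: "I \<subseteq> regular" using I(2) by (simp add: regular_sub_def)
  have "irreducible_representation pscale G I reg_act"
    unfolding irreducible_representation_def
  proof (intro conjI allI impI)
    show "Defs.representation pscale G I reg_act"
      unfolding Defs.representation_def using I(2) IR
      by (auto simp: regular_sub_def reg_act_add reg_act_scale reg_act_comp intro: reg_act_id)
    show "I \<noteq> {0}" by (rule I(3))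
    fix U' assume U': "seq.subspace U' \<and> U' \<subseteq> I \<and> (\<forall>g\<in>G. \<forall>u\<in>U'. reg_act g u \<in> U')"
    then have "regular_sub U'" using IR by (auto simp: regular_sub_def)
    then show "U' = {0} \<or> U' = I" using min U' by blast
  qed
  then obtain i where i: "i \<le> n" "isomorphic_representations G sW (W i) (\<rho> i) pscale I reg_act"
    using complete unfolding complete_irreducibles_def by blast
  then obtain \<phi> where bij: "bij_betw \<phi> (W i) I" and \<phi>_add: "\<And>x y. x \<in> W i \<Longrightarrow> y \<in> W i \<Longrightarrow> \<phi> (x + y) = \<phi> x + \<phi> y"
    and \<phi>_scale: "\<And>c x. x \<in> W i \<Longrightarrow> \<phi> (sW c x) = pscale c (\<phi> x)"
    and \<phi>_act: "\<And>g x. g \<in> G \<Longrightarrow> x \<in> W i \<Longrightarrow> \<phi> (\<rho> i g x) = reg_act g (\<phi> x)"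
    unfolding isomorphic_representations_def by blast
  interpret c: coordinate_representation G sW "W i" "\<rho> i" "r i" "e i" "co i" by (rule cr[OF i(1)])
  have \<phi>_0: "\<phi> 0 = 0" using \<phi>_scale[OF c.U_0, of 0] by simp
  have kill: "reg_mult y z = 0" if y: "y \<in> J" and z: "z \<in> I" for y z
  proof -
    obtain w where w: "w \<in> W i" "z = \<phi> w" using bij z by (auto simp: bij_betw_def)
    have \<phi>_sum: "\<phi> (\<Sum>g\<in>A. sW (f g) (\<rho> i g w)) = (\<Sum>g\<in>A. pscale (f g) (reg_act g z))" if "A \<subseteq> G" for f A
      using finite_subset[OF that fin_G] that
    proof (induction A rule: finite_induct)
      case (insert g A)
      have "(\<Sum>g\<in>A. sW (f g) (\<rho> i g w)) \<in> W i" using insert.prems w by (intro c.U_sum c.U_scale c.rho_U) auto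
      then show ?case using insert w by (simp add: \<phi>_add \<phi>_scale \<phi>_act c.U_scale c.rho_U)
    qed (simp add: \<phi>_0)
    have "(\<Sum>g\<in>G. sW (Poly_Mapping.lookup y (idx g)) (\<rho> i g w)) = 0"
    proof (rule c.co_eqI[OF _ c.U_0])
      show "(\<Sum>g\<in>G. sW (Poly_Mapping.lookup y (idx g)) (\<rho> i g w)) \<in> W i"
        using w by (intro c.U_sum c.U_scale c.rho_U)
      fix j assume j: "j < r i"
      have "co i (\<Sum>g\<in>G. sW (Poly_Mapping.lookup y (idx g)) (\<rho> i g w)) j
          = (\<Sum>g\<in>G. Poly_Mapping.lookup y (idx g) * (\<Sum>k<r i. D i g j k * co i w k))"
        by (subst c.co_sum) (simp_all add: c.U_scale c.rho_U w c.co_scale c.co_rho D_def)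
      also have "\<dots> = (\<Sum>k<r i. (\<Sum>g\<in>G. Poly_Mapping.lookup y (idx g) * D i g j k) * co i w k)"
        unfolding sum_distrib_left sum_distrib_right by (subst sum.swap) (simp only: mult.assoc)
      also have "\<dots> = 0" using y i(1) j by (simp add: J_def)
      finally show "co i (\<Sum>g\<in>G. sW (Poly_Mapping.lookup y (idx g)) (\<rho> i g w)) j = co i 0 j" by (simp add: c.co_0)
    qed
    then show ?thesis using \<phi>_sum[of G "\<lambda>g. Poly_Mapping.lookup y (idx g)"] by (simp add: reg_mult_def \<phi>_0)
  qed
  \<comment> \<open>\<open>y * u\<close> equals \<open>y\<close> for \<open>y\<close> in
    \<open>I\<close> by the choice of \<open>u\<close>, and equals zero because \<open>y\<close>
    lies in \<open>J\<close> and \<open>u\<close> in \<open>I\<close>.\<close>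
  obtain u where u: "u \<in> I" "\<And>y. y \<in> I \<Longrightarrow> reg_mult y u = y" by (rule regular_idempotent[OF I(2) cG]) blast
  have "y = 0" if "y \<in> I" for y using kill[of y u] u that I(1) by auto
  moreover have "0 \<in> I" using I(2) seq.subspace_0 by (auto simp: regular_sub_def)
  ultimately show False using I(3) by blast
qed

section \<open>The symmetric algebra as a polynomial ring\<close>

lemma free_algebra_simps [simp]:
  "carrier free_algebra = UNIV" "x \<otimes>\<^bsub>free_algebra\<^esub> y = x * y" "x \<oplus>\<^bsub>free_algebra\<^esub> y = x + y"
  "\<one>\<^bsub>free_algebra\<^esub> = 1" "\<zero>\<^bsub>free_algebra\<^esub> = 0"
  by (simp_all add: free_algebra_def)

lemma ring_free_algebra: "ring free_algebra"
proof (intro ringI abelian_groupI monoidI)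
  fix x :: "('x \<Rightarrow>\<^sub>0 nat) \<Rightarrow>\<^sub>0 'k::field"
  show "\<exists>y\<in>carrier free_algebra. y \<oplus>\<^bsub>free_algebra\<^esub> x = \<zero>\<^bsub>free_algebra\<^esub>"
    by (rule bexI[of _ "- x"]) simp_all
qed (simp_all add: algebra_simps)

context linear_coordinates begin

abbreviation "I \<equiv> sym_ideal sV"

lemma ideal_I: "ideal I free_algebra"
  unfolding sym_ideal_def by (rule ring.genideal_ideal[OF ring_free_algebra]) simp

lemma subgroup_I: "subgroup I (add_monoid free_algebra)"
  using ideal_I by (simp add: ideal_def additive_subgroup_def)

lemma I_0: "0 \<in> I" using subgroup.one_closed[OF subgroup_I] by simp
lemma I_add: "x \<in> I \<Longrightarrow> y \<in> I \<Longrightarrow> x + y \<in> I" using subgroup.m_closed[OF subgroup_I] by simp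
lemma I_mult: "x \<in> I \<Longrightarrow> y * x \<in> I" using ideal.I_l_closed[OF ideal_I] by simp
lemma I_mult_right: "x \<in> I \<Longrightarrow> x * y \<in> I" using ideal.I_r_closed[OF ideal_I] by simp
lemma I_generators: "sym_var (v + w) - sym_var v - sym_var w \<in> I" "sym_var (sV c v) - sym_const c * sym_var v \<in> I"
  using ring.genideal_self[OF ring_free_algebra] unfolding sym_ideal_def by fastforce+

lemma theta_I: assumes "p \<in> I" shows "theta p = 0"
proof -
  have "I \<subseteq> {p. theta p = 0}"
    unfolding sym_ideal_def
  proof (rule ring.genideal_minimal[OF ring_free_algebra])
    show "ideal {p. theta p = 0} free_algebra"
    proof (rule idealI[OF ring_free_algebra])
      show "subgroup {p. theta p = 0} (add_monoid free_algebra)"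
      proof (rule group.subgroupI)
        show "group (add_monoid free_algebra)"
          by (rule abelian_group.a_group[OF ring.is_abelian_group[OF ring_free_algebra]])
        fix p :: "('v \<Rightarrow>\<^sub>0 nat) \<Rightarrow>\<^sub>0 'k" assume p: "p \<in> {p. theta p = 0}"
        have "inv\<^bsub>add_monoid free_algebra\<^esub> p = - p"
          by (rule group.inv_equality[OF abelian_group.a_group[OF ring.is_abelian_group[OF ring_free_algebra]]]) simp_all
        then show "inv\<^bsub>add_monoid free_algebra\<^esub> p \<in> {p. theta p = 0}"
          using p by (simp add: hom_uminus algebra_homs)
      qed (auto simp: hom_add hom_0 algebra_homs intro: exI[of _ 0])
    qed (auto simp: hom_mult algebra_homs)
  next
    show "{sym_var (v + w) - sym_var v - sym_var w |v w. True} \<union> {sym_var (sV c v) - sym_const c * sym_var v |c v. True}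
        \<subseteq> {p. theta p = 0}"
      by (auto simp: hom_diff hom_mult algebra_homs theta_var theta_const io_add io_scale)
  qed
  then show ?thesis using assms by blast
qed

lemma sym_var_combination:
  "sym_var (\<Sum>j\<in>A. sV (c j) (b j)) - (\<Sum>j\<in>A. sym_const (c j) * sym_var (b j)) \<in> I"
proof (induction A rule: infinite_finite_induct)
  case (insert x A)
  let ?s = "\<Sum>j\<in>A. sV (c j) (b j)" and ?t = "\<Sum>j\<in>A. sym_const (c j) * sym_var (b j)"
  have "(sym_var (sV (c x) (b x) + ?s) - sym_var (sV (c x) (b x)) - sym_var ?s)
      + (sym_var (sV (c x) (b x)) - sym_const (c x) * sym_var (b x)) + (sym_var ?s - ?t) \<in> I"
    by (intro I_add I_generators insert.IH)
  then show ?case using insert.hyps by (simp add: algebra_simps)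
qed (use I_generators(2)[of 0 0] in \<open>simp_all add: sym_const_def\<close>)

text \<open>Modulo the relations every polynomial in vectors becomes one in the basis vectors. This
  bounds the kernel of \<open>theta\<close> by the ideal, the inclusion opposite to
  \<open>theta_I\<close>.\<close>

lemma eta_theta: "p - eta (theta p) \<in> I"
proof (induction p rule: polynomial_induct)
  case (const c)
  show ?case by (simp add: theta_const eta_const I_0)
next
  case (var v)
  have "eta (theta (sym_var v)) = (\<Sum>j<d. sym_const (cd v j) * sym_var (b j))"
    by (simp add: theta_var io_def hom_sum hom_mult algebra_homs eta_const eta_var)
  then show ?case using sym_var_combination[where A = "{..<d}" and c = "cd v"] by (simp add: cd_expansion)
next
  case (add p q)
  have "(p - eta (theta p)) + (q - eta (theta q)) \<in> I" using add by (rule I_add)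
  then show ?case by (simp add: hom_add algebra_homs algebra_simps)
next
  case (mult p q)
  have "(p - eta (theta p)) * q + eta (theta p) * (q - eta (theta q)) \<in> I" using mult by (intro I_add I_mult I_mult_right)
  then show ?case by (simp add: hom_mult algebra_homs algebra_simps)
qed

lemma I_iff: "p \<in> I \<longleftrightarrow> theta p = 0"
  using theta_I eta_theta[of p] by (auto simp: hom_0 algebra_homs)

text \<open>The element of \<open>Sym(V)\<close> belonging to a polynomial, as a fibre of
  \<open>theta\<close>; the fibre is empty outside \<open>PS\<close>. \<open>uncls\<close> evaluates
  \<open>theta\<close> at an arbitrary member of a coset.\<close>

definition cls :: "'k mpoly \<Rightarrow> ('k, 'v) sym" where "cls s = theta -` {s}"
definition uncls :: "('k, 'v) sym \<Rightarrow> 'k mpoly" where "uncls c = theta (SOME p. p \<in> c)"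

lemma coset_I: "I +>\<^bsub>free_algebra\<^esub> p = cls (theta p)"
proof -
  have "I +>\<^bsub>free_algebra\<^esub> p = {a + p |a. a \<in> I}" by (auto simp: a_r_coset_def r_coset_def)
  also have "\<dots> = cls (theta p)"
  proof (intro equalityI subsetI)
    fix x assume "x \<in> cls (theta p)"
    then have "x - p \<in> I" by (simp add: I_iff cls_def hom_diff algebra_homs)
    then show "x \<in> {a + p |a. a \<in> I}" by (intro CollectI exI[of _ "x - p"]) simp
  qed (auto simp: cls_def hom_add algebra_homs I_iff)
  finally show ?thesis .
qed

lemma uncls_cls: assumes "s \<in> PS" shows "uncls (cls s) = s"
proof -
  have "eta s \<in> cls s" using theta_eta[OF assms] by (simp add: cls_def)
  then have "(SOME p. p \<in> cls s) \<in> cls s" by (rule someI)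
  then show ?thesis by (simp add: uncls_def cls_def)
qed

lemma carrier_Sym: "carrier (Sym sV) = cls ` PS"
  unfolding Sym_def FactRing_def A_RCOSETS_def'
  using PS_theta by (auto simp: coset_I image_iff) (metis theta_eta)

lemma cls_Sym: "s \<in> PS \<Longrightarrow> cls s \<in> carrier (Sym sV)" by (simp add: carrier_Sym)
lemma uncls_PS: "c \<in> carrier (Sym sV) \<Longrightarrow> uncls c \<in> PS" by (auto simp: carrier_Sym uncls_cls)
lemma cls_uncls: "c \<in> carrier (Sym sV) \<Longrightarrow> cls (uncls c) = c" by (auto simp: carrier_Sym uncls_cls)

lemma cls_coset: "s \<in> PS \<Longrightarrow> cls s = I +>\<^bsub>free_algebra\<^esub> eta s" by (simp add: coset_I theta_eta)

lemma Sym_mult: assumes "s \<in> PS" "t \<in> PS" shows "cls s \<otimes>\<^bsub>Sym sV\<^esub> cls t = cls (s * t)"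
proof -
  have "cls s \<otimes>\<^bsub>Sym sV\<^esub> cls t = I +>\<^bsub>free_algebra\<^esub> (eta s \<otimes>\<^bsub>free_algebra\<^esub> eta t)"
    unfolding cls_coset[OF assms(1)] cls_coset[OF assms(2)] Sym_def FactRing_def
    using ideal.rcoset_mult_add[OF ideal_I, of "eta s" "eta t"] by simp
  then show ?thesis by (simp add: coset_I hom_mult algebra_homs theta_eta assms)
qed

lemma Sym_add: assumes "s \<in> PS" "t \<in> PS" shows "cls s \<oplus>\<^bsub>Sym sV\<^esub> cls t = cls (s + t)"
proof -
  have "cls s \<oplus>\<^bsub>Sym sV\<^esub> cls t = I +>\<^bsub>free_algebra\<^esub> (eta s \<oplus>\<^bsub>free_algebra\<^esub> eta t)"
    unfolding cls_coset[OF assms(1)] cls_coset[OF assms(2)] Sym_def FactRing_def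
    using abelian_subgroup.a_rcos_sum[OF abelian_subgroupI3[OF ideal.axioms(1)[OF ideal_I] ring.is_abelian_group[OF ring_free_algebra]], of "eta s" "eta t"]
    by (simp add: ideal_I)
  then show ?thesis by (simp add: coset_I hom_add algebra_homs theta_eta assms)
qed

lemma Sym_one: "\<one>\<^bsub>Sym sV\<^esub> = cls 1"
  using coset_I[of 1] poly_eval_1[OF C(1), of io] by (simp add: Sym_def FactRing_def theta_def)

lemma Sym_zero: "\<zero>\<^bsub>Sym sV\<^esub> = cls 0"
  unfolding Sym_def FactRing_def by (auto simp: cls_def I_iff)

lemma Sym_const_cls: "Sym_const sV c = cls (sym_const c)"
  by (simp add: Sym_const_def coset_I theta_const)

lemma Sym_act_cls:
  assumes "Vector_Spaces.linear sV sV g" "s \<in> PS" shows "Sym_act sV g (cls s) = cls (actP g s)"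
proof -
  have "Sym_act sV g (cls s) = (\<Union>p\<in>cls s. cls (actP g s))"
    unfolding Sym_act_def coset_I theta_rename[OF assms(1)] by (rule SUP_cong) (auto simp: cls_def)
  moreover have "cls s \<noteq> {}" using theta_eta[OF assms(2)] by (auto simp: cls_def)
  ultimately show ?thesis by simp
qed

definition invariants :: "('v \<Rightarrow> 'v) set \<Rightarrow> 'k mpoly set" where
  "invariants G = {s \<in> PS. \<forall>g\<in>G. actP g s = s}"

lemma cls_inject: "s \<in> PS \<Longrightarrow> t \<in> PS \<Longrightarrow> cls s = cls t \<longleftrightarrow> s = t"
  using uncls_cls by metis

lemma carrier_invariant_ring:
  assumes "\<And>g. g \<in> G \<Longrightarrow> Vector_Spaces.linear sV sV g"
  shows "carrier (invariant_ring sV G) = cls ` invariants G"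
proof -
  have "Sym_act sV g (cls s) = cls s \<longleftrightarrow> actP g s = s" if "g \<in> G" "s \<in> PS" for g s
    using Sym_act_cls[OF assms[OF that(1)] that(2)] PS_actP[OF assms[OF that(1)] that(2)] that(2) by (simp add: cls_inject)
  then show ?thesis unfolding invariant_ring_def carrier_Sym invariants_def by auto
qed

lemma invariant_ring_ops:
  "x \<otimes>\<^bsub>invariant_ring sV G\<^esub> y = x \<otimes>\<^bsub>Sym sV\<^esub> y" "x \<oplus>\<^bsub>invariant_ring sV G\<^esub> y = x \<oplus>\<^bsub>Sym sV\<^esub> y"
  "\<one>\<^bsub>invariant_ring sV G\<^esub> = cls 1" "\<zero>\<^bsub>invariant_ring sV G\<^esub> = cls 0"
  by (simp_all add: invariant_ring_def Sym_one Sym_zero)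

lemma PS_power: "s \<in> PS \<Longrightarrow> s ^ n \<in> PS"
  by (induction n) (simp_all add: PS_1 PS_mult)

lemma invariant_ring_pow: assumes "s \<in> PS" shows "cls s [^]\<^bsub>invariant_ring sV G\<^esub> (n::nat) = cls (s ^ n)"
  by (induction n) (simp_all add: invariant_ring_ops Sym_mult PS_power assms mult.commute)

end

section \<open>The modules of covariants in coordinates\<close>

locale tensor_coordinates = linear_coordinates sV d b cd + W: coordinate_representation G sW U \<rho> r e co
  for sV :: "'k::field \<Rightarrow> 'v::ab_group_add \<Rightarrow> 'v" and d b cd
    and G :: "('v \<Rightarrow> 'v) set" and sW :: "'k \<Rightarrow> 'w::ab_group_add \<Rightarrow> 'w" and U \<rho> r e co +
  assumes G_linear: "g \<in> G \<Longrightarrow> Vector_Spaces.linear sV sV g"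
begin

abbreviation "F \<equiv> tensor_free sV U"
abbreviation "Q \<equiv> tensor_relations sV sW U"

text \<open>The \<open>j\<close>-th coordinate of a tensor,
  \<open>s \<otimes> w \<mapsto> co w j * s\<close>, defined on formal sums before passing to the
  quotient. Cosets are then compared by comparing polynomials.\<close>

definition tau :: "nat \<Rightarrow> (('k, 'v) sym \<times> 'w \<Rightarrow>\<^sub>0 int) \<Rightarrow> 'k mpoly" where
  "tau j = additive_extension (\<lambda>(s, w) n. of_int n * (sym_const (co w j) * uncls s))"

lemma tau_F: "(\<lambda>(s, w) n. of_int n * (sym_const (co w j) * uncls s)) m 0 = (0 :: 'k mpoly)"
  "(\<lambda>(s, w) n. of_int n * (sym_const (co w j) * uncls s)) m (a + c) =
   (\<lambda>(s, w) n. of_int n * (sym_const (co w j) * uncls s)) m a + ((\<lambda>(s, w) n. of_int n * (sym_const (co w j) * uncls s)) m c :: 'k mpoly)"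
  by (auto simp: case_prod_beta distrib_right)

lemma tau_add: "tau j (x + y) = tau j x + tau j y"
  unfolding tau_def by (rule additive_extension_add) (rule tau_F)+
lemma tau_0: "tau j 0 = 0"
  unfolding tau_def by (rule additive_extension_0) (rule tau_F)+
lemma tau_frag_of: "tau j (frag_of (s, w)) = sym_const (co w j) * uncls s"
proof -
  have "tau j (frag_of (s, w)) = (\<lambda>(s, w) n. of_int n * (sym_const (co w j) * uncls s)) (s, w) 1"
    unfolding tau_def by (rule additive_extension_single) (rule tau_F)+
  then show ?thesis by simp
qed
lemma tau_uminus: "tau j (- x) = - tau j x"
  using tau_add[of j x "- x"] by (simp add: tau_0 minus_unique)
lemma tau_diff: "tau j (x - y) = tau j x - tau j y"
  using tau_add[of j x "- y"] by (simp add: tau_uminus)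
lemma tau_sum: "tau j (sum f A) = (\<Sum>a\<in>A. tau j (f a))"
  by (induction A rule: infinite_finite_induct) (simp_all add: tau_0 tau_add)

lemma F_ops [simp]: "x \<otimes>\<^bsub>F\<^esub> y = x + y" "\<one>\<^bsub>F\<^esub> = 0"
  by (simp_all add: tensor_free_def)
lemma carrier_F: "x \<in> carrier F \<longleftrightarrow> Poly_Mapping.keys x \<subseteq> carrier (Sym sV) \<times> U"
  by (simp add: tensor_free_def)
lemma comm_group_F: "comm_group F" by (simp add: tensor_free_def abelian_free_Abelian_group)
lemma group_F: "group F" by (simp add: tensor_free_def)
lemma F_inv: "x \<in> carrier F \<Longrightarrow> inv\<^bsub>F\<^esub> x = - x" by (simp add: tensor_free_def)
lemma F_frag: "s \<in> carrier (Sym sV) \<Longrightarrow> w \<in> U \<Longrightarrow> frag_of (s, w) \<in> carrier F"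
  by (simp add: carrier_F)
lemma F_0: "0 \<in> carrier F" by (simp add: carrier_F)
lemma F_add: "x \<in> carrier F \<Longrightarrow> y \<in> carrier F \<Longrightarrow> x + y \<in> carrier F"
  using group.is_monoid[OF group_F] monoid.m_closed[of F x y] by simp
lemma F_uminus: "x \<in> carrier F \<Longrightarrow> - x \<in> carrier F" by (simp add: carrier_F)
lemma F_diff: "x \<in> carrier F \<Longrightarrow> y \<in> carrier F \<Longrightarrow> x - y \<in> carrier F"
  using F_add[OF _ F_uminus] by fastforce
lemma F_sum: "(\<And>a. a \<in> A \<Longrightarrow> f a \<in> carrier F) \<Longrightarrow> sum f A \<in> carrier F"
  by (induction A rule: infinite_finite_induct) (simp_all add: F_0 F_add)

text \<open>The generating set inside \<open>tensor_relations\<close>, named to support induction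
  over the generated subgroup.\<close>

definition gens :: "(('k, 'v) sym \<times> 'w \<Rightarrow>\<^sub>0 int) set" where
  "gens = {frag_of (s \<oplus>\<^bsub>Sym sV\<^esub> t, w) - frag_of (s, w) - frag_of (t, w) | s t w.
         s \<in> carrier (Sym sV) \<and> t \<in> carrier (Sym sV) \<and> w \<in> U} \<union>
      {frag_of (s, w + x) - frag_of (s, w) - frag_of (s, x) | s w x.
         s \<in> carrier (Sym sV) \<and> w \<in> U \<and> x \<in> U} \<union>
      {frag_of (Sym_const sV c \<otimes>\<^bsub>Sym sV\<^esub> s, w) - frag_of (s, sW c w) | c s w.
         s \<in> carrier (Sym sV) \<and> w \<in> U}"

lemma Q_gens: "Q = generate F gens"
  by (simp add: tensor_relations_def gens_def)

lemma Sym_add_closed: "s \<in> carrier (Sym sV) \<Longrightarrow> t \<in> carrier (Sym sV) \<Longrightarrow> s \<oplus>\<^bsub>Sym sV\<^esub> t \<in> carrier (Sym sV)"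
  by (auto simp: carrier_Sym Sym_add PS_add)
lemma Sym_scale_closed: "s \<in> carrier (Sym sV) \<Longrightarrow> Sym_const sV c \<otimes>\<^bsub>Sym sV\<^esub> s \<in> carrier (Sym sV)"
  by (auto simp: carrier_Sym Sym_const_cls Sym_mult PS_mult PS_const)

lemma gens_F: "gens \<subseteq> carrier F"
  unfolding gens_def by (auto intro!: F_diff F_frag Sym_add_closed Sym_scale_closed W.U_add W.U_scale)

lemma subgroup_Q: "subgroup Q F"
  unfolding Q_gens by (rule group.generate_is_subgroup[OF group_F gens_F])
lemma Q_0: "0 \<in> Q" using subgroup.one_closed[OF subgroup_Q] by simp
lemma Q_add: "x \<in> Q \<Longrightarrow> y \<in> Q \<Longrightarrow> x + y \<in> Q" using subgroup.m_closed[OF subgroup_Q] by simp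
lemma Q_F: "x \<in> Q \<Longrightarrow> x \<in> carrier F" using subgroup.subset[OF subgroup_Q] by blast
lemma Q_uminus: "x \<in> Q \<Longrightarrow> - x \<in> Q" using subgroup.m_inv_closed[OF subgroup_Q] F_inv Q_F by metis
lemma Q_diff: "x \<in> Q \<Longrightarrow> y \<in> Q \<Longrightarrow> x - y \<in> Q" using Q_add[OF _ Q_uminus] by fastforce
lemma Q_incl: "x \<in> gens \<Longrightarrow> x \<in> Q" unfolding Q_gens by (rule generate.incl)

lemma Q_add_left: assumes "s \<in> PS" "t \<in> PS" "w \<in> U"
  shows "frag_of (cls (s + t), w) - frag_of (cls s, w) - frag_of (cls t, w) \<in> Q"
  by (rule Q_incl, unfold gens_def Sym_add[OF assms(1,2), symmetric]) (use assms cls_Sym in blast)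
lemma Q_add_right: assumes "s \<in> PS" "w \<in> U" "x \<in> U"
  shows "frag_of (cls s, w + x) - frag_of (cls s, w) - frag_of (cls s, x) \<in> Q"
  by (rule Q_incl, unfold gens_def) (use assms cls_Sym in blast)
lemma Q_scale: assumes "s \<in> PS" "w \<in> U" shows "frag_of (cls (sym_const c * s), w) - frag_of (cls s, sW c w) \<in> Q"
proof (rule Q_incl)
  have "cls (sym_const c * s) = Sym_const sV c \<otimes>\<^bsub>Sym sV\<^esub> cls s"
    by (simp add: Sym_const_cls Sym_mult PS_const assms)
  then show "frag_of (cls (sym_const c * s), w) - frag_of (cls s, sW c w) \<in> gens"
    unfolding gens_def using cls_Sym[OF assms(1)] assms(2) by auto
qed

lemma tau_gens: "x \<in> gens \<Longrightarrow> tau j x = 0"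
  unfolding gens_def
  by (auto simp: tau_diff tau_frag_of carrier_Sym Sym_add Sym_mult Sym_const_cls uncls_cls PS_add PS_mult PS_const
      W.co_add W.co_scale const_hom distrib_left distrib_right mult_ac)

lemma tau_Q: "x \<in> Q \<Longrightarrow> tau j x = 0"
  unfolding Q_gens
proof (induction rule: generate.induct)
  case one show ?case by (simp add: tau_0)
next
  case (incl h) then show ?case by (rule tau_gens)
next
  case (inv h)
  then have "inv\<^bsub>F\<^esub> h = - h" using gens_F F_inv by blast
  then show ?case using tau_gens[OF inv] by (simp add: tau_uminus)
next
  case (eng h1 h2) then show ?case by (simp add: tau_add)
qed

lemma tau_PS: assumes "x \<in> carrier F" shows "tau j x \<in> PS"
  using assms unfolding carrier_F
proof (induction x rule: frag_induction)
  case zero show ?case by (simp add: tau_0 PS_0)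
next
  case (one x)
  then show ?case by (cases x) (auto simp: tau_frag_of intro!: PS_mult PS_const uncls_PS)
next
  case (diff x y) then show ?case using PS_add[OF _ PS_uminus] by (fastforce simp: tau_diff)
qed

definition Sr :: "(nat \<Rightarrow> 'k mpoly) set" where
  "Sr = {m. (\<forall>j<r. m j \<in> PS) \<and> (\<forall>j\<ge>r. m j = 0)}"

definition std :: "(nat \<Rightarrow> 'k mpoly) \<Rightarrow> ('k, 'v) sym \<times> 'w \<Rightarrow>\<^sub>0 int" where
  "std m = (\<Sum>j<r. frag_of (cls (m j), e j))"

lemma std_F: "m \<in> Sr \<Longrightarrow> std m \<in> carrier F"
  unfolding std_def by (intro F_sum F_frag cls_Sym W.e_U) (auto simp: Sr_def)

lemma tau_std: assumes "m \<in> Sr" "j < r" shows "tau j (std m) = m j"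
proof -
  have "tau j (std m) = (\<Sum>i<r. if i = j then m j else 0)"
    unfolding std_def tau_sum
    by (intro sum.cong refl) (use assms in \<open>auto simp: tau_frag_of W.co_e uncls_cls const_hom Sr_def\<close>)
  then show ?thesis using assms(2) by simp
qed

lemma Q_zero_left: "w \<in> U \<Longrightarrow> frag_of (cls 0, w) \<in> Q"
  using Q_uminus[OF Q_add_left[OF PS_0 PS_0, of w]] by simp
lemma Q_zero_right: "s \<in> PS \<Longrightarrow> frag_of (cls s, 0) \<in> Q"
  using Q_uminus[OF Q_add_right[OF _ W.U_0 W.U_0, of s]] by simp

lemma Q_sum_right: "s \<in> PS \<Longrightarrow> (\<And>j. j \<in> A \<Longrightarrow> f j \<in> U) \<Longrightarrow>
    frag_of (cls s, \<Sum>j\<in>A. f j) - (\<Sum>j\<in>A. frag_of (cls s, f j)) \<in> Q"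
proof (induction A rule: infinite_finite_induct)
  case (insert x A)
  have "(frag_of (cls s, f x + sum f A) - frag_of (cls s, f x) - frag_of (cls s, sum f A))
     + (frag_of (cls s, sum f A) - (\<Sum>j\<in>A. frag_of (cls s, f j))) \<in> Q"
    using insert by (intro Q_add Q_add_right W.U_sum) auto
  then show ?case using insert.hyps by (simp add: algebra_simps)
qed (simp_all add: Q_zero_right)

text \<open>Expanding \<open>w\<close> in the basis and moving scalars across the tensor sign
  reduces every formal sum to the standard one with the same coordinates. Hence the coordinates
  determine the class.\<close>

lemma std_congruent: assumes "x \<in> carrier F" shows "x - std (\<lambda>j. tau j x) \<in> Q"
proof -
  \<comment> \<open>Membership in the carrier is carried along, so that in the step for differences
    the coordinates of both parts are known to lie in \<open>PS\<close>.\<close>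
  have "x \<in> carrier F \<and> x - std (\<lambda>j. tau j x) \<in> Q"
  using assms unfolding carrier_F[of x]
proof (induction x rule: frag_induction)
  case zero
  have "std (\<lambda>j. 0) \<in> Q" unfolding std_def
    using W.e_U by (induction r) (auto intro: Q_0 Q_add Q_zero_left)
  then show ?case using Q_uminus[of "std (\<lambda>j. 0)"] by (simp add: tau_0 F_0)
next
  case (one x)
  then obtain c w where x: "x = (c, w)" "c \<in> carrier (Sym sV)" "w \<in> U" by (cases x) auto
  define s where "s = uncls c"
  have s: "s \<in> PS" "c = cls s" using x uncls_PS cls_uncls by (auto simp: s_def)
  have "frag_of (cls s, \<Sum>j<r. sW (co w j) (e j)) - (\<Sum>j<r. frag_of (cls s, sW (co w j) (e j))) \<in> Q"
    by (rule Q_sum_right[OF s(1)]) (simp add: W.U_scale W.e_U)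
  then have 1: "frag_of (cls s, w) - (\<Sum>j<r. frag_of (cls s, sW (co w j) (e j))) \<in> Q"
    by (simp only: W.co_expansion[OF x(3)])
  have 2: "(\<Sum>j\<in>A. frag_of (cls (sym_const (co w j) * s), e j)) - (\<Sum>j\<in>A. frag_of (cls s, sW (co w j) (e j))) \<in> Q"
    if "A \<subseteq> {..<r}" for A
    using finite_subset[OF that finite_lessThan] that
  proof (induction A rule: finite_induct)
    case (insert i A)
    have "(frag_of (cls (sym_const (co w i) * s), e i) - frag_of (cls s, sW (co w i) (e i))) +
       ((\<Sum>j\<in>A. frag_of (cls (sym_const (co w j) * s), e j)) - (\<Sum>j\<in>A. frag_of (cls s, sW (co w j) (e j)))) \<in> Q"
      using insert s W.e_U by (intro Q_add Q_scale) auto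
    then show ?case using insert.hyps by (simp add: algebra_simps)
  qed (simp add: Q_0)
  have "std (\<lambda>j. tau j (frag_of x)) = (\<Sum>j<r. frag_of (cls (sym_const (co w j) * s), e j))"
    by (simp add: std_def x tau_frag_of s_def)
  then show ?case using Q_diff[OF 1 2[OF order_refl]] one by (simp add: x s(2) carrier_F)
next
  case (diff x y)
  have xy: "tau j x \<in> PS" "tau j y \<in> PS" for j using diff tau_PS[unfolded carrier_F] by blast+
  have "(\<Sum>j\<in>A. frag_of (cls (tau j x), e j)) - (\<Sum>j\<in>A. frag_of (cls (tau j (x - y)), e j)) - (\<Sum>j\<in>A. frag_of (cls (tau j y), e j)) \<in> Q"
    if "A \<subseteq> {..<r}" for A
    using finite_subset[OF that finite_lessThan] that
  proof (induction A rule: finite_induct)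
    case (insert i A)
    have "frag_of (cls (tau i (x - y) + tau i y), e i) - frag_of (cls (tau i (x - y)), e i) - frag_of (cls (tau i y), e i) \<in> Q"
      using insert.prems xy W.e_U PS_add[OF xy(1) PS_uminus[OF xy(2)]] by (intro Q_add_left) (auto simp: tau_diff)
    from Q_add[OF this insert.IH] show ?case using insert by (simp add: tau_diff algebra_simps)
  qed (simp add: Q_0)
  from this[of "{..<r}"]
  have 3: "std (\<lambda>j. tau j x) - std (\<lambda>j. tau j (x - y)) - std (\<lambda>j. tau j y) \<in> Q" by (simp add: std_def)
  have 4: "(x - std (\<lambda>j. tau j x)) - (y - std (\<lambda>j. tau j y)) \<in> Q" by (rule Q_diff[OF conjunct2[OF diff(1)] conjunct2[OF diff(2)]])
  show ?case using Q_add[OF 4 3] diff F_diff[unfolded carrier_F, of x y] by (simp add: algebra_simps)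
qed
  then show ?thesis ..
qed

lemma Q_iff: assumes "x \<in> carrier F" shows "x \<in> Q \<longleftrightarrow> (\<forall>j<r. tau j x = 0)"
proof
  assume "\<forall>j<r. tau j x = 0"
  then have "std (\<lambda>j. tau j x) = std (\<lambda>j. tau j 0)" by (simp add: std_def tau_0)
  then have "x - std (\<lambda>j. tau j 0) \<in> Q" using std_congruent[OF assms] by simp
  from Q_diff[OF this std_congruent[OF F_0]] show "x \<in> Q" by simp
qed (simp add: tau_Q)

definition tcls :: "(nat \<Rightarrow> 'k mpoly) \<Rightarrow> ('k, 'v, 'w) tensor" where
  "tcls m = {x \<in> carrier F. \<forall>j<r. tau j x = m j}"

lemma coset_Q: assumes "x \<in> carrier F" shows "Q #>\<^bsub>F\<^esub> x = tcls (\<lambda>j. tau j x)"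
proof (intro equalityI subsetI)
  fix y assume "y \<in> Q #>\<^bsub>F\<^esub> x"
  then obtain h where h: "h \<in> Q" "y = h + x" by (auto simp: r_coset_def)
  then show "y \<in> tcls (\<lambda>j. tau j x)" using Q_F assms by (simp add: tcls_def F_add tau_add tau_Q)
next
  fix y assume "y \<in> tcls (\<lambda>j. tau j x)"
  then have y: "y \<in> carrier F" "\<And>j. j < r \<Longrightarrow> tau j y = tau j x" by (auto simp: tcls_def)
  then have "y - x \<in> Q" using assms by (subst Q_iff) (simp_all add: F_diff tau_diff)
  then show "y \<in> Q #>\<^bsub>F\<^esub> x" unfolding r_coset_def by (auto intro!: bexI[of _ "y - x"])
qed

lemma tcls_cong: "(\<And>j. j < r \<Longrightarrow> m j = m' j) \<Longrightarrow> tcls m = tcls m'"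
  unfolding tcls_def by auto

lemma tcls_std: "m \<in> Sr \<Longrightarrow> std m \<in> tcls m"
  by (simp add: tcls_def std_F tau_std)

lemma tcls_coset: assumes "m \<in> Sr" shows "tcls m = Q #>\<^bsub>F\<^esub> std m"
  unfolding coset_Q[OF std_F[OF assms]] by (rule tcls_cong) (simp add: tau_std assms)

lemma tcls_inject: assumes "m \<in> Sr" "m' \<in> Sr" shows "tcls m = tcls m' \<longleftrightarrow> m = m'"
proof
  assume "tcls m = tcls m'"
  moreover have "std m \<in> tcls m" using assms(1) by (rule tcls_std)
  ultimately have "std m \<in> tcls m'" by simp
  then have "m j = m' j" if "j < r" for j using tau_std[OF assms(1) that] that by (simp add: tcls_def)
  note eq = this
  show "m = m'"
  proof
    fix j show "m j = m' j" using eq[of j] assms by (cases "j < r") (simp_all add: Sr_def)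
  qed
qed simp

lemma normal_Q: "normal Q F"
  by (rule comm_group.normal_iff_subgroup[THEN iffD2, OF comm_group_F subgroup_Q])

lemma carrier_tensor: "carrier (Sym_tensor sV sW U) = tcls ` Sr"
proof -
  have "carrier (Sym_tensor sV sW U) = (\<lambda>x. tcls (\<lambda>j. tau j x)) ` carrier F"
    unfolding Sym_tensor_def FactGroup_def RCOSETS_def by (auto simp: coset_Q)
  also have "\<dots> = tcls ` Sr"
  proof (intro equalityI subsetI)
    fix T assume "T \<in> (\<lambda>x. tcls (\<lambda>j. tau j x)) ` carrier F"
    then obtain x where x: "x \<in> carrier F" "T = tcls (\<lambda>j. tau j x)" by blast
    have "T = tcls (\<lambda>j. if j < r then tau j x else 0)" unfolding x(2) by (rule tcls_cong) simp
    moreover have "(\<lambda>j. if j < r then tau j x else 0) \<in> Sr" using tau_PS[OF x(1)] by (simp add: Sr_def)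
    ultimately show "T \<in> tcls ` Sr" by blast
  next
    fix T assume "T \<in> tcls ` Sr"
    then obtain m where m: "m \<in> Sr" "T = tcls m" by blast
    have "T = tcls (\<lambda>j. tau j (std m))" unfolding m(2) by (rule tcls_cong) (simp add: tau_std m)
    then show "T \<in> (\<lambda>x. tcls (\<lambda>j. tau j x)) ` carrier F" using std_F[OF m(1)] by blast
  qed
  finally show ?thesis .
qed

lemma tensor_mult: assumes "m \<in> Sr" "m' \<in> Sr"
  shows "tcls m \<otimes>\<^bsub>Sym_tensor sV sW U\<^esub> tcls m' = tcls (\<lambda>j. m j + m' j)"
proof -
  have "tcls m \<otimes>\<^bsub>Sym_tensor sV sW U\<^esub> tcls m' = Q #>\<^bsub>F\<^esub> (std m + std m')"
    unfolding tcls_coset[OF assms(1)] tcls_coset[OF assms(2)] Sym_tensor_def FactGroup_def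
    using normal.rcos_sum[OF normal_Q std_F[OF assms(1)] std_F[OF assms(2)]] by simp
  also have "\<dots> = tcls (\<lambda>j. m j + m' j)"
    unfolding coset_Q[OF F_add[OF std_F[OF assms(1)] std_F[OF assms(2)]]]
    by (rule tcls_cong) (simp add: tau_add tau_std assms)
  finally show ?thesis .
qed

lemma tensor_one: "\<one>\<^bsub>Sym_tensor sV sW U\<^esub> = tcls (\<lambda>_. 0)"
proof -
  have "Q = tcls (\<lambda>_. 0)"
  proof (intro equalityI subsetI)
    fix x assume "x \<in> Q"
    then show "x \<in> tcls (\<lambda>_. 0)" by (simp add: tcls_def Q_F tau_Q)
  next
    fix x assume "x \<in> tcls (\<lambda>_. 0)"
    then show "x \<in> Q" unfolding tcls_def by (simp add: Q_iff)
  qed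
  then show ?thesis by (simp add: Sym_tensor_def FactGroup_def)
qed

text \<open>\<open>L\<close> describes \<open>f \<otimes> h\<close> in coordinates. Compatibility
  with differences suffices because formal sums are built by differences; \<open>L_cong\<close> is
  required because \<open>tcls\<close> prescribes only the coordinates below
  \<open>r\<close>.\<close>

lemma tensor_map_tcls:
  assumes m: "m \<in> Sr"
    and f: "\<And>s. s \<in> carrier (Sym sV) \<Longrightarrow> f s \<in> carrier (Sym sV)" and h: "\<And>w. w \<in> U \<Longrightarrow> h w \<in> U"
    and L_diff: "\<And>j t t'. L j (\<lambda>i. t i - t' i) = (L j t - L j t' :: 'k mpoly)"
    and L_cong: "\<And>j t t'. j < r \<Longrightarrow> (\<And>i. i < r \<Longrightarrow> t i = t' i) \<Longrightarrow> L j t = L j t'"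
    and L: "\<And>s w j. s \<in> carrier (Sym sV) \<Longrightarrow> w \<in> U \<Longrightarrow> j < r \<Longrightarrow>
        tau j (frag_of (f s, h w)) = L j (\<lambda>i. tau i (frag_of (s, w)))"
  shows "tensor_map sV sW U f h (tcls m) = tcls (\<lambda>j. L j m)"
proof -
  let ?x = "frag_extend (\<lambda>(s, w). frag_of (f s, h w))"
  have ext: "?x x \<in> carrier F \<and> (\<forall>j<r. tau j (?x x) = L j (\<lambda>i. tau i x))" if "x \<in> carrier F" for x
    using that unfolding carrier_F[of x]
  proof (induction x rule: frag_induction)
    case zero
    have "L j (\<lambda>i. 0) = 0" for j using L_diff[of j "\<lambda>_. 0" "\<lambda>_. 0"] by simp
    then show ?case by (simp add: F_0 tau_0)
  next
    case (one x) then show ?case using f h L by (cases x) (auto intro!: F_frag)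
  next
    case (diff x y) then show ?case by (simp add: frag_extend_diff F_diff tau_diff L_diff)
  qed
  have eq: "Q #>\<^bsub>F\<^esub> ?x x = tcls (\<lambda>j. L j m)" if "x \<in> tcls m" for x
  proof -
    have x: "x \<in> carrier F" "\<And>j. j < r \<Longrightarrow> tau j x = m j" using that by (auto simp: tcls_def)
    show ?thesis unfolding coset_Q[OF conjunct1[OF ext[OF x(1)]]]
    proof (rule tcls_cong)
      fix j assume j: "j < r"
      have "tau j (?x x) = L j (\<lambda>i. tau i x)" using ext[OF x(1)] j by blast
      also have "\<dots> = L j m" by (rule L_cong[OF j x(2)])
      finally show "tau j (?x x) = L j m" .
    qed
  qed
  have "std m \<in> tcls m" using m by (rule tcls_std)
  then have ne: "tcls m \<noteq> {}" by blast
  have "tensor_map sV sW U f h (tcls m) = (\<Union>x\<in>tcls m. tcls (\<lambda>j. L j m))"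
    unfolding tensor_map_def by (rule SUP_cong[OF refl eq])
  then show ?thesis using ne by simp
qed

lemma tensor_map_act:
  assumes m: "m \<in> Sr" and g: "g \<in> G"
  shows "tensor_map sV sW U (Sym_act sV g) (\<rho> g) (tcls m) = tcls (\<lambda>j. \<Sum>k<r. sym_const (W.D g j k) * actP g (m k))"
proof (rule tensor_map_tcls[OF m])
  fix s assume "s \<in> carrier (Sym sV)"
  then show "Sym_act sV g s \<in> carrier (Sym sV)" by (auto simp: carrier_Sym Sym_act_cls G_linear g PS_actP)
next
  fix s w j assume s: "s \<in> carrier (Sym sV)" and w: "w \<in> U" and j: "j < r"
  obtain p where p: "p \<in> PS" "s = cls p" using s by (auto simp: carrier_Sym)
  have const_sum: "sym_const (sum f A) = (\<Sum>k\<in>A. sym_const (f k) :: 'k mpoly)" for f :: "nat \<Rightarrow> 'k" and A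
    by (induction A rule: infinite_finite_induct) (simp_all add: const_hom)
  show "tau j (frag_of (Sym_act sV g s, \<rho> g w)) = (\<Sum>k<r. sym_const (W.D g j k) * actP g (tau k (frag_of (s, w))))"
    using p g w by (simp add: tau_frag_of Sym_act_cls G_linear uncls_cls PS_actP W.co_rho const_sum const_hom
        sum_distrib_right hom_mult algebra_homs actP_const mult.assoc)
qed (simp_all add: W.rho_U g hom_diff algebra_homs right_diff_distrib sum_subtractf)

lemma tensor_map_smult:
  assumes m: "m \<in> Sr" and q: "q \<in> PS"
  shows "tensor_map sV sW U ((\<otimes>\<^bsub>Sym sV\<^esub>) (cls q)) id (tcls m) = tcls (\<lambda>j. q * m j)"
proof (rule tensor_map_tcls[OF m])
  fix s assume "s \<in> carrier (Sym sV)"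
  then show "cls q \<otimes>\<^bsub>Sym sV\<^esub> s \<in> carrier (Sym sV)" by (auto simp: carrier_Sym Sym_mult q PS_mult)
next
  fix s w j assume s: "s \<in> carrier (Sym sV)"
  then obtain p where p: "p \<in> PS" "s = cls p" by (auto simp: carrier_Sym)
  show "tau j (frag_of (cls q \<otimes>\<^bsub>Sym sV\<^esub> s, id w)) = q * tau j (frag_of (s, w))"
    using p q by (simp add: tau_frag_of Sym_mult uncls_cls PS_mult mult.left_commute)
qed (simp_all add: right_diff_distrib)

definition covs :: "(nat \<Rightarrow> 'k mpoly) set" where
  "covs = {m \<in> Sr. \<forall>g\<in>G. \<forall>j<r. (\<Sum>k<r. sym_const (W.D g j k) * actP g (m k)) = m j}"

abbreviation "M \<equiv> covariants sV G sW U \<rho>"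

lemma covs_Sr: "m \<in> covs \<Longrightarrow> m \<in> Sr" by (simp add: covs_def)

lemma carrier_M: "carrier M = tcls ` covs"
proof -
  have "tensor_map sV sW U (Sym_act sV g) (\<rho> g) (tcls m) = tcls m \<longleftrightarrow>
      (\<forall>j<r. (\<Sum>k<r. sym_const (W.D g j k) * actP g (m k)) = m j)" if m: "m \<in> Sr" and g: "g \<in> G" for m g
  proof -
    let ?y = "\<lambda>j. if j < r then \<Sum>k<r. sym_const (W.D g j k) * actP g (m k) else 0"
    have "(\<Sum>k<r. sym_const (W.D g j k) * actP g (m k)) \<in> PS" for j
      by (intro PS_sum PS_mult PS_const PS_actP G_linear[OF g]) (use m in \<open>simp add: Sr_def\<close>)
    then have y: "?y \<in> Sr" by (simp add: Sr_def)
    have "tensor_map sV sW U (Sym_act sV g) (\<rho> g) (tcls m) = tcls ?y"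
      unfolding tensor_map_act[OF m g] by (rule tcls_cong) simp
    then have "tensor_map sV sW U (Sym_act sV g) (\<rho> g) (tcls m) = tcls m \<longleftrightarrow> ?y = m" by (simp add: tcls_inject y m)
    also have "\<dots> \<longleftrightarrow> (\<forall>j<r. (\<Sum>k<r. sym_const (W.D g j k) * actP g (m k)) = m j)"
      using m by (auto simp: Sr_def fun_eq_iff)
    finally show ?thesis .
  qed
  then show ?thesis unfolding covariants_def carrier_tensor covs_def by auto
qed

lemma M_add: "m \<in> covs \<Longrightarrow> m' \<in> covs \<Longrightarrow> tcls m \<oplus>\<^bsub>M\<^esub> tcls m' = tcls (\<lambda>j. m j + m' j)"
  by (simp add: covariants_def tensor_mult covs_Sr)
lemma M_zero: "\<zero>\<^bsub>M\<^esub> = tcls (\<lambda>_. 0)"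
  by (simp add: covariants_def tensor_one)
lemma M_smult: "m \<in> covs \<Longrightarrow> q \<in> PS \<Longrightarrow> cls q \<odot>\<^bsub>M\<^esub> tcls m = tcls (\<lambda>j. q * m j)"
  by (simp add: covariants_def tensor_map_smult covs_Sr)

end

section \<open>Coordinate charts of modules and bounds for the multiplicities\<close>

context linear_coordinates begin

text \<open>A coordinate description of a module record. The zero is listed separately because it is
  a field of the record, and the record is left arbitrary so that the bounds can be proved without
  mentioning tensors.\<close>

definition chart :: "(nat \<Rightarrow> 'k mpoly) set \<Rightarrow> (('k, 'v) sym, 'm) module \<Rightarrow> ((nat \<Rightarrow> 'k mpoly) \<Rightarrow> 'm) \<Rightarrow> bool" where
  "chart Cv M f \<longleftrightarrow> bij_betw f Cv (carrier M) \<and>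
     (\<forall>m\<in>Cv. \<forall>m'\<in>Cv. f m \<oplus>\<^bsub>M\<^esub> f m' = f (\<lambda>j. m j + m' j)) \<and>
     (\<forall>q\<in>PS. \<forall>m\<in>Cv. cls q \<odot>\<^bsub>M\<^esub> f m = f (\<lambda>j. q * m j)) \<and> \<zero>\<^bsub>M\<^esub> = f (\<lambda>_. 0)"

end

lemma (in tensor_coordinates) covariants_chart: "chart covs (covariants sV G sW U \<rho>) tcls"
proof -
  have "inj_on tcls covs" using tcls_inject covs_Sr by (metis inj_onI)
  then show ?thesis
    unfolding chart_def bij_betw_def using M_add M_smult M_zero carrier_M by auto
qed

text \<open>\<open>dl\<close>, \<open>bl\<close> and \<open>vl\<close> satisfy a condition in which
  \<open>q\<close> does not occur: the Galois coordinates can be chosen once and serve all powers of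
  \<open>p\<close>.\<close>

locale symmetric_frobenius = frobenius_coordinates sV d b cd q rt
  for sV :: "'k::field \<Rightarrow> 'v::ab_group_add \<Rightarrow> 'v" and d b cd q rt +
  fixes G :: "('v \<Rightarrow> 'v) set" and dl bl vl
  assumes G_lin: "g \<in> G \<Longrightarrow> Vector_Spaces.linear sV sV g"
    and galois: "invariant_galois PS sym_const aug G actP io dl bl vl"
begin

sublocale fr: invariant_frobenius PS sym_const aug G actP io dl bl vl q Box "\<lambda>a. Poly_Mapping.single a 1" rc
proof -
  interpret invariant_galois PS sym_const aug G actP io dl bl vl by (rule galois)
  show "invariant_frobenius PS sym_const aug G actP io dl bl vl q Box (\<lambda>a. Poly_Mapping.single a 1) rc"
    by unfold_locales
       (use finite_Box q_pos q_add rc_PS rc_add rc_smult rc_expansion in \<open>auto simp: Box_def intro!: PS_single\<close>)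
qed

abbreviation "IR \<equiv> invariant_ring sV G"

lemma R_invariants: "fr.R = invariants G" by (simp add: fr.R_def invariants_def)
lemma R_PS: "x \<in> fr.R \<Longrightarrow> x \<in> PS" by (simp add: fr.R_def)
lemma carrier_IR: "carrier IR = cls ` fr.R"
  unfolding R_invariants by (rule carrier_invariant_ring[OF G_lin])

lemma chart_abelian_monoid: assumes f: "chart (fr.Cov r D) M f" shows "abelian_monoid M"
proof -
  have im: "carrier M = f ` fr.Cov r D" using f by (simp add: chart_def bij_betw_def)
  show ?thesis
    by (rule abelian_monoidI) (use f in \<open>auto simp: im chart_def fr.Cov_0 fr.Cov_add add_ac\<close>)
qed

text \<open>\<open>linearly_independent\<close> sums over a set of module elements; injectivity of
  \<open>f\<close> turns this into a sum over a set of vectors.\<close>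

lemma chart_finsum:
  assumes f: "chart (fr.Cov r D) M f" and A: "finite A" "A \<subseteq> fr.Cov r D" and s: "\<And>m. m \<in> A \<Longrightarrow> s m \<in> fr.R"
    and a: "\<And>m. m \<in> A \<Longrightarrow> a (f m) = cls (s m)"
  shows "(\<Oplus>\<^bsub>M\<^esub>x\<in>f ` A. a x \<odot>\<^bsub>M\<^esub> x) = f (\<lambda>j. \<Sum>m\<in>A. s m * m j)"
  using A s a
proof (induction A rule: finite_induct)
  interpret abelian_monoid M by (rule chart_abelian_monoid[OF f])
  have inj: "inj_on f (fr.Cov r D)" and im: "carrier M = f ` fr.Cov r D" using f by (auto simp: chart_def bij_betw_def)
  { case empty then show ?case using f by (simp add: chart_def) }
  case (insert m A)
  have sm: "a (f x) \<odot>\<^bsub>M\<^esub> f x = f (\<lambda>j. s x * x j) \<and> (\<lambda>j. s x * x j) \<in> fr.Cov r D" if "x \<in> insert m A" for x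
    using f insert.prems that R_PS fr.Cov_smult by (auto simp: chart_def)
  have "f m \<notin> f ` A" using inj_onD[OF inj] insert by blast
  moreover have "(\<lambda>x. a x \<odot>\<^bsub>M\<^esub> x) \<in> f ` A \<rightarrow> carrier M" using sm im by auto
  moreover have "a (f m) \<odot>\<^bsub>M\<^esub> f m \<in> carrier M" using sm im by auto
  ultimately have "(\<Oplus>\<^bsub>M\<^esub>x\<in>f ` insert m A. a x \<odot>\<^bsub>M\<^esub> x)
      = a (f m) \<odot>\<^bsub>M\<^esub> f m \<oplus>\<^bsub>M\<^esub> (\<Oplus>\<^bsub>M\<^esub>x\<in>f ` A. a x \<odot>\<^bsub>M\<^esub> x)"
    using insert.hyps(1) by (simp add: finsum_insert)
  also have "\<dots> = f (\<lambda>j. s m * m j) \<oplus>\<^bsub>M\<^esub> f (\<lambda>j. \<Sum>m\<in>A. s m * m j)"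
    using insert sm by simp
  also have "\<dots> = f (\<lambda>j. s m * m j + (\<Sum>m\<in>A. s m * m j))"
  proof -
    have "(\<lambda>j. \<Sum>m\<in>A. s m * m j) \<in> fr.Cov r D" using sm by (intro fr.Cov_sum) auto
    then show ?thesis using f sm[of m] by (simp add: chart_def)
  qed
  finally show ?case using insert.hyps by simp
qed

lemma chart_independent:
  assumes f: "chart (fr.Cov r D) M f" and A: "finite A" "A \<subseteq> fr.Cov r D"
  shows "linearly_independent IR M (f ` A) \<longleftrightarrow> fr.R_independent r A"
proof -
  have inj: "inj_on f (fr.Cov r D)" and im: "carrier M = f ` fr.Cov r D" and z: "\<zero>\<^bsub>M\<^esub> = f (\<lambda>_. 0)"
    using f by (auto simp: chart_def bij_betw_def)
  have Cv: "(\<lambda>j. \<Sum>m\<in>A. s m * m j) \<in> fr.Cov r D" if "\<And>m. m \<in> A \<Longrightarrow> s m \<in> fr.R" for s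
    using that A by (intro fr.Cov_sum fr.Cov_smult) auto
  have zero_iff: "f (\<lambda>j. \<Sum>m\<in>A. s m * m j) = \<zero>\<^bsub>M\<^esub> \<longleftrightarrow> (\<forall>j<r. (\<Sum>m\<in>A. s m * m j) = 0)"
    if "\<And>m. m \<in> A \<Longrightarrow> s m \<in> fr.R" for s
  proof -
    have "f (\<lambda>j. \<Sum>m\<in>A. s m * m j) = \<zero>\<^bsub>M\<^esub> \<longleftrightarrow> (\<lambda>j. \<Sum>m\<in>A. s m * m j) = (\<lambda>_. 0)"
      unfolding z using inj_on_eq_iff[OF inj Cv[OF that] fr.Cov_0] by simp
    also have "\<dots> \<longleftrightarrow> (\<forall>j<r. (\<Sum>m\<in>A. s m * m j) = 0)"
    proof
      assume *: "\<forall>j<r. (\<Sum>m\<in>A. s m * m j) = 0"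
      show "(\<lambda>j. \<Sum>m\<in>A. s m * m j) = (\<lambda>_. 0)"
        by (rule fr.Cov_eqI[OF Cv[OF that] fr.Cov_0]) (use * in auto)
    qed (simp add: fun_eq_iff)
    finally show ?thesis .
  qed
  show ?thesis
  proof
    assume L: "linearly_independent IR M (f ` A)"
    show "fr.R_independent r A" unfolding fr.R_independent_def
    proof (intro allI impI)
      fix s assume s: "(\<forall>x\<in>A. s x \<in> fr.R) \<and> (\<forall>j<r. (\<Sum>x\<in>A. s x * x j) = 0)"
      define a where "a x = cls (s (inv_into A f x))" for x
      have a: "a (f m) = cls (s m)" if "m \<in> A" for m
        using inv_into_f_f[OF inj_on_subset[OF inj A(2)] that] by (simp add: a_def)
      have "(\<Oplus>\<^bsub>M\<^esub>x\<in>f ` A. a x \<odot>\<^bsub>M\<^esub> x) = f (\<lambda>j. \<Sum>m\<in>A. s m * m j)"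
        by (rule chart_finsum[OF f A]) (use s a in auto)
      also have "\<dots> = \<zero>\<^bsub>M\<^esub>" using zero_iff[of s] s by blast
      finally have "\<forall>x\<in>f ` A. a x = \<zero>\<^bsub>IR\<^esub>"
        using L s a unfolding linearly_independent_def carrier_IR by auto
      then have "cls (s x) = cls 0" if "x \<in> A" for x using a that by (simp add: invariant_ring_ops)
      then show "\<forall>x\<in>A. s x = 0" using cls_inject s R_PS PS_0 by blast
    qed
  next
    assume I: "fr.R_independent r A"
    show "linearly_independent IR M (f ` A)" unfolding linearly_independent_def
    proof (intro conjI ballI impI)
      show "finite (f ` A)" using A by simp
      show "f ` A \<subseteq> carrier M" using A im by auto
      fix a x assume a: "a \<in> f ` A \<rightarrow> carrier IR" and 0: "(\<Oplus>\<^bsub>M\<^esub>x\<in>f ` A. a x \<odot>\<^bsub>M\<^esub> x) = \<zero>\<^bsub>M\<^esub>" and x: "x \<in> f ` A"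
      have a': "uncls (a (f m)) \<in> fr.R \<and> a (f m) = cls (uncls (a (f m)))" if "m \<in> A" for m
      proof -
        have "a (f m) \<in> cls ` fr.R" using a that unfolding carrier_IR by auto
        then show ?thesis using R_PS uncls_cls by auto
      qed
      have "f (\<lambda>j. \<Sum>m\<in>A. uncls (a (f m)) * m j) = \<zero>\<^bsub>M\<^esub>"
        unfolding 0[symmetric] by (rule chart_finsum[OF f A, symmetric]) (use a' in auto)
      then have 1: "\<forall>j<r. (\<Sum>m\<in>A. uncls (a (f m)) * m j) = 0"
        by (subst (asm) zero_iff) (use a' in auto)
      have "\<forall>m\<in>A. uncls (a (f m)) = 0"
        by (rule I[unfolded fr.R_independent_def, THEN spec[of _ "\<lambda>m. uncls (a (f m))"], THEN mp]) (use a' 1 in blast)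
      then show "a x = \<zero>\<^bsub>IR\<^esub>" using x a' by (auto simp: invariant_ring_ops)
    qed
  qed
qed

text \<open>The independent sets of \<open>M\<close> are the images of independent sets of
  covariants, whose largest size is \<open>r\<close> by \<open>Cov_basis\<close> and
  \<open>Cov_dependent\<close>.\<close>

lemma chart_rank:
  assumes f: "chart (fr.Cov r D) M f" and D: "fr.mrep r D"
  shows "module_rank IR M = r"
  unfolding module_rank_def
proof (rule Greatest_equality)
  have inj: "inj_on f (fr.Cov r D)" and im: "carrier M = f ` fr.Cov r D" using f by (auto simp: chart_def bij_betw_def)
  obtain B where B: "finite B" "B \<subseteq> fr.Cov r D" "card B = r" "fr.R_independent r B" by (rule fr.Cov_basis[OF D])
  then have "linearly_independent IR M (f ` B)" using chart_independent[OF f B(1,2)] by simp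
  moreover have "card (f ` B) = r" using card_image[OF inj_on_subset[OF inj B(2)]] B(3) by simp
  ultimately show "\<exists>A. linearly_independent IR M A \<and> card A = r" by blast
  fix y assume "\<exists>A. linearly_independent IR M A \<and> card A = y"
  then obtain A' where A': "linearly_independent IR M A'" "card A' = y" by blast
  then have "finite A'" "A' \<subseteq> f ` fr.Cov r D" by (auto simp: linearly_independent_def im)
  then obtain A where A: "A \<subseteq> fr.Cov r D" "finite A" "A' = f ` A" by (rule finite_subset_image[elim_format]) blast
  then have "fr.R_independent r A" using chart_independent[OF f A(2,1)] A' by simp
  then have "card A \<le> r" using fr.Cov_dependent[OF A(2,1)] by (meson not_le)
  then show "y \<le> r" using A'(2) A card_image_le[OF A(2), of f] by simp
qed

text \<open>The isomorphism is split into its components \<Phi> and its inverse into the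
  restrictions \<Psi> to single summands, both in coordinates. Two facts are retained: the
  composites add up to the identity, and a family of covariants with total image zero is
  zero.\<close>

lemma isomorphism_families:
  fixes Mo :: "nat \<Rightarrow> (('k, 'v) sym, 'm) module" and n e p :: nat and c r :: "nat \<Rightarrow> nat" and D
  assumes q: "q = p ^ e"
    and iso: "frobenius_multiplicities p IR n Mo e c"
    and f: "\<And>i. i \<le> n \<Longrightarrow> chart (fr.Cov (r i) (D i)) (Mo i) (f i)"
  defines "J \<equiv> SIGMA i:{..n}. {..<c i}"
  obtains \<Phi> \<Psi> where "\<And>t. t \<in> J \<Longrightarrow> fr.qlin_to (r (fst t)) (D (fst t)) (\<Phi> t)"
    "\<And>t. t \<in> J \<Longrightarrow> fr.qlin_from (r (fst t)) (D (fst t)) (\<Psi> t)"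
    "\<And>y. y \<in> fr.R \<Longrightarrow> (\<Sum>t\<in>J. \<Psi> t (\<Phi> t y)) = y"
    "\<And>w t j. (\<And>t. t \<in> J \<Longrightarrow> w t \<in> fr.Cov (r (fst t)) (D (fst t))) \<Longrightarrow> (\<Sum>t\<in>J. \<Psi> t (w t)) = 0 \<Longrightarrow> t \<in> J \<Longrightarrow> w t j = 0"
proof -
  let ?C = "\<lambda>t. fr.Cov (r (fst t)) (D (fst t))" and ?f = "\<lambda>t. f (fst t)" and ?M = "\<lambda>t. Mo (fst t)"
  have finJ: "finite J" by (simp add: J_def)
  have ft: "chart (?C t) (?M t) (?f t)" if "t \<in> J" for t using f that by (auto simp: J_def)
  have inj: "inj_on (?f t) (?C t)" and im: "carrier (?M t) = ?f t ` ?C t"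
    and fadd: "\<And>m m'. m \<in> ?C t \<Longrightarrow> m' \<in> ?C t \<Longrightarrow> ?f t m \<oplus>\<^bsub>?M t\<^esub> ?f t m' = ?f t (\<lambda>j. m j + m' j)"
    and fsm: "\<And>s m. s \<in> fr.R \<Longrightarrow> m \<in> ?C t \<Longrightarrow> cls s \<odot>\<^bsub>?M t\<^esub> ?f t m = ?f t (\<lambda>j. s * m j)"
    if "t \<in> J" for t using ft[OF that] R_PS by (auto simp: chart_def bij_betw_def)
  let ?N = "frobenius_twist p e IR (regular_module IR)" and ?S = "finite_direct_sum J (\<lambda>(i, j). Mo i)"
  have cN: "carrier ?N = cls ` fr.R" by (simp add: frobenius_twist_def regular_module_def carrier_IR)
  have addN: "cls x \<oplus>\<^bsub>?N\<^esub> cls y = cls (x + y)" if "x \<in> fr.R" "y \<in> fr.R" for x y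
    using that R_PS by (simp add: frobenius_twist_def regular_module_def invariant_ring_ops Sym_add)
  have smN: "cls s \<odot>\<^bsub>?N\<^esub> cls y = cls (s ^ q * y)" if "s \<in> fr.R" "y \<in> fr.R" for s y
    using that R_PS by (simp add: frobenius_twist_def regular_module_def invariant_ring_ops invariant_ring_pow Sym_mult PS_power q)
  have cS: "carrier ?S = (\<Pi>\<^sub>E t\<in>J. carrier (?M t))" by (simp add: finite_direct_sum_def case_prod_beta)
  obtain \<phi> where bij: "bij_betw \<phi> (cls ` fr.R) (\<Pi>\<^sub>E t\<in>J. carrier (?M t))"
    and \<phi>_add: "\<And>x y. x \<in> fr.R \<Longrightarrow> y \<in> fr.R \<Longrightarrow> \<phi> (cls (x + y)) = (\<lambda>t\<in>J. \<phi> (cls x) t \<oplus>\<^bsub>?M t\<^esub> \<phi> (cls y) t)"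
    and \<phi>_sm: "\<And>s x. s \<in> fr.R \<Longrightarrow> x \<in> fr.R \<Longrightarrow> \<phi> (cls (s ^ q * x)) = (\<lambda>t\<in>J. cls s \<odot>\<^bsub>?M t\<^esub> \<phi> (cls x) t)"
  proof -
    obtain \<phi> where \<phi>: "bij_betw \<phi> (carrier ?N) (carrier ?S)"
      "\<And>x y. x \<in> carrier ?N \<Longrightarrow> y \<in> carrier ?N \<Longrightarrow> \<phi> (x \<oplus>\<^bsub>?N\<^esub> y) = \<phi> x \<oplus>\<^bsub>?S\<^esub> \<phi> y"
      "\<And>s x. s \<in> carrier IR \<Longrightarrow> x \<in> carrier ?N \<Longrightarrow> \<phi> (s \<odot>\<^bsub>?N\<^esub> x) = s \<odot>\<^bsub>?S\<^esub> \<phi> x"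
      using iso unfolding frobenius_multiplicities_def isomorphic_modules_def J_def by blast
    show thesis
    proof (rule that[of \<phi>])
      show "bij_betw \<phi> (cls ` fr.R) (\<Pi>\<^sub>E t\<in>J. carrier (?M t))" using \<phi>(1) unfolding cN cS .
      fix x y assume xy: "x \<in> fr.R" "y \<in> fr.R"
      show "\<phi> (cls (x + y)) = (\<lambda>t\<in>J. \<phi> (cls x) t \<oplus>\<^bsub>?M t\<^esub> \<phi> (cls y) t)"
        using \<phi>(2)[of "cls x" "cls y"] xy by (simp add: cN addN finite_direct_sum_def case_prod_beta)
      show "\<phi> (cls (x ^ q * y)) = (\<lambda>t\<in>J. cls x \<odot>\<^bsub>?M t\<^esub> \<phi> (cls y) t)"
        using \<phi>(3)[of "cls x" "cls y"] xy by (simp add: cN carrier_IR smN finite_direct_sum_def case_prod_beta)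
    qed
  qed
  have \<phi>_inj: "x = y" if "x \<in> fr.R" "y \<in> fr.R" "\<phi> (cls x) = \<phi> (cls y)" for x y
    using inj_onD[OF bij_betw_imp_inj_on[OF bij] that(3)] that cls_inject R_PS by blast
  have \<phi>_C: "\<phi> (cls y) \<in> (\<Pi>\<^sub>E t\<in>J. carrier (?M t))" if "y \<in> fr.R" for y
    using bij_betwE[OF bij] that by blast
  define \<Phi> where "\<Phi> t y = inv_into (?C t) (?f t) (\<phi> (cls y) t)" for t y
  have \<Phi>: "\<Phi> t y \<in> ?C t" "?f t (\<Phi> t y) = \<phi> (cls y) t" if "t \<in> J" "y \<in> fr.R" for t y
  proof -
    have "\<phi> (cls y) t \<in> ?f t ` ?C t" using PiE_mem[OF \<phi>_C[OF that(2)] that(1)] im[OF that(1)] by simp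
    then show "\<Phi> t y \<in> ?C t" "?f t (\<Phi> t y) = \<phi> (cls y) t"
      unfolding \<Phi>_def by (rule inv_into_into, rule f_inv_into_f)
  qed
  define full where "full w = (\<lambda>t\<in>J. ?f t (w t))" for w
  define fam where "fam w \<longleftrightarrow> (\<forall>t\<in>J. w t \<in> ?C t)" for w
  \<comment> \<open>The inverse isomorphism on families of covariants; on families supported at one
    \<open>t\<close> it will be \<open>\<Psi> t\<close>.\<close>
  define \<chi> where "\<chi> w = uncls (inv_into (cls ` fr.R) \<phi> (full w))" for w
  have \<chi>: "\<chi> w \<in> fr.R" "\<phi> (cls (\<chi> w)) = full w" if "fam w" for w
  proof -
    have "full w \<in> (\<Pi>\<^sub>E t\<in>J. carrier (?M t))" using that by (auto simp: full_def fam_def im)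
    then have im': "full w \<in> \<phi> ` (cls ` fr.R)" using bij by (simp add: bij_betw_def)
    obtain y where y: "y \<in> fr.R" "inv_into (cls ` fr.R) \<phi> (full w) = cls y" using inv_into_into[OF im'] by blast
    have "\<chi> w = y" unfolding \<chi>_def y(2) by (rule uncls_cls[OF R_PS[OF y(1)]])
    then show "\<chi> w \<in> fr.R" "\<phi> (cls (\<chi> w)) = full w" using y f_inv_into_f[OF im'] by simp_all
  qed
  have \<chi>_eq: "\<chi> w = y" if "fam w" "y \<in> fr.R" "\<phi> (cls y) = full w" for w y
    using \<phi>_inj[OF \<chi>(1)[OF that(1)] that(2)] \<chi>(2)[OF that(1)] that(3) by simp
  have fam_add: "fam (\<lambda>t j. w t j + w' t j)" if "fam w" "fam w'" for w w'
    using that fr.Cov_add by (simp add: fam_def)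
  have fam_sm: "fam (\<lambda>t j. s * w t j)" if "fam w" "s \<in> fr.R" for w s
    using that fr.Cov_smult by (simp add: fam_def)
  have \<chi>_add: "\<chi> (\<lambda>t j. w t j + w' t j) = \<chi> w + \<chi> w'" if w: "fam w" "fam w'" for w w'
  proof (rule \<chi>_eq[OF fam_add[OF w]])
    show "\<chi> w + \<chi> w' \<in> fr.R" using \<chi>(1) w fr.R_add by blast
    show "\<phi> (cls (\<chi> w + \<chi> w')) = full (\<lambda>t j. w t j + w' t j)"
      unfolding \<phi>_add[OF \<chi>(1)[OF w(1)] \<chi>(1)[OF w(2)]] \<chi>(2)[OF w(1)] \<chi>(2)[OF w(2)]
      unfolding full_def by (rule restrict_ext) (use w in \<open>simp add: fam_def fadd\<close>)
  qed
  have \<chi>_sm: "\<chi> (\<lambda>t j. s * w t j) = s ^ q * \<chi> w" if w: "fam w" "s \<in> fr.R" for w s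
  proof (rule \<chi>_eq[OF fam_sm[OF w]])
    show "s ^ q * \<chi> w \<in> fr.R" using \<chi>(1) w fr.R_mult fr.R_power by blast
    show "\<phi> (cls (s ^ q * \<chi> w)) = full (\<lambda>t j. s * w t j)"
      unfolding \<phi>_sm[OF w(2) \<chi>(1)[OF w(1)]] \<chi>(2)[OF w(1)]
      unfolding full_def by (rule restrict_ext) (use w in \<open>simp add: fam_def fsm\<close>)
  qed
  have fam_0: "fam (\<lambda>t j. 0)" by (simp add: fam_def fr.Cov_0)
  have \<chi>_0: "\<chi> (\<lambda>t j. 0) = 0"
    using \<chi>_sm[OF fam_0 fr.R_0] q_pos by (simp add: zero_power)
  define \<Psi> where "\<Psi> t m = \<chi> (\<lambda>s. if s = t then m else (\<lambda>j. 0))" for t m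
  have fam_single: "fam (\<lambda>s. if s = t then m else (\<lambda>j. 0))" if "m \<in> ?C t" for t m
    using that fr.Cov_0 by (simp add: fam_def)
  have \<Psi>_sum: "(\<Sum>t\<in>A. \<Psi> t (w t)) = \<chi> (\<lambda>s. if s \<in> A then w s else (\<lambda>j. 0))" if w: "fam w" and A: "A \<subseteq> J" for w A
    using finite_subset[OF A finJ] A
  proof (induction A rule: finite_induct)
    case empty show ?case using \<chi>_0 by simp
  next
    case (insert t A)
    have 1: "fam (\<lambda>s. if s = t then w t else (\<lambda>j. 0))" using fam_single w insert.prems by (simp add: fam_def)
    have 2: "fam (\<lambda>s. if s \<in> A then w s else (\<lambda>j. 0))" using w fr.Cov_0 by (simp add: fam_def)
    have "(\<lambda>s. if s \<in> insert t A then w s else (\<lambda>j. 0))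
        = (\<lambda>s j. (if s = t then w t else (\<lambda>j. 0)) j + (if s \<in> A then w s else (\<lambda>j. 0)) j)"
      using insert.hyps by (auto simp: fun_eq_iff)
    then show ?case using \<chi>_add[OF 1 2] insert by (simp add: \<Psi>_def)
  qed
  have \<chi>_cong: "\<chi> w = \<chi> w'" if "\<And>t. t \<in> J \<Longrightarrow> w t = w' t" for w w'
    using that by (simp add: \<chi>_def full_def cong: restrict_cong)
  show thesis
  proof (rule that[of \<Phi> \<Psi>])
    fix t assume t: "t \<in> J"
    show "fr.qlin_to (r (fst t)) (D (fst t)) (\<Phi> t)" unfolding fr.qlin_to_def
    proof (intro conjI ballI)
      fix y z assume y: "y \<in> fr.R"
      show "\<Phi> t y \<in> ?C t" by (rule \<Phi>(1)[OF t y])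
      { assume z: "z \<in> fr.R"
        have "?f t (\<Phi> t (y + z)) = ?f t (\<lambda>j. \<Phi> t y j + \<Phi> t z j)"
          using \<Phi>[OF t y] \<Phi>[OF t z] \<Phi>[OF t fr.R_add[OF y z]] t by (simp add: \<phi>_add[OF y z] flip: fadd[OF t])
        then show "\<Phi> t (y + z) = (\<lambda>j. \<Phi> t y j + \<Phi> t z j)"
          using inj_onD[OF inj[OF t]] \<Phi>[OF t y] \<Phi>[OF t z] \<Phi>[OF t fr.R_add[OF y z]] fr.Cov_add by blast
        have "?f t (\<Phi> t (y ^ q * z)) = ?f t (\<lambda>j. y * \<Phi> t z j)"
          using \<Phi>[OF t z] \<Phi>[OF t fr.R_mult[OF fr.R_power[OF y] z]] t by (simp add: \<phi>_sm[OF y z] flip: fsm[OF t y])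
        then show "\<Phi> t (y ^ q * z) = (\<lambda>j. y * \<Phi> t z j)"
          using inj_onD[OF inj[OF t]] \<Phi>[OF t z] \<Phi>[OF t fr.R_mult[OF fr.R_power[OF y] z]] fr.Cov_smult[OF y] by blast }
    qed
    show "fr.qlin_from (r (fst t)) (D (fst t)) (\<Psi> t)" unfolding fr.qlin_from_def
    proof (intro conjI ballI)
      fix m m' assume m: "m \<in> ?C t"
      show "\<Psi> t m \<in> fr.R" unfolding \<Psi>_def by (rule \<chi>(1)[OF fam_single[OF m]])
      { assume m': "m' \<in> ?C t"
        have "(\<lambda>s. if s = t then (\<lambda>j. m j + m' j) else (\<lambda>j. 0))
          = (\<lambda>s j. (if s = t then m else (\<lambda>j. 0)) j + (if s = t then m' else (\<lambda>j. 0)) j)" by (auto simp: fun_eq_iff)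
        then show "\<Psi> t (\<lambda>j. m j + m' j) = \<Psi> t m + \<Psi> t m'"
          unfolding \<Psi>_def using \<chi>_add[OF fam_single[OF m] fam_single[OF m']] by simp }
      fix s assume s: "s \<in> fr.R"
      have "(\<lambda>s'. if s' = t then (\<lambda>j. s * m j) else (\<lambda>j. 0)) = (\<lambda>s' j. s * (if s' = t then m else (\<lambda>j. 0)) j)"
        by (auto simp: fun_eq_iff)
      then show "\<Psi> t (\<lambda>j. s * m j) = s ^ q * \<Psi> t m"
        unfolding \<Psi>_def using \<chi>_sm[OF fam_single[OF m] s] by simp
    qed
  next
    fix y assume y: "y \<in> fr.R"
    have fam: "fam (\<lambda>t. \<Phi> t y)" using \<Phi>(1)[OF _ y] by (simp add: fam_def)
    have "\<phi> (cls y) = full (\<lambda>t. \<Phi> t y)"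
      unfolding full_def using \<Phi>(2)[OF _ y] \<phi>_C[OF y] by (auto simp: fun_eq_iff PiE_def extensional_def)
    from \<chi>_eq[OF fam y this] have "\<chi> (\<lambda>t. \<Phi> t y) = y" .
    moreover have "\<chi> (\<lambda>s. if s \<in> J then \<Phi> s y else (\<lambda>j. 0)) = \<chi> (\<lambda>t. \<Phi> t y)" by (rule \<chi>_cong) simp
    ultimately show "(\<Sum>t\<in>J. \<Psi> t (\<Phi> t y)) = y" using \<Psi>_sum[OF fam order_refl] by simp
  next
    fix w t j assume w: "\<And>t. t \<in> J \<Longrightarrow> w t \<in> ?C t" and 0: "(\<Sum>t\<in>J. \<Psi> t (w t)) = 0" and t: "t \<in> J"
    have fam: "fam w" using w by (simp add: fam_def)
    have "\<chi> (\<lambda>s. if s \<in> J then w s else (\<lambda>j. 0)) = \<chi> w" by (rule \<chi>_cong) simp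
    then have "\<chi> w = \<chi> (\<lambda>t j. 0)" using \<Psi>_sum[OF fam order_refl] 0 \<chi>_0 by simp
    then have "full w = full (\<lambda>t j. 0)" using \<chi>(2)[OF fam] \<chi>(2)[OF fam_0] by metis
    then have "full w t = full (\<lambda>t j. 0) t" by simp
    then have "?f t (w t) = ?f t (\<lambda>j. 0)" using t by (simp add: full_def)
    then have "w t = (\<lambda>j. 0)" using inj_onD[OF inj[OF t]] w[OF t] fr.Cov_0 by blast
    then show "w t j = 0" by simp
  qed
qed

text \<open>The upper bound is \<open>total_bound\<close> together with
  \<open>card Box = q ^ d\<close>. For the lower one, the monomials in \<open>Y\<close> stay
  independent after multiplication by \<open>dl\<close>; \<open>Xq_basis\<close> converts them into
  twisted covariants, and \<open>multiplicity_bound\<close>, with \<open>J0\<close> the copies of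
  \<open>M_i\<close>, compares the number of these with \<open>c i\<close>.\<close>

lemma frobenius_bounds:
  fixes Mo :: "nat \<Rightarrow> (('k, 'v) sym, 'm) module" and n e p :: nat and c r :: "nat \<Rightarrow> nat" and D
  assumes q: "q = p ^ e"
    and iso: "frobenius_multiplicities p IR n Mo e c"
    and f: "\<And>i. i \<le> n \<Longrightarrow> chart (fr.Cov (r i) (D i)) (Mo i) (f i)" and D: "\<And>i. i \<le> n \<Longrightarrow> fr.mrep (r i) (D i)"
    and schur0: "\<And>i i' Q j k. i \<le> n \<Longrightarrow> i' \<le> n \<Longrightarrow> i \<noteq> i' \<Longrightarrow> fr.intertwiner (r i) (D i) (r i') (D i') Q \<Longrightarrow>
        j < r i' \<Longrightarrow> k < r i \<Longrightarrow> Q j k = 0"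
    and schur1: "\<And>i Q. i \<le> n \<Longrightarrow> fr.intertwiner (r i) (D i) (r i) (D i) Q \<Longrightarrow>
        \<exists>c. \<forall>j<r i. \<forall>k<r i. Q j k = (if j = k then c else 0)"
    and cG: "of_nat (card G) \<noteq> (0::'k)"
  shows "(\<Sum>i\<le>n. c i * r i) \<le> q ^ d"
    and "i \<le> n \<Longrightarrow> r i * (\<Prod>j<d. q - Poly_Mapping.lookup (Min (Poly_Mapping.keys dl)) j) \<le> card G * c i"
proof -
  let ?J = "SIGMA i:{..n}. {..<c i}"
  obtain \<Phi> \<Psi> where \<Phi>: "\<And>t. t \<in> ?J \<Longrightarrow> fr.qlin_to (r (fst t)) (D (fst t)) (\<Phi> t)"
    and \<Psi>: "\<And>t. t \<in> ?J \<Longrightarrow> fr.qlin_from (r (fst t)) (D (fst t)) (\<Psi> t)"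
    and dec: "\<And>y. y \<in> fr.R \<Longrightarrow> (\<Sum>t\<in>?J. \<Psi> t (\<Phi> t y)) = y"
    and inj: "\<And>w t j. (\<And>t. t \<in> ?J \<Longrightarrow> w t \<in> fr.Cov (r (fst t)) (D (fst t))) \<Longrightarrow> (\<Sum>t\<in>?J. \<Psi> t (w t)) = 0 \<Longrightarrow> t \<in> ?J \<Longrightarrow> w t j = 0"
    by (rule isomorphism_families[OF q iso f]) auto
  have finJ: "finite ?J" by simp
  have DJ: "fr.mrep (r (fst t)) (D (fst t))" if "t \<in> ?J" for t using that D by auto
  have "(\<Sum>t\<in>?J. r (fst t)) \<le> card Box"
  proof (rule fr.total_bound[where D = "\<lambda>t. D (fst t)" and \<Psi> = \<Psi>])
    fix w :: "nat \<times> nat \<Rightarrow> nat \<Rightarrow> 'k mpoly" and t j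
    assume "\<And>t. t \<in> ?J \<Longrightarrow> w t \<in> fr.Cov (r (fst t)) (D (fst t))" "(\<Sum>t\<in>?J. \<Psi> t (w t)) = 0" "t \<in> ?J"
    then show "w t j = 0" by (rule inj)
  qed (use finJ DJ \<Psi> in blast)+
  moreover have "(\<Sum>t\<in>?J. r (fst t)) = (\<Sum>i\<le>n. \<Sum>j<c i. r i)"
    by (subst sum.Sigma) (auto simp: case_prod_beta)
  ultimately show "(\<Sum>i\<le>n. c i * r i) \<le> q ^ d" by (simp add: card_Box)
  assume i: "i \<le> n"
  let ?\<delta> = "Min (Poly_Mapping.keys dl)"
  define Y where "Y = {c. Poly_Mapping.keys c \<subseteq> {..<d} \<and> (\<forall>j<d. Poly_Mapping.lookup c j < q - Poly_Mapping.lookup ?\<delta> j)}"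
  have finY: "finite Y" and cardY: "card Y = (\<Prod>j<d. q - Poly_Mapping.lookup ?\<delta> j)"
    unfolding Y_def by (rule finite_bounded, rule card_bounded)
  have yS: "Poly_Mapping.single t 1 \<in> PS" if "t \<in> Y" for t using that by (intro PS_single) (simp add: Y_def)
  have ind: "u t = 0" if u: "\<And>a. a \<in> Box \<Longrightarrow> (\<Sum>t\<in>Y. u t * fr.kap a (dl * Poly_Mapping.single t 1)) = 0" and t: "t \<in> Y" for u t
    by (rule box_independent[OF fr.dl_S fr.dl_0, of u]) (use u t in \<open>simp_all add: fr.kap_def Y_def\<close>)
  have "\<exists>Z. finite Z \<and> Z \<subseteq> fr.Xq (r i) (D i) \<and> fr.k_independent (r i) Z \<and> r i * card Y \<le> card G * card Z"
  proof (rule fr.Xq_basis[OF D[OF i] finY, of "\<lambda>t. Poly_Mapping.single t 1"])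
    fix u t assume "\<And>a. a \<in> Box \<Longrightarrow> (\<Sum>t\<in>Y. u t * fr.kap a (dl * Poly_Mapping.single t 1)) = 0" "t \<in> Y"
    then show "u t = 0" by (rule ind)
  qed (use yS in blast)+
  then obtain Z where Z: "finite Z" "Z \<subseteq> fr.Xq (r i) (D i)" "fr.k_independent (r i) Z" "r i * card Y \<le> card G * card Z"
    by blast
  let ?K = "{i} \<times> {..<c i}"
  have "card Z \<le> card ?K"
  proof (rule fr.multiplicity_bound)
    show "finite ?J" by (rule finJ)
    show "fr.mrep (r i) (D i)" by (rule D[OF i])
    show "finite Z" "Z \<subseteq> fr.Xq (r i) (D i)" "fr.k_independent (r i) Z" by (rule Z)+
    show "?K \<subseteq> ?J" using i by auto
    show "of_nat (card G) \<noteq> (0::'k)" by (rule cG)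
  next
    fix t assume t: "t \<in> ?J"
    show "fr.mrep (r (fst t)) (D (fst t))" by (rule DJ[OF t])
    show "fr.qlin_to (r (fst t)) (D (fst t)) (\<Phi> t)" by (rule \<Phi>[OF t])
    show "fr.qlin_from (r (fst t)) (D (fst t)) (\<Psi> t)" by (rule \<Psi>[OF t])
  next
    fix y assume "y \<in> fr.R"
    then show "(\<Sum>t\<in>?J. \<Psi> t (\<Phi> t y)) = y" by (rule dec)
  next
    fix t Q j k assume "t \<in> ?J - ?K" "fr.intertwiner (r i) (D i) (r (fst t)) (D (fst t)) Q" "j < r (fst t)" "k < r i"
    moreover have "fst t \<le> n" "i \<noteq> fst t" using \<open>t \<in> ?J - ?K\<close> by (cases t; auto)+
    ultimately show "Q j k = 0" using schur0[of i "fst t" Q j k] i by blast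
  next
    fix t assume "t \<in> ?K"
    then show "r (fst t) = r i \<and> D (fst t) = D i" by auto
  next
    fix Q assume "fr.intertwiner (r i) (D i) (r i) (D i) Q"
    then show "\<exists>c. \<forall>j<r i. \<forall>k<r i. Q j k = (if j = k then c else 0)" by (rule schur1[OF i])
  qed
  then have "card Z \<le> c i" by simp
  then have "card G * card Z \<le> card G * c i" by (rule mult_le_mono2)
  from order_trans[OF Z(4) this] show "r i * (\<Prod>j<d. q - Poly_Mapping.lookup ?\<delta> j) \<le> card G * c i"
    by (simp only: cardY)
qed

end

section \<open>The limit of the multiplicities\<close>

text \<open>The lower bounds for \<open>j \<noteq> i\<close> are inserted into the bound for the
  weighted sum. With \<open>m\<close> the product in the lower bounds and \<open>q\<close> the power
  \<open>(p ^ e) ^ d\<close>, this leaves for \<open>c e i * r i\<close> at most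
  \<open>q - (N - r i * r i) * m / N\<close>. As \<open>m / q\<close> tends to 1, the two bounds for
  \<open>c e i / q\<close> meet at \<open>r i / N\<close>.\<close>

lemma multiplicity_limit:
  fixes c :: "nat \<Rightarrow> nat \<Rightarrow> nat" and r \<delta> :: "nat \<Rightarrow> nat" and N d n p i :: nat
  assumes p: "p \<ge> 2" and N: "N > 0" and i: "i \<le> n" "r i > 0" and squares: "N \<le> (\<Sum>j\<le>n. r j * r j)"
    and upper: "\<And>e. (\<Sum>j\<le>n. c e j * r j) \<le> (p ^ e) ^ d"
    and lower: "\<And>e j. j \<le> n \<Longrightarrow> r j * (\<Prod>k<d. p ^ e - \<delta> k) \<le> N * c e j"
  shows "(\<lambda>e. real (c e i) / real (p ^ (d * e))) \<longlonglongrightarrow> real (r i) / real N"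
proof -
  define m where "m e = (\<Prod>k<d. p ^ e - \<delta> k)" for e
  \<comment> \<open>Here \<open>q e\<close> is the full rank \<open>(p ^ e) ^ d\<close>, not the
    Frobenius exponent \<open>p ^ e\<close>.\<close>
  define q where "q e = real ((p ^ e) ^ d)" for e
  have q: "q e > 0" for e using p by (simp add: q_def)
  define \<mu> where "\<mu> e = real (m e) / q e" for e
  have factor: "(\<lambda>e. real (p ^ e - \<delta> k) / real (p ^ e)) \<longlonglongrightarrow> 1" for k
  proof (rule tendsto_sandwich)
    have "(\<lambda>e. (1 / real p) ^ e) \<longlonglongrightarrow> 0" by (rule LIMSEQ_power_zero) (use p in simp)
    then have "(\<lambda>e. 1 - real (\<delta> k) * (1 / real p) ^ e) \<longlonglongrightarrow> 1 - real (\<delta> k) * 0"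
      by (rule tendsto_diff[OF tendsto_const tendsto_mult[OF tendsto_const]])
    then show "(\<lambda>e. 1 - real (\<delta> k) * (1 / real p) ^ e) \<longlonglongrightarrow> 1"
      by (simp only: mult_zero_right diff_zero)
    show "\<forall>\<^sub>F e in sequentially. 1 - real (\<delta> k) * (1 / real p) ^ e \<le> real (p ^ e - \<delta> k) / real (p ^ e)"
    proof (rule always_eventually, rule allI)
      fix e
      have pe: "real (p ^ e) > 0" using p by simp
      have "1 - real (\<delta> k) * (1 / real p) ^ e = (real (p ^ e) - real (\<delta> k)) / real (p ^ e)"
        using pe by (simp add: diff_divide_distrib power_one_over)
      \<comment> \<open>Truncation of the natural subtraction at zero can only increase the
        right-hand side.\<close>
      also have "\<dots> \<le> real (p ^ e - \<delta> k) / real (p ^ e)"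
        using pe by (intro divide_right_mono) linarith+
      finally show "1 - real (\<delta> k) * (1 / real p) ^ e \<le> real (p ^ e - \<delta> k) / real (p ^ e)" .
    qed
    show "\<forall>\<^sub>F e in sequentially. real (p ^ e - \<delta> k) / real (p ^ e) \<le> 1"
    proof (rule always_eventually, rule allI)
      fix e
      have "real (p ^ e - \<delta> k) \<le> real (p ^ e)" by (rule of_nat_mono) simp
      then show "real (p ^ e - \<delta> k) / real (p ^ e) \<le> 1" using p by (simp add: divide_le_eq)
    qed
  qed simp
  have "(\<lambda>e. \<Prod>k<d. real (p ^ e - \<delta> k) / real (p ^ e)) \<longlonglongrightarrow> (\<Prod>k<d. 1)"
    by (intro tendsto_prod factor)
  moreover have "\<mu> = (\<lambda>e. \<Prod>k<d. real (p ^ e - \<delta> k) / real (p ^ e))"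
    by (rule ext) (simp add: \<mu>_def m_def q_def prod_dividef)
  ultimately have \<mu>: "\<mu> \<longlonglongrightarrow> 1" by (simp only: prod.neutral_const)
  have L: "(real (r i) / real N) * \<mu> e \<le> real (c e i) / q e" for e
  proof -
    have "real (r i * m e) \<le> real (N * c e i)" using lower[OF i(1), of e] unfolding m_def by (rule of_nat_mono)
    then have "real (r i) * real (m e) / real N \<le> real (c e i)" using N by (simp add: divide_le_eq mult.commute)
    then have "real (r i) * real (m e) / real N / q e \<le> real (c e i) / q e" using q[of e] by (intro divide_right_mono) auto
    then show ?thesis by (simp add: \<mu>_def mult.commute)
  qed
  have U: "real (c e i) / q e \<le> (real N - (real N - real (r i) * real (r i)) * \<mu> e) / (real N * real (r i))" for e
  proof -
    have split: "(\<Sum>j\<le>n. f j) = f i + (\<Sum>j\<in>{..n}-{i}. f j)" for f :: "nat \<Rightarrow> real"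
      using i(1) by (intro sum.remove) auto
    have "real (\<Sum>j\<le>n. c e j * r j) \<le> q e" using upper[of e] unfolding q_def by (rule of_nat_mono)
    then have 1: "real (c e i) * real (r i) + (\<Sum>j\<in>{..n}-{i}. real (c e j) * real (r j)) \<le> q e"
      using split[of "\<lambda>j. real (c e j) * real (r j)"] by simp
    have "real N \<le> real (\<Sum>j\<le>n. r j * r j)" using squares by (rule of_nat_mono)
    then have 2: "real N - real (r i) * real (r i) \<le> (\<Sum>j\<in>{..n}-{i}. real (r j) * real (r j))"
      using split[of "\<lambda>j. real (r j) * real (r j)"] by simp
    have "(real N - real (r i) * real (r i)) * real (m e) \<le> (\<Sum>j\<in>{..n}-{i}. real (r j) * real (r j)) * real (m e)"
      using 2 by (rule mult_right_mono) simp
    also have "\<dots> \<le> (\<Sum>j\<in>{..n}-{i}. real N * (real (c e j) * real (r j)))"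
      unfolding sum_distrib_right
    proof (rule sum_mono)
      fix j assume "j \<in> {..n}-{i}"
      then have "real (r j * m e) \<le> real (N * c e j)" using lower[of j e] unfolding m_def by (intro of_nat_mono) simp
      then have "real (r j * m e) * real (r j) \<le> real (N * c e j) * real (r j)" by (rule mult_right_mono) simp
      then show "real (r j) * real (r j) * real (m e) \<le> real N * (real (c e j) * real (r j))" by (simp add: mult_ac)
    qed
    also have "\<dots> = real N * (\<Sum>j\<in>{..n}-{i}. real (c e j) * real (r j))" by (simp add: sum_distrib_left)
    also have "\<dots> \<le> real N * (q e - real (c e i) * real (r i))" using 1 by (intro mult_left_mono) auto
    finally have "real N * real (r i) * real (c e i) \<le> real N * q e - (real N - real (r i) * real (r i)) * real (m e)"
      by (simp add: algebra_simps)
    then have "real (c e i) \<le> (real N * q e - (real N - real (r i) * real (r i)) * real (m e)) / (real N * real (r i))"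
      using N i(2) by (simp add: le_divide_eq mult.commute)
    then have "real (c e i) / q e \<le> (real N * q e - (real N - real (r i) * real (r i)) * real (m e)) / (real N * real (r i)) / q e"
      using q[of e] by (intro divide_right_mono) auto
    also have "\<dots> = (real N - (real N - real (r i) * real (r i)) * \<mu> e) / (real N * real (r i))"
      using q[of e] N i(2) by (simp add: \<mu>_def field_simps)
    finally show ?thesis .
  qed
  have "(\<lambda>e. real (c e i) / q e) \<longlonglongrightarrow> real (r i) / real N"
  proof (rule tendsto_sandwich[OF always_eventually always_eventually])
    show "\<forall>e. (real (r i) / real N) * \<mu> e \<le> real (c e i) / q e" using L by blast
    show "\<forall>e. real (c e i) / q e \<le> (real N - (real N - real (r i) * real (r i)) * \<mu> e) / (real N * real (r i))" using U by blast
    have "(\<lambda>e. (real (r i) / real N) * \<mu> e) \<longlonglongrightarrow> (real (r i) / real N) * 1" by (intro tendsto_intros \<mu>)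
    then show "(\<lambda>e. (real (r i) / real N) * \<mu> e) \<longlonglongrightarrow> real (r i) / real N" by simp
    have "(\<lambda>e. (real N - (real N - real (r i) * real (r i)) * \<mu> e) / (real N * real (r i)))
        \<longlonglongrightarrow> (real N - (real N - real (r i) * real (r i)) * 1) / (real N * real (r i))"
      by (intro tendsto_intros \<mu>) (use N i(2) in simp)
    moreover have "(real N - (real N - real (r i) * real (r i)) * 1) / (real N * real (r i)) = real (r i) / real N"
      using N i(2) by (simp add: field_simps)
    ultimately show "(\<lambda>e. (real N - (real N - real (r i) * real (r i)) * \<mu> e) / (real N * real (r i))) \<longlonglongrightarrow> real (r i) / real N"
      by (simp only:)
  qed
  moreover have "q e = real (p ^ (d * e))" for e unfolding q_def power_mult[symmetric] by (simp add: mult.commute)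
  ultimately show ?thesis by simp
qed

section \<open>Algebraically closed fields, characteristic, and elements of finite order\<close>

text \<open>Over a finite field the product of all \<open>X - a\<close>, increased by 1, takes the
  value 1 everywhere and has no root.\<close>

lemma infinite_alg_closed_field: "infinite (UNIV :: 'k::alg_closed_field set)"
proof
  assume fin: "finite (UNIV :: 'k set)"
  define P where "P = (\<Prod>a\<in>(UNIV :: 'k set). [:- a, 1:])"
  have "P \<noteq> 0" using fin by (auto simp: P_def)
  have "poly P a = 0" for a using fin by (simp add: P_def poly_prod prod_zero_iff)
  have deg: "degree P > 0"
  proof (rule ccontr)
    assume "\<not> degree P > 0"
    then obtain c where "P = [:c:]" using degree_eq_zeroE[of P] by blast
    then show False using \<open>P \<noteq> 0\<close> \<open>\<And>a. poly P a = 0\<close>[of 0] by simp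
  qed
  then have "degree (P + 1) = degree P" by (intro degree_add_eq_left) simp
  then obtain z where "poly (P + 1) z = 0" using alg_closed_imp_poly_has_root[of "P + 1"] deg by auto
  then show False using \<open>\<And>a. poly P a = 0\<close>[of z] by simp
qed

lemma CHAR_mpoly: "CHAR('k::field mpoly) = CHAR('k)"
proof (rule CHAR_eqI)
  have *: "Poly_Mapping.single 0 (of_nat n) = (of_nat n :: 'k mpoly)" for n by simp
  show "of_nat CHAR('k) = (0 :: 'k mpoly)" unfolding *[symmetric] by simp
  fix n assume "of_nat n = (0 :: 'k mpoly)"
  then have "Poly_Mapping.lookup (of_nat n :: 'k mpoly) 0 = 0" by simp
  then have "of_nat n = (0::'k)" by (simp add: lookup_of_nat)
  then show "CHAR('k) dvd n" by (simp add: of_nat_eq_0_iff_char_dvd)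
qed

text \<open>Two powers of \<open>g\<close> coincide, and cancelling bijections yields a finite
  order. The inverse is then a power of \<open>g\<close>, which gives closure under inverses without
  computing inverses in \<open>GL\<close>.\<close>

lemma finite_order:
  assumes fin: "finite G" and comp: "\<And>g h. g \<in> G \<Longrightarrow> h \<in> G \<Longrightarrow> g \<circ> h \<in> G" and id: "id \<in> G"
    and bij: "\<And>g. g \<in> G \<Longrightarrow> bij g" and g: "g \<in> G"
  shows "\<exists>m>0. (g ^^ m) = id" "inv_into UNIV g \<in> G"
proof -
  have pow: "g ^^ m \<in> G" for m by (induction m) (simp_all only: funpow.simps id comp g)
  have "\<not> inj (\<lambda>m. g ^^ m)"
  proof
    assume "inj (\<lambda>m. g ^^ m)"
    then have "infinite (range (\<lambda>m. g ^^ m))" by (rule range_inj_infinite)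
    moreover have "range (\<lambda>m. g ^^ m) \<subseteq> G" using pow by (rule image_subsetI)
    ultimately show False using finite_subset fin by blast
  qed
  then obtain a k where ak: "g ^^ a = g ^^ k" "a \<noteq> k" unfolding inj_def not_all not_imp by (elim exE conjE) (rule that)
  have ex: "\<exists>m>0. (g ^^ m) = id" if "g ^^ a = g ^^ k" "a < k" for a k
  proof -
    have k: "a + (k - a) = k" using that(2) by simp
    have "(g ^^ a) ((g ^^ (k - a)) x) = (g ^^ a) x" for x
    proof -
      have "(g ^^ a) ((g ^^ (k - a)) x) = (g ^^ (a + (k - a))) x" by (simp only: funpow_add comp_apply)
      also have "\<dots> = (g ^^ a) x" by (simp only: k that(1))
      finally show ?thesis .
    qed
    then have "(g ^^ (k - a)) x = x" for x by (rule injD[OF bij_is_inj[OF bij[OF pow[of a]]]])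
    then have "g ^^ (k - a) = id" unfolding id_def by (rule ext)
    moreover have "k - a > 0" using that(2) by simp
    ultimately show ?thesis by blast
  qed
  show "\<exists>m>0. (g ^^ m) = id"
  proof (cases "a < k")
    case True then show ?thesis by (rule ex[OF ak(1)])
  next
    case False
    then have "k < a" using ak(2) by simp
    then show ?thesis by (rule ex[OF ak(1)[symmetric]])
  qed
  then obtain m where m: "0 < m" "(g ^^ m) = id" by (elim exE conjE) (rule that)
  obtain l where "m = Suc l" using m(1) by (cases m) simp_all
  then have "g ((g ^^ l) x) = x" for x using fun_cong[OF m(2), of x] by (simp only: funpow.simps comp_apply id_apply)
  then have "inv_into UNIV g = g ^^ l" by (intro ext inv_f_eq[OF bij_is_inj[OF bij[OF g]]])
  then show "inv_into UNIV g \<in> G" by (simp only: pow)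
qed

theorem theorem3p4:
  fixes sV :: "'k::alg_closed_field \<Rightarrow> 'v::ab_group_add \<Rightarrow> 'v"
    and BV :: "'v set"
    and G :: "('v \<Rightarrow> 'v) set"
    and sW :: "'k \<Rightarrow> 'w::ab_group_add \<Rightarrow> 'w"
    and W :: "nat \<Rightarrow> 'w set"
    and \<rho> :: "nat \<Rightarrow> ('v \<Rightarrow> 'v) \<Rightarrow> 'w \<Rightarrow> 'w"
    and p d n :: nat
    and c :: "nat \<Rightarrow> nat \<Rightarrow> nat"
  assumes "Factorial_Ring.prime p" and "CHAR('k) = p"
    and "finite_dimensional_vector_space sV BV"
    and "vector_space.dim sV UNIV = d"
    and "subgroup G (GL sV)" and "finite G" and "\<not> p dvd card G"
    and "\<forall>g\<in>G. \<not> pseudo_reflection sV g"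
    and "vector_space sW"
    and "complete_irreducibles G sW n W \<rho>"
    and "vector_space.dim sW (W 0) = 1" and "\<forall>g\<in>G. \<forall>w\<in>W 0. \<rho> 0 g w = w"
    and "\<forall>e. frobenius_multiplicities p (invariant_ring sV G) n
               (\<lambda>i. covariants sV G sW (W i) (\<rho> i)) e (c e)"
  shows "\<forall>i\<le>n.
    (\<lambda>e. real (c e i) / real (p ^ (d * e)))
      \<longlonglongrightarrow> real (vector_space.dim sW (W i)) / real (card G) \<and>
    real (vector_space.dim sW (W i)) / real (card G) =
      real (module_rank (invariant_ring sV G) (covariants sV G sW (W i) (\<rho> i))) / real (card G)"
proof -
  note p = assms(1) and char = assms(2) and finG = assms(6)
  interpret V: finite_dimensional_vector_space sV BV by (rule assms(3))
  interpret W: vector_space sW by (rule assms(9))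
  have id: "id \<in> G" using subgroup.one_closed[OF assms(5)] by (simp add: GL_def)
  have comp: "g \<circ> h \<in> G" if "g \<in> G" "h \<in> G" for g h using subgroup.m_closed[OF assms(5) that] by (simp add: GL_def)
  have GLG: "Vector_Spaces.linear sV sV g" "bij g" if "g \<in> G" for g
    using subgroup.subset[OF assms(5)] that by (auto simp: GL_def)
  have order: "\<exists>m>0. (g ^^ m) = id" "inv_into UNIV g \<in> G" if "g \<in> G" for g
  proof -
    show "\<exists>m>0. (g ^^ m) = id" using finG comp id GLG(2) that by (rule finite_order(1))
    show "inv_into UNIV g \<in> G" using finG comp id GLG(2) that by (rule finite_order(2))
  qed
  interpret fg: finite_map_group G
  proof
    show "finite G" "id \<in> G" by (rule finG id)+
    fix g assume g: "g \<in> G"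
    show "bij g" "inv_into UNIV g \<in> G" by (rule GLG(2)[OF g] order(2)[OF g])+
    fix h assume "h \<in> G"
    with g show "g \<circ> h \<in> G" by (rule comp)
  qed
  obtain b cd where cd: "\<And>v. (\<Sum>j<d. sV (cd v j) (b j)) = v" "\<And>u v j. cd (u + v) j = cd u j + cd v j"
    "\<And>c u j. cd (sV c u) j = c * cd u j" "\<And>i j. i < d \<Longrightarrow> j < d \<Longrightarrow> cd (b i) j = (if i = j then 1 else 0)"
  proof -
    show thesis
    proof (rule V.finite_subspace_coordinates[OF V.finite_Basis V.independent_Basis V.span_Basis, unfolded assms(4)])
      fix e :: "nat \<Rightarrow> 'v" and co :: "'v \<Rightarrow> nat \<Rightarrow> 'k"
      assume e: "\<And>j. j < d \<Longrightarrow> e j \<in> UNIV" "\<And>u. u \<in> UNIV \<Longrightarrow> (\<Sum>j<d. sV (co u j) (e j)) = u"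
        "\<And>u v j. u \<in> UNIV \<Longrightarrow> v \<in> UNIV \<Longrightarrow> co (u + v) j = co u j + co v j"
        "\<And>c u j. u \<in> UNIV \<Longrightarrow> co (sV c u) j = c * co u j"
        "\<And>i j. i < d \<Longrightarrow> j < d \<Longrightarrow> co (e i) j = (if i = j then 1 else 0)"
      show thesis by (rule that[of co e]; rule e(2-); simp)
    qed
  qed
  interpret L: linear_coordinates sV d b cd by unfold_locales (rule cd; assumption)+
  have isetup: "invariant_setup L.PS sym_const L.aug G L.actP L.io"
  proof unfold_locales
    fix g assume g: "g \<in> G" "g \<noteq> id"
    obtain m where m: "m > 0" "(g ^^ m) = id" using order(1)[OF g(1)] by (elim exE conjE) (rule that)
    \<comment> \<open>Two values of \<open>g - id\<close> that are not proportional give coprime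
      linear forms.\<close>
    have "\<exists>x y. g x - x \<noteq> 0 \<and> (\<forall>c. g y - y \<noteq> sV c (g x - x))"
      by (rule L.no_reflection_vectors[OF GLG(1)[OF g(1)] GLG(2)[OF g(1)] m g(2) assms(8)[rule_format, OF g(1)]])
    then obtain x y where xy: "g x - x \<noteq> 0" "\<forall>c. g y - y \<noteq> sV c (g x - x)" by (elim exE conjE) (rule that)
    have "L.io (g x - x) \<noteq> 0" using L.io_inject[of "g x - x" 0] xy(1) by (auto simp: L.io_0)
    moreover have "\<forall>c. L.io (g x - x) dvd c * L.io (g y - y) \<longrightarrow> L.io (g x - x) dvd c"
      by (intro allI impI) (rule L.linear_form_cancel[OF xy(1) xy(2)[rule_format]])
    ultimately show "\<exists>x y. L.io (g x) - L.io x \<noteq> 0 \<and>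
        (\<forall>c. L.io (g x) - L.io x dvd c * (L.io (g y) - L.io y) \<longrightarrow> L.io (g x) - L.io x dvd c)"
      unfolding L.io_diff by (intro exI[of _ x] exI[of _ y] conjI)
  next
    have "\<exists>v. \<forall>g\<in>G. g \<noteq> id \<longrightarrow> g v \<noteq> v"
      by (rule L.generic_vector[OF finG GLG(1) infinite_alg_closed_field])
    then obtain v where v: "\<forall>g\<in>G. g \<noteq> id \<longrightarrow> g v \<noteq> v" by (elim exE) (rule that)
    show "\<exists>v. \<forall>g\<in>G. g \<noteq> id \<longrightarrow> L.io (g v) \<noteq> L.io v"
    proof (intro exI[of _ v] ballI impI notI)
      fix g assume "g \<in> G" "g \<noteq> id" "L.io (g v) = L.io v"
      then show False using v L.io_inject[of "g v" v] by simp
    qed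
  next
    fix g assume "g \<in> G"
    then show "L.actP g (L.io v) = L.io (g v)" for v by (rule L.actP_io[OF GLG(1)])
    show "L.actP (g \<circ> h) x = L.actP g (L.actP h x)" for h x using \<open>g \<in> G\<close> by (intro L.actP_comp GLG(1))
    show "x \<in> L.PS \<Longrightarrow> L.actP g x \<in> L.PS" for x using \<open>g \<in> G\<close> by (intro L.PS_actP GLG(1))
  qed (simp_all add: L.PS_1 L.PS_add L.PS_mult L.PS_uminus L.PS_const L.PS_io L.const_hom L.hom_add L.hom_mult
      L.algebra_homs L.aug_const L.aug_actP L.actP_const L.actP_id)
  obtain dl bl vl where gal: "invariant_galois L.PS sym_const L.aug G L.actP L.io dl bl vl"
  proof -
    interpret invariant_setup L.PS sym_const L.aug G L.actP L.io by (rule isetup)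
    show thesis
    proof (rule galois_coordinates)
      fix dl bl vl
      assume 1: "dl \<noteq> 0" "dl \<in> L.PS" "\<And>l. bl l \<in> L.PS" "vl \<in> L.PS"
        "\<And>x. x \<in> G \<Longrightarrow> (\<Sum>l<card G. L.actP x (vl ^ l) * bl l) = (if x = id then dl else 0)"
      show thesis by (rule that, unfold_locales) (fact 1)+
    qed
  qed
  define r where "r i = W.dim (W i)" for i
  have irr: "irreducible_representation sW G (W i) (\<rho> i)" if "i \<le> n" for i
    using assms(10) that by (simp add: complete_irreducibles_def)
  \<comment> \<open>The implication stands inside the existential so that one choice function covers
    all indices; basis and coordinates are chosen together as a pair.\<close>
  have "\<exists>f. i \<le> n \<longrightarrow> coordinate_representation G sW (W i) (\<rho> i) (r i) (fst f) (snd f)" for i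
  proof (cases "i \<le> n")
    case True
    obtain B where B: "finite B" "W.independent B" "W.span B = W i"
      by (rule W.irreducible_finite_basis[OF finG id comp irr[OF True]])
    show ?thesis
    proof (rule W.finite_subspace_coordinates[OF B])
      fix e :: "nat \<Rightarrow> 'w" and co :: "'w \<Rightarrow> nat \<Rightarrow> 'k"
      assume e: "\<And>j. j < W.dim (W i) \<Longrightarrow> e j \<in> W i" "\<And>u. u \<in> W i \<Longrightarrow> (\<Sum>j<W.dim (W i). sW (co u j) (e j)) = u"
        "\<And>u v j. u \<in> W i \<Longrightarrow> v \<in> W i \<Longrightarrow> co (u + v) j = co u j + co v j"
        "\<And>c u j. u \<in> W i \<Longrightarrow> co (sW c u) j = c * co u j"
        "\<And>k j. k < W.dim (W i) \<Longrightarrow> j < W.dim (W i) \<Longrightarrow> co (e k) j = (if k = j then 1 else 0)"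
      have rep: "Defs.representation sW G (W i) (\<rho> i)" using irr[OF True] by (simp add: irreducible_representation_def)
      have "coordinate_representation G sW (W i) (\<rho> i) (r i) e co"
        unfolding r_def by unfold_locales (fact rep e)+
      then show ?thesis by (intro exI[of _ "(e, co)"]) simp
    qed
  qed simp
  then obtain F where F: "\<And>i. i \<le> n \<Longrightarrow> coordinate_representation G sW (W i) (\<rho> i) (r i) (fst (F i)) (snd (F i))"
    by metis
  define e where "e i = fst (F i)" for i
  define co where "co i = snd (F i)" for i
  have cr: "coordinate_representation G sW (W i) (\<rho> i) (r i) (e i) (co i)" if "i \<le> n" for i
    using F[OF that] by (simp add: e_def co_def)
  define D where "D i = coordinate_representation.D (\<rho> i) (e i) (co i)" for i
  have mrep: "fg.mrep (r i) (D i)" if "i \<le> n" for i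
    unfolding D_def by (rule coordinate_representation.mrep_D[OF cr[OF that]])
  have "\<exists>f. i \<le> n \<longrightarrow> L.chart (invariant_setup.Cov L.PS sym_const G L.actP (r i) (D i)) (covariants sV G sW (W i) (\<rho> i)) f" for i
  proof (cases "i \<le> n")
    case True
    interpret c: coordinate_representation G sW "W i" "\<rho> i" "r i" "e i" "co i" by (rule cr[OF True])
    interpret t: tensor_coordinates sV d b cd G sW "W i" "\<rho> i" "r i" "e i" "co i"
      by (intro tensor_coordinates.intro L.linear_coordinates_axioms c.coordinate_representation_axioms
          tensor_coordinates_axioms.intro GLG(1))
    interpret s: invariant_setup L.PS sym_const L.aug G L.actP L.io by (rule isetup)
    \<comment> \<open>Invariant tensors and abstract covariants are the same vectors, both taken
      with respect to the basis \<open>e i\<close>.\<close>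
    have "t.covs = s.Cov (r i) (D i)"
      unfolding t.covs_def t.Sr_def s.Cov_def D_def by auto
    then show ?thesis using t.covariants_chart by auto
  qed simp
  then obtain f where chart: "\<And>i. i \<le> n \<Longrightarrow>
      L.chart (invariant_setup.Cov L.PS sym_const G L.actP (r i) (D i)) (covariants sV G sW (W i) (\<rho> i)) (f i)"
    by metis
  have schur0: "Q j k = 0"
    if ii: "i \<le> n" "i' \<le> n" "i \<noteq> i'" and Q: "fg.intertwiner (r i) (D i) (r i') (D i') Q" and jk: "j < r i'" "k < r i"
    for i i' Q j k
  proof -
    interpret A: coordinate_representation G sW "W i" "\<rho> i" "r i" "e i" "co i" by (rule cr[OF ii(1)])
    interpret B: coordinate_representation G sW "W i'" "\<rho> i'" "r i'" "e i'" "co i'" by (rule cr[OF ii(2)])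
    interpret two_representations G sW "W i" "\<rho> i" "r i" "e i" "co i" "W i'" "\<rho> i'" "r i'" "e i'" "co i'" ..
    show ?thesis
      by (rule schur_nonisomorphic[OF irr[OF ii(1)] irr[OF ii(2)] _ _ jk])
         (use Q assms(10) ii in \<open>auto simp: D_def complete_irreducibles_def\<close>)
  qed
  have rpos: "r i > 0" if "i \<le> n" for i
  proof (rule ccontr)
    interpret A: coordinate_representation G sW "W i" "\<rho> i" "r i" "e i" "co i" by (rule cr[OF that])
    assume "\<not> r i > 0"
    then have "u = 0" if "u \<in> W i" for u using A.co_expansion[OF that] by simp
    then show False using irr[OF that] A.U_0 unfolding irreducible_representation_def by blast
  qed
  have schur1: "\<exists>c. \<forall>j<r i. \<forall>k<r i. Q j k = (if j = k then c else 0)"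
    if i: "i \<le> n" and Q: "fg.intertwiner (r i) (D i) (r i) (D i) Q" for i Q
    using coordinate_representation.schur_scalar[OF cr[OF i] irr[OF i] _ matrix_eigenvector[OF rpos[OF i]]] Q
    unfolding D_def by blast
  have cG: "of_nat (card G) \<noteq> (0::'k)" using assms(7) char by (simp add: of_nat_eq_0_iff_char_dvd)
  have squares: "card G \<le> (\<Sum>i\<le>n. r i * r i)" by (rule sum_of_squares[OF cr assms(10) cG])
  have frob: "\<exists>rt. symmetric_frobenius sV d b cd (p ^ e) rt G dl bl vl" for e
  proof -
    let ?q = "p ^ e"
    have q: "?q > 0" using p by (simp add: prime_gt_0_nat)
    have add: "(x + y :: 'k) ^ ?q = x ^ ?q + y ^ ?q" for x y
      using freshmans_dream'[where 'a = 'k, of ?q e x y] p char by simp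
    have inj: "x = y" if "(x::'k) ^ ?q = y ^ ?q" for x y
    proof -
      have "(x - y) ^ ?q + y ^ ?q = x ^ ?q" using add[of "x - y" y] by simp
      then have "(x - y) ^ ?q = 0" using that by simp
      then show ?thesis by simp
    qed
    \<comment> \<open>\<open>k\<close> is perfect, and injectivity of Frobenius forces the chosen
      roots to be additive and multiplicative.\<close>
    have "\<exists>y::'k. y ^ ?q = x" for x using nth_root_exists[OF q, of x] by blast
    then obtain rt :: "'k \<Rightarrow> 'k" where rt: "\<And>x. rt x ^ ?q = x" by metis
    have "symmetric_frobenius sV d b cd ?q rt G dl bl vl"
    proof (intro symmetric_frobenius.intro frobenius_coordinates.intro L.linear_coordinates_axioms
        frobenius_coordinates_axioms.intro symmetric_frobenius_axioms.intro GLG(1) gal rt)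
      show "?q > 0" by (rule q)
      show "(x + y) ^ ?q = x ^ ?q + y ^ ?q" for x y :: "'k mpoly"
        using freshmans_dream'[where 'a = "'k mpoly", of ?q e x y] p char by (simp add: CHAR_mpoly)
      show "rt (a + a') = rt a + rt a'" for a a' by (rule inj) (simp only: add rt)
      show "rt (a * a') = rt a * rt a'" for a a' by (rule inj) (simp only: power_mult_distrib rt)
      show "rt (a ^ ?q) = a" for a by (rule inj) (simp only: rt)
    qed
    then show ?thesis by blast
  qed
  \<comment> \<open>\<open>dl\<close> was chosen without reference to \<open>e\<close>, so the shift
    in the lower bound is constant along the sequence.\<close>
  let ?\<delta> = "\<lambda>j. Poly_Mapping.lookup (Min (Poly_Mapping.keys dl)) j"
  have bounds: "(\<Sum>j\<le>n. c e j * r j) \<le> (p ^ e) ^ d"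
    "\<And>j. j \<le> n \<Longrightarrow> r j * (\<Prod>k<d. p ^ e - ?\<delta> k) \<le> card G * c e j" for e
  proof -
    obtain rt where sf: "symmetric_frobenius sV d b cd (p ^ e) rt G dl bl vl" using frob by blast
    interpret sf: symmetric_frobenius sV d b cd "p ^ e" rt G dl bl vl by (rule sf)
    have cov: "i \<le> n \<Longrightarrow> L.chart (sf.fr.Cov (r i) (D i)) (covariants sV G sW (W i) (\<rho> i)) (f i)" for i
      by (rule chart)
    note sf_bounds = sf.frobenius_bounds[where p = p and e = e and c = "c e" and r = r and D = D and f = f and n = n
            and Mo = "\<lambda>i. covariants sV G sW (W i) (\<rho> i)"]
    show "(\<Sum>j\<le>n. c e j * r j) \<le> (p ^ e) ^ d"
      by (rule sf_bounds(1); (rule refl assms(13)[rule_format] cov mrep schur0 schur1 cG; assumption)?)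
    show "r j * (\<Prod>k<d. p ^ e - ?\<delta> k) \<le> card G * c e j" if "j \<le> n" for j
      by (rule sf_bounds(2)[OF _ _ _ _ _ _ _ that]; (rule refl assms(13)[rule_format] cov mrep schur0 schur1 cG; assumption)?)
  qed
  have rank: "module_rank (invariant_ring sV G) (covariants sV G sW (W i) (\<rho> i)) = r i" if "i \<le> n" for i
  proof -
    \<comment> \<open>The rank does not involve \<open>e\<close>; exponent 0 gives an instance of
      the setting in which \<open>chart_rank\<close> is available.\<close>
    obtain rt where sf: "symmetric_frobenius sV d b cd (p ^ 0) rt G dl bl vl" using frob by blast
    interpret sf: symmetric_frobenius sV d b cd "p ^ 0" rt G dl bl vl by (rule sf)
    show ?thesis using chart[OF that] mrep[OF that] by (rule sf.chart_rank)
  qed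
  show ?thesis
  proof (intro allI impI conjI)
    fix i assume i: "i \<le> n"
    show "(\<lambda>e. real (c e i) / real (p ^ (d * e))) \<longlonglongrightarrow> real (W.dim (W i)) / real (card G)"
      using multiplicity_limit[OF prime_ge_2_nat[OF p] fg.card_G i rpos[OF i] squares bounds] by (simp add: r_def)
    show "real (W.dim (W i)) / real (card G) =
      real (module_rank (invariant_ring sV G) (covariants sV G sW (W i) (\<rho> i))) / real (card G)"
      by (simp add: rank[OF i] r_def)
  qed
qed

end
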